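(* For every $C^1$ smooth radial set $K\subseteq\mathbb{R}^n$ and every $\delta\in(0,1)$, the function $t\mapsto |C_\delta \overline{K_t}|_n$ is $C^1$ (for $t$ in a neighborhood of $0$), and $$\frac{\partial}{\partial t}|C_\delta\overline{K_t}|_n\bigg|_{t=0}=0.$$
   Context: $|\cdot|_n$ denotes $n$-dimensional Lebesgue measure and $|\cdot|$ the Euclidean norm. A radial set is a set of the form $K=\{0\}\cup\{x\in\mathbb{R}^n\setminus\{0\}: |x|\le\rho_K(x/|x|)\}$ where $\rho_K:S^{n-1}\to[0,\infty)$ is continuous; $\rho_K$ is called its radial function. A radial body is a radial set whose radial function is strictly positive. A radial set $K$ is called $C^\beta$ smooth if $\rho_K$ is $C^\beta$ on $S^{n-1}$. For a radial set $K$ and real $t$ near $0$ (so that $1+t\rho_K>0$), $K_t$ is the radial body with radial function $\rho_{K_t}(v)=1+t\rho_K(v)$, and $\overline{K_t}=K_t/|K_t|_n^{1/n}$. For $\delta\in(0,1)$ and a radial body (or convex body) $L$, $C_\delta L=\{x\in\mathbb{R}^n: |L\cap(L+x)|_n\ge\delta|L|_n\}$. *)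

theory Defs
  imports "HOL-Analysis.Analysis"
begin

definition radial_region :: "(real^'n \<Rightarrow> real) \<Rightarrow> (real^'n) set" where
  "radial_region \<rho> = {0} \<union> {x. x \<noteq> 0 \<and> norm x \<le> \<rho> (x /\<^sub>R norm x)}"

text \<open>Only the values of \<open>\<rho>\<close> on the unit sphere matter; they are determined by \<open>K\<close>
  (lemma \<open>is_radial_fun_unique\<close> below).\<close>

definition is_radial_fun :: "(real^'n) set \<Rightarrow> (real^'n \<Rightarrow> real) \<Rightarrow> bool" where
  "is_radial_fun K \<rho> \<longleftrightarrow>
     continuous_on (sphere 0 1) \<rho> \<and> (\<forall>v\<in>sphere 0 1. 0 \<le> \<rho> v) \<and> K = radial_region \<rho>"

definition radial_set :: "(real^'n) set \<Rightarrow> bool" where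
  "radial_set K \<longleftrightarrow> (\<exists>\<rho>. is_radial_fun K \<rho>)"

definition radial_fun :: "(real^'n) set \<Rightarrow> real^'n \<Rightarrow> real" where
  "radial_fun K = (SOME \<rho>. is_radial_fun K \<rho>)"

definition radial_body :: "(real^'n) set \<Rightarrow> bool" where
  "radial_body K \<longleftrightarrow> radial_set K \<and> (\<forall>v\<in>sphere 0 1. 0 < radial_fun K v)"

text \<open>\<open>C\<^sup>1\<close> functions on a subset of \<open>\<real>\<^sup>n\<close> (here the sphere) in the usual sense for
  submanifolds: near every point they extend to a \<open>C\<^sup>1\<close> function on an open set.\<close>

definition C1_on :: "(real^'n) set \<Rightarrow> (real^'n \<Rightarrow> real) \<Rightarrow> bool" where
  "C1_on S f \<longleftrightarrow>
     (\<forall>x\<in>S. \<exists>U g (g' :: real^'n \<Rightarrow> (real^'n) \<Rightarrow>\<^sub>L real).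
        open U \<and> x \<in> U \<and>
        (\<forall>y\<in>U. (g has_derivative blinfun_apply (g' y)) (at y)) \<and> continuous_on U g' \<and>
        (\<forall>y\<in>U \<inter> S. g y = f y))"

definition C1_smooth_radial_set :: "(real^'n) set \<Rightarrow> bool" where
  "C1_smooth_radial_set K \<longleftrightarrow> radial_set K \<and> C1_on (sphere 0 1) (radial_fun K)"

definition radial_perturbation :: "(real^'n) set \<Rightarrow> real \<Rightarrow> (real^'n) set" where
  "radial_perturbation K t = radial_region (\<lambda>v. 1 + t * radial_fun K v)"

definition volume_normalized :: "(real^'n) set \<Rightarrow> (real^'n) set" where
  "volume_normalized L = (\<lambda>x. x /\<^sub>R root CARD('n) (measure lebesgue L)) ` L"

definition convolution_body :: "real \<Rightarrow> (real^'n) set \<Rightarrow> (real^'n) set" where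
  "convolution_body \<delta> L =
     {x. measure lebesgue (L \<inter> (\<lambda>y. y + x) ` L) \<ge> \<delta> * measure lebesgue L}"

lemma scaleR_mem_radial_region:
  assumes "v \<in> sphere 0 1" "0 < r"
  shows "r *\<^sub>R v \<in> radial_region \<rho> \<longleftrightarrow> r \<le> \<rho> v"
  using assms by (auto simp: radial_region_def)

lemma is_radial_fun_unique:
  assumes "is_radial_fun K \<rho>" "is_radial_fun K \<sigma>" "v \<in> sphere 0 1"
  shows "\<rho> v = \<sigma> v"
proof -
  have "r \<le> \<rho> v \<longleftrightarrow> r \<le> \<sigma> v" if "0 < r" for r
    using assms that scaleR_mem_radial_region[of v r] unfolding is_radial_fun_def by metis
  moreover have "0 \<le> \<rho> v" "0 \<le> \<sigma> v"
    using assms by (auto simp: is_radial_fun_def)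
  ultimately show ?thesis
    by (metis antisym linorder_not_le order.order_iff_strict)
qed

lemma is_radial_fun_radial_fun:
  assumes "radial_set K"
  shows "is_radial_fun K (radial_fun K)"
  using assms unfolding radial_set_def radial_fun_def by (rule someI_ex)

lemma radial_perturbation_body:
  assumes K: "radial_set K" and pos: "\<And>v. v \<in> sphere 0 1 \<Longrightarrow> 0 < 1 + t * radial_fun K v"
  shows "radial_body (radial_perturbation K t)"
    and "v \<in> sphere 0 1 \<Longrightarrow> radial_fun (radial_perturbation K t) v = 1 + t * radial_fun K v"
proof -
  have *: "is_radial_fun (radial_perturbation K t) (\<lambda>v. 1 + t * radial_fun K v)"
    using is_radial_fun_radial_fun[OF K] pos
    by (auto simp: is_radial_fun_def radial_perturbation_def intro!: continuous_intros less_imp_le)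
  then have r: "radial_set (radial_perturbation K t)"
    by (auto simp: radial_set_def)
  have eq: "radial_fun (radial_perturbation K t) v = 1 + t * radial_fun K v"
    if "v \<in> sphere 0 1" for v
    using is_radial_fun_unique[OF is_radial_fun_radial_fun[OF r] * that] .
  then show "v \<in> sphere 0 1 \<Longrightarrow> radial_fun (radial_perturbation K t) v = 1 + t * radial_fun K v" .
  show "radial_body (radial_perturbation K t)"
    using r eq pos by (simp add: radial_body_def)
qed

end

theory Submission
  imports Defs
begin

text \<open>Let \<open>B\<close> be the unit ball, \<open>\<rho>\<close> the radial function of \<open>K\<close>, \<open>W(t)\<close> the volume of \<open>K\<^sub>t\<close> and
  \<open>V(t)\<close> the volume of \<open>{x. |K\<^sub>t \<inter> (K\<^sub>t + x)| \<ge> \<delta> W(t)}\<close>. By scaling, the function to be differentiated is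
  \<open>V(t) / W(t)\<close>. To say that \<open>v / \<lambda>\<close> lies in the convolution body of \<open>K\<^sub>t\<close>, where \<open>|v| = 1\<close>, is to say that
  \<open>G(t, \<lambda>, v) = |L \<inter> (L + v)| - \<delta> |L| \<ge> 0\<close> for the body \<open>L = \<lambda> K\<^sub>t\<close>. Thus both the parameter \<open>t\<close> and the
  distance from the origin become perturbations of a radial function, namely \<open>\<lambda> (1 + t \<rho>)\<close>, while
  the translation vector \<open>v\<close> stays fixed.

  In polar coordinates, the volume of \<open>L \<inter> E\<close> for a fixed set \<open>E\<close> varies with the radial function \<open>R\<close> of \<open>L\<close>
  only through those directions whose boundary point \<open>R(u) u\<close> lies in \<open>E\<close>. Letting both copies of \<open>L\<close>
  vary gives, with \<open>\<sigma>\<close> the cone measure of the sphere and \<open>n\<close> the dimension,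
  \[ \frac{d}{dh} |L_{R+hw} \cap (L_{R+hw} + v)| = n \int w R^{n-1} (1[Ru - v \in L] + 1[Ru + v \in L]) d\sigma(u) \]
  (lemma \<open>excess_has_derivative_line\<close>), and the right-hand side is continuous in all parameters (lemma
  \<open>tendsto_excess_slope\<close>). Both rest on dominated convergence and need that almost no boundary point of \<open>L\<close>
  lies on the boundary of \<open>L \<plusminus> v\<close>. For the ball these points lie in a hyperplane
  orthogonal to \<open>v\<close>; for a Lipschitz \<open>\<rho>\<close> and small \<open>t\<close>, every half of a great circle from \<open>-v\<close> to \<open>v\<close> still
  meets the exceptional set at most once, so the set is null (lemma \<open>exists_transversal_range\<close>). A \<open>C\<^sup>1\<close> function on
  the sphere is Lipschitz.

  At \<open>t = 0\<close> there is a critical \<open>\<lambda>\<^sub>0 > 1/2\<close> with \<open>G(0, \<lambda>\<^sub>0, v) = 0\<close> for all \<open>v\<close>, and \<open>G\<close> has positive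
  \<open>\<lambda>\<close>-derivative there: the lens \<open>\<lambda>\<^sub>0 B \<inter> (\<lambda>\<^sub>0 B + v)\<close> is covered by a spherical sector and its mirror image,
  with room to spare (lemma \<open>lens_lt_cap\<close>). Hence, for small \<open>t\<close>, \<open>G(t, \<lambda>, v) = 0\<close> has a unique root
  \<open>\<lambda> = r(t, v)\<close> near \<open>\<lambda>\<^sub>0\<close>, which is \<open>C\<^sup>1\<close> in \<open>t\<close> with bounds uniform in \<open>v\<close> (lemma \<open>level_set_radius\<close>). As
  \<open>V(t) = \<integral> r(t, v)\<^sup>-\<^sup>n d\<sigma>(v)\<close>, differentiation under the integral shows that \<open>V\<close> is \<open>C\<^sup>1\<close>. At \<open>t = 0\<close>, Fubini's theorem and rotation
  invariance evaluate the double integral for \<open>V'(0)\<close> (lemma \<open>integral_excess_slope\<close>):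
  \<open>V'(0) = n \<lambda>\<^sub>0\<^sup>-\<^sup>n \<integral>\<rho> d\<sigma> = (V(0) / W(0)) W'(0)\<close>, so the derivative of \<open>V / W\<close> vanishes.\<close>

abbreviation vol :: "'a::euclidean_space set \<Rightarrow> real" where
  "vol \<equiv> measure lborel"

section \<open>Polar coordinates\<close>

text \<open>The measure \<open>n s\<^sup>n\<^sup>-\<^sup>1 ds\<close> on the positive half-line, which gives \<open>{0<..a}\<close> mass \<open>a\<^sup>n\<close>.\<close>

definition radial_measure :: "nat \<Rightarrow> real measure" where
  "radial_measure n = density lborel (\<lambda>s. ennreal (n * s ^ (n - 1)) * indicator {0<..} s)"

text \<open>The cone measure of the unit sphere: a set of directions is measured by the volume of the
  cone over it in the unit ball. It equals surface measure divided by the dimension, and it is taken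
  as a measure on the whole space that is concentrated on the sphere.\<close>

definition cone_measure :: "'a::euclidean_space measure" where
  "cone_measure = distr (density lborel (indicator (cball 0 1))) borel sgn"

lemma sgn_borel_measurable [measurable]: "(sgn :: 'a::euclidean_space \<Rightarrow> 'a) \<in> borel_measurable borel"
  unfolding sgn_div_norm by measurable

lemma sets_radial_measure [measurable_cong, simp]: "sets (radial_measure n) = sets borel"
  and space_radial_measure [simp]: "space (radial_measure n) = UNIV"
  by (simp_all add: radial_measure_def)

lemma sets_cone_measure [measurable_cong, simp]: "sets cone_measure = sets borel"
  and space_cone_measure [simp]: "space cone_measure = UNIV"
  by (simp_all add: cone_measure_def)

lemma emeasure_radial_measure_Ioc:
  assumes "0 < n" "0 \<le> b" "b \<le> a"
  shows "emeasure (radial_measure n) {b<..a} = ennreal (a ^ n - b ^ n)"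
proof -
  have "emeasure (radial_measure n) {b<..a}
      = (\<integral>\<^sup>+s. ennreal (n * s ^ (n - 1)) * indicator {0<..} s * indicator {b<..a} s \<partial>lborel)"
    by (simp add: radial_measure_def emeasure_density)
  also have "\<dots> = (\<integral>\<^sup>+s. ennreal (n * s ^ (n - 1)) * indicator {b..a} s \<partial>lborel)"
    using AE_lborel_singleton[of b] assms
    by (intro nn_integral_cong_AE) (auto elim!: eventually_mono split: split_indicator)
  also have "\<dots> = ennreal (a ^ n - b ^ n)"
    using assms by (intro nn_integral_FTC_Icc) (auto intro!: derivative_eq_intros)
  finally show ?thesis .
qed

lemma indicator_cball_measurable [measurable]:
  "(indicator (cball a r) :: 'a::euclidean_space \<Rightarrow> ennreal) \<in> borel_measurable borel"
  by (intro borel_measurable_indicator borel_closed closed_cball)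

lemma emeasure_radial_measure_ray:
  assumes [measurable]: "A \<in> sets (borel :: 'a::euclidean_space measure)"
  shows "emeasure (radial_measure n) {s. s *\<^sub>R v \<in> A}
    = (\<integral>\<^sup>+s. ennreal (n * s ^ (n - 1)) * indicator {0<..} s * indicator A (s *\<^sub>R v) \<partial>lborel)"
  unfolding radial_measure_def
  by (subst emeasure_density) (auto intro!: nn_integral_cong split: split_indicator)

lemma measurable_emeasure_radial_measure [measurable]:
  assumes [measurable]: "A \<in> sets (borel :: 'a::euclidean_space measure)"
  shows "(\<lambda>v. emeasure (radial_measure n) {s. s *\<^sub>R v \<in> A}) \<in> borel_measurable borel"
  unfolding emeasure_radial_measure_ray[OF assms] by measurable

lemma AE_radial_measure_pos: "AE s in radial_measure n. 0 < s"
  unfolding radial_measure_def by (subst AE_density) (auto split: split_indicator)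

lemma emeasure_cone_measure:
  assumes [measurable]: "A \<in> sets (borel :: 'a::euclidean_space measure)"
  shows "emeasure cone_measure A = emeasure lborel {z\<in>cball 0 1. sgn z \<in> A}"
proof -
  have [measurable]: "sgn -` A \<in> sets borel"
    using measurable_sets[OF sgn_borel_measurable assms] by simp
  have "{z\<in>cball 0 1. sgn z \<in> A} = cball 0 1 \<inter> sgn -` A" by auto
  moreover have "cball 0 1 \<inter> sgn -` A \<in> sets borel" by measurable
  ultimately show ?thesis
    unfolding cone_measure_def
    by (subst emeasure_distr, simp, simp, subst emeasure_density) (simp_all flip: indicator_inter_arith)
qed

lemma finite_measure_cone_measure: "finite_measure (cone_measure :: 'a::euclidean_space measure)"
proof
  have "emeasure (cone_measure :: 'a measure) UNIV = emeasure lborel (cball 0 1 :: 'a set)"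
    by (subst emeasure_cone_measure) (auto intro!: arg_cong[of _ _ "emeasure lborel"])
  also have "\<dots> < \<infinity>"
    using emeasure_lborel_cball_finite by blast
  finally show "emeasure (cone_measure :: 'a measure) (space cone_measure) \<noteq> \<infinity>" by simp
qed

lemma AE_cone_measure_norm: "AE v in (cone_measure :: 'a::euclidean_space measure). norm v = 1"
proof (rule AE_I')
  have *: "{v::'a. norm v \<noteq> 1} \<in> sets borel" by measurable
  have "{z\<in>cball 0 1. sgn z \<in> {v::'a. norm v \<noteq> 1}} = {0}"
    by (auto simp: norm_sgn split: if_splits)
  then have "emeasure cone_measure {v::'a. norm v \<noteq> 1} = 0"
    by (subst emeasure_cone_measure[OF *]) simp
  then show "{v::'a. norm v \<noteq> 1} \<in> null_sets cone_measure"
    using * by (auto simp: null_sets_def)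
qed auto

text \<open>Lebesgue measure is the image of the product of the cone measure and the radial measure
  under \<open>(v, s) \<mapsto> s v\<close>. Rescaling the inner variable by \<open>norm z\<close>, exchanging the integrals and substituting
  \<open>w = u z\<close> turns the right-hand side into the integral over \<open>w \<in> A\<close> of
  \<open>(norm w)\<^sup>n\<close> times the integral of \<open>n / u\<^sup>n\<^sup>+\<^sup>1\<close> over \<open>u \<ge> norm w\<close>, which is \<open>1\<close>.\<close>

lemma emeasure_lborel_polar:
  assumes A[measurable]: "A \<in> sets (borel :: 'a::euclidean_space measure)"
  shows "emeasure lborel A =
    (\<integral>\<^sup>+v. emeasure (radial_measure DIM('a)) {s. s *\<^sub>R v \<in> A} \<partial>cone_measure)"
proof -
  let ?n = "DIM('a)"
  have n: "?n > 0" by simp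
  let ?f = "\<lambda>(z::'a) (u::real). indicator (cball 0 1) z * (ennreal (norm z ^ ?n) *
    (ennreal (?n * u ^ (?n - 1)) * indicator {0<..} u * indicator A (u *\<^sub>R z)))"
  let ?h = "\<lambda>(w::'a) (u::real). indicator A w * (ennreal (norm w ^ ?n) *
    (ennreal (?n / u ^ (?n + 1)) * indicator {0<..} u * indicator {norm w..} u))"
  let ?h' = "\<lambda>(w::'a) (u::real). indicator A w * (ennreal (norm w ^ ?n) *
    (ennreal (?n / u ^ (?n + 1)) * indicator {0<..} u * (if norm w \<le> u then 1 else 0))) :: ennreal"
  define I where "I = (\<lambda>v::'a. emeasure (radial_measure ?n) {s. s *\<^sub>R v \<in> A})"
  have I: "I v = (\<integral>\<^sup>+s. ennreal (?n * s ^ (?n - 1)) * indicator {0<..} s * indicator A (s *\<^sub>R v) \<partial>lborel)" for v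
    unfolding I_def by (rule emeasure_radial_measure_ray) fact
  have [measurable]: "I \<in> borel_measurable borel"
    unfolding I by measurable
  have "(\<integral>\<^sup>+v. I v \<partial>cone_measure) = (\<integral>\<^sup>+z. indicator (cball 0 1) z * I (sgn z) \<partial>lborel)"
    unfolding cone_measure_def by (subst nn_integral_distr, simp, simp, subst nn_integral_density) auto
  also have "\<dots> = (\<integral>\<^sup>+z. (\<integral>\<^sup>+u. ?f z u \<partial>lborel) \<partial>lborel)"
  proof (rule nn_integral_cong_AE, use AE_lborel_singleton[of "0::'a"] in eventually_elim)
    fix z :: 'a assume z: "z \<noteq> 0"
    let ?k = "\<lambda>s::real. ennreal (?n * s ^ (?n - 1)) * indicator {0<..} s * indicator A (s *\<^sub>R sgn z)"
    have "I (sgn z) = ennreal \<bar>norm z\<bar> * (\<integral>\<^sup>+u. ?k (0 + norm z * u) \<partial>lborel)"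
      unfolding I using z by (subst nn_integral_real_affine[where t=0 and c="norm z"]) auto
    also have "\<dots> = (\<integral>\<^sup>+u. ennreal (norm z) * ?k (norm z * u) \<partial>lborel)"
      by (subst nn_integral_cmult) auto
    also have "\<dots> = (\<integral>\<^sup>+u. ennreal (norm z ^ ?n) * (ennreal (?n * u ^ (?n - 1))
       * indicator {0<..} u * indicator A (u *\<^sub>R z)) \<partial>lborel)"
    proof (intro nn_integral_cong)
      fix u :: real
      have 1: "(norm z * u) *\<^sub>R sgn z = u *\<^sub>R z" using z by (simp add: sgn_div_norm)
      have 2: "0 < norm z * u \<longleftrightarrow> 0 < u" using z by (simp add: zero_less_mult_iff)
      have 3: "norm z * (?n * (norm z * u) ^ (?n - 1)) = norm z ^ ?n * (?n * u ^ (?n - 1))"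
        using n by (cases ?n) (auto simp: power_mult_distrib)
      show "ennreal (norm z) * ?k (norm z * u) = ennreal (norm z ^ ?n) * (ennreal (?n * u ^ (?n - 1))
       * indicator {0<..} u * indicator A (u *\<^sub>R z))"
        using 2 3 unfolding 1 by (auto split: split_indicator simp flip: ennreal_mult)
    qed
    finally show "indicator (cball 0 1) z * I (sgn z) = (\<integral>\<^sup>+u. ?f z u \<partial>lborel)"
      by (simp add: nn_integral_cmult)
  qed
  also have "\<dots> = (\<integral>\<^sup>+u. (\<integral>\<^sup>+z. ?f z u \<partial>lborel) \<partial>lborel)"
    by (rule lborel_pair.Fubini') measurable
  also have "\<dots> = (\<integral>\<^sup>+u. (\<integral>\<^sup>+w. ?h w u \<partial>lborel) \<partial>lborel)"
  proof (rule nn_integral_cong)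
    fix u :: real
    show "(\<integral>\<^sup>+z. ?f z u \<partial>lborel) = (\<integral>\<^sup>+w. ?h w u \<partial>lborel)"
    proof (cases "0 < u")
      case False
      then show ?thesis by simp
    next
      case True
      have "(\<integral>\<^sup>+z. ?f z u \<partial>lborel)
       = (\<integral>\<^sup>+w. ennreal (\<bar>1/u\<bar> ^ ?n) * ?f (0 + (1/u) *\<^sub>R w) u \<partial>lborel)"
        by (subst lborel_affine[of "1/u" 0]) (use True in \<open>auto simp: nn_integral_density nn_integral_distr\<close>)
      also have "\<dots> = (\<integral>\<^sup>+w. ?h w u \<partial>lborel)"
      proof (rule nn_integral_cong)
        fix w :: 'a
        have 1: "indicator (cball 0 1) ((1/u) *\<^sub>R w) = (indicator {norm w..} u :: ennreal)"
          using True by (auto split: split_indicator simp: field_simps)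
        have 3: "(\<bar>1/u\<bar> ^ ?n) * (norm ((1/u) *\<^sub>R w) ^ ?n * (?n * u ^ (?n - 1))) = norm w ^ ?n * (?n / u ^ (?n + 1))"
          using n True by (cases ?n) (auto simp: power_mult_distrib field_simps)
        have 4: "ennreal (\<bar>1/u\<bar> ^ ?n) * (ennreal (norm ((1/u) *\<^sub>R w) ^ ?n) * ennreal (?n * u ^ (?n - 1))) =
           ennreal (norm w ^ ?n) * ennreal (?n / u ^ (?n + 1))"
          using 3 True by (simp flip: ennreal_mult)
        show "ennreal (\<bar>1/u\<bar> ^ ?n) * ?f (0 + (1/u) *\<^sub>R w) u = ?h w u"
          unfolding add_0 1 using 4 True by (auto split: split_indicator)
      qed
      finally show ?thesis .
    qed
  qed
  also have "\<dots> = (\<integral>\<^sup>+w. (\<integral>\<^sup>+u. ?h w u \<partial>lborel) \<partial>lborel)"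
  proof (rule lborel_pair.Fubini')
    have "(\<lambda>(x::'a, y::real). ?h' x y) \<in> borel_measurable (lborel \<Otimes>\<^sub>M lborel)"
      by measurable
    also have "(\<lambda>(x::'a, y::real). ?h' x y) = (\<lambda>(x, y). ?h x y)"
      by (auto simp: fun_eq_iff split: split_indicator)
    finally show "(\<lambda>(x::'a, y::real). ?h x y) \<in> borel_measurable (lborel \<Otimes>\<^sub>M lborel)" .
  qed
  also have "\<dots> = (\<integral>\<^sup>+w. indicator A w \<partial>lborel)"
  proof (rule nn_integral_cong_AE, use AE_lborel_singleton[of "0::'a"] in eventually_elim)
    fix w :: 'a assume w: "w \<noteq> 0"
    have "(\<integral>\<^sup>+u. ennreal (?n / u ^ (?n + 1)) * indicator {0<..} u * indicator {norm w..} u \<partial>lborel)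
       = (\<integral>\<^sup>+u. ennreal (?n / u ^ (?n + 1)) * indicator {norm w..} u \<partial>lborel)"
      using w by (intro nn_integral_cong) (auto split: split_indicator simp: not_less dest: order_trans)
    also have "\<dots> = ennreal (0 - (- 1 / norm w ^ ?n))"
    proof (rule nn_integral_FTC_atLeast)
      fix x assume x: "norm w \<le> x"
      then have "x > 0" using w by (smt (verit) zero_less_norm_iff)
      then show "((\<lambda>u. - 1 / u ^ ?n) has_real_derivative ?n / x ^ (?n + 1)) (at x)"
        using n by (cases ?n) (auto intro!: derivative_eq_intros simp: field_simps power2_eq_square,
            metis mult.commute power_minus_mult neq0_conv One_nat_def)
      show "0 \<le> ?n / x ^ (?n + 1)" using \<open>x > 0\<close> by simp
    next
      show "((\<lambda>u. - 1 / u ^ ?n) \<longlongrightarrow> (0::real)) at_top"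
        using n by (intro tendsto_divide_0[OF tendsto_const] filterlim_pow_at_top
            filterlim_at_top_imp_at_infinity filterlim_ident)
    qed measurable
    finally have "ennreal (norm w ^ ?n) * (\<integral>\<^sup>+u. ennreal (?n / u ^ (?n + 1)) * indicator {0<..} u * indicator {norm w..} u \<partial>lborel) = 1"
      using w by (simp flip: ennreal_mult)
    then show "(\<integral>\<^sup>+u. ?h w u \<partial>lborel) = indicator A w"
      by (subst nn_integral_cmult, measurable, subst nn_integral_cmult, measurable)
  qed
  also have "\<dots> = emeasure lborel A" by simp
  finally show ?thesis unfolding I_def ..
qed

section \<open>Volume of a radial body inside a set\<close>

lemma abs_power_diff_le:
  fixes a b c :: real
  assumes "\<bar>a\<bar> \<le> c" "\<bar>b\<bar> \<le> c"
  shows "\<bar>a ^ n - b ^ n\<bar> \<le> n * c ^ (n - 1) * \<bar>a - b\<bar>"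
proof -
  have c: "0 \<le> c" using assms by linarith
  have "\<bar>\<Sum>i<n. b ^ (n - Suc i) * a ^ i\<bar> \<le> (\<Sum>i<n. \<bar>b ^ (n - Suc i) * a ^ i\<bar>)"
    by (rule sum_abs)
  also have "\<dots> \<le> (\<Sum>i<n. c ^ (n - 1))"
  proof (rule sum_mono)
    fix i assume "i \<in> {..<n}"
    then have "n - 1 = (n - Suc i) + i" by auto
    then have "c ^ (n - 1) = c ^ (n - Suc i) * c ^ i" by (simp add: power_add)
    moreover have "\<bar>b\<bar> ^ (n - Suc i) * \<bar>a\<bar> ^ i \<le> c ^ (n - Suc i) * c ^ i"
      using assms c by (intro mult_mono power_mono) auto
    ultimately show "\<bar>b ^ (n - Suc i) * a ^ i\<bar> \<le> c ^ (n - 1)"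
      by (simp add: abs_mult power_abs)
  qed
  finally have "\<bar>a - b\<bar> * \<bar>\<Sum>i<n. b ^ (n - Suc i) * a ^ i\<bar> \<le> \<bar>a - b\<bar> * (\<Sum>i<n. c ^ (n - 1))"
    by (intro mult_left_mono) auto
  then show ?thesis
    unfolding power_diff_sumr2 abs_mult by (simp add: mult_ac)
qed

interpretation cone_measure: finite_measure "cone_measure :: 'a::euclidean_space measure"
  by (rule finite_measure_cone_measure)

text \<open>The radial mass of the part of \<open>E\<close> on the ray in direction \<open>v\<close> up to distance \<open>a\<close>.\<close>

definition ray_measure :: "'a::euclidean_space set \<Rightarrow> 'a \<Rightarrow> real \<Rightarrow> real" where
  "ray_measure E v a = measure (radial_measure DIM('a)) ({0<..a} \<inter> {s. s *\<^sub>R v \<in> E})"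

lemma ray_sets [measurable]:
  fixes v :: "'a::euclidean_space"
  assumes [measurable]: "E \<in> sets borel"
  shows "{s::real. s *\<^sub>R v \<in> E} \<in> sets borel"
  using measurable_sets[of "\<lambda>s::real. s *\<^sub>R v" borel borel E] by (simp add: vimage_def)

lemma emeasure_ray_finite:
  fixes v :: "'a::euclidean_space"
  assumes "E \<in> sets borel" "0 \<le> b"
  shows "emeasure (radial_measure DIM('a)) ({b<..a} \<inter> {s. s *\<^sub>R v \<in> E}) \<noteq> \<infinity>"
proof -
  have "emeasure (radial_measure DIM('a)) ({b<..a} \<inter> {s. s *\<^sub>R v \<in> E})
     \<le> emeasure (radial_measure DIM('a)) {b<..max b a}"
    by (intro emeasure_mono) auto
  also have "\<dots> < \<infinity>" using assms by (subst emeasure_radial_measure_Ioc) auto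
  finally show ?thesis by simp
qed

lemma measure_radial_measure_Ioc:
  assumes "0 < n" "0 \<le> b" "b \<le> a"
  shows "measure (radial_measure n) {b<..a} = a ^ n - b ^ n"
  using assms by (simp add: measure_def emeasure_radial_measure_Ioc power_mono)

lemma ray_measure_diff:
  fixes v :: "'a::euclidean_space"
  assumes E: "E \<in> sets borel" and ab: "0 \<le> b" "b \<le> a"
  shows "ray_measure E v a - ray_measure E v b =
    measure (radial_measure DIM('a)) ({b<..a} \<inter> {s. s *\<^sub>R v \<in> E})"
proof -
  have *: "{0<..a} \<inter> {s. s *\<^sub>R v \<in> E} = ({0<..b} \<inter> {s. s *\<^sub>R v \<in> E}) \<union> ({b<..a} \<inter> {s. s *\<^sub>R v \<in> E})"
    using ab by auto
  have "ray_measure E v a = ray_measure E v b + measure (radial_measure DIM('a)) ({b<..a} \<inter> {s. s *\<^sub>R v \<in> E})"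
    unfolding ray_measure_def *
    by (rule measure_Union) (use E ab emeasure_ray_finite[OF E] in auto)
  then show ?thesis by simp
qed

lemma ray_measure_diff_bounds:
  fixes v :: "'a::euclidean_space"
  assumes E: "E \<in> sets borel" and ab: "0 \<le> b" "b \<le> a"
  shows "0 \<le> ray_measure E v a - ray_measure E v b"
    and "ray_measure E v a - ray_measure E v b \<le> a ^ DIM('a) - b ^ DIM('a)"
proof -
  show "0 \<le> ray_measure E v a - ray_measure E v b"
    unfolding ray_measure_diff[OF assms] by simp
  have "measure (radial_measure DIM('a)) ({b<..a} \<inter> {s. s *\<^sub>R v \<in> E}) \<le> measure (radial_measure DIM('a)) {b<..a}"
    using E ab by (intro measure_mono_fmeasurable fmeasurableI)
      (auto simp: emeasure_radial_measure_Ioc)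
  then show "ray_measure E v a - ray_measure E v b \<le> a ^ DIM('a) - b ^ DIM('a)"
    unfolding ray_measure_diff[OF assms] using ab by (simp add: measure_radial_measure_Ioc)
qed

lemma ray_measure_abs_diff_le:
  fixes v :: "'a::euclidean_space"
  assumes E: "E \<in> sets borel" and ab: "0 \<le> b" "0 \<le> a"
  shows "\<bar>ray_measure E v a - ray_measure E v b\<bar> \<le> \<bar>a ^ DIM('a) - b ^ DIM('a)\<bar>"
  using ray_measure_diff_bounds[OF E, of a b v] ray_measure_diff_bounds[OF E, of b a v] ab
  by linarith

lemma ray_measure_diff_const:
  fixes v :: "'a::euclidean_space"
  assumes E: "E \<in> sets borel" and ab: "0 \<le> b" "0 \<le> a"
    and k: "\<And>s. min a b \<le> s \<Longrightarrow> s \<le> max a b \<Longrightarrow> indicator E (s *\<^sub>R v) = k" "k = 0 \<or> k = (1::real)"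
  shows "ray_measure E v a - ray_measure E v b = k * (a ^ DIM('a) - b ^ DIM('a))"
proof -
  have *: "ray_measure E v y - ray_measure E v x = k * (y ^ DIM('a) - x ^ DIM('a))"
    if "0 \<le> x" "x \<le> y" "min a b = x" "max a b = y" for x y
  proof -
    have "{x<..y} \<inter> {s. s *\<^sub>R v \<in> E} = (if k = 1 then {x<..y} else {})"
      using k that by (fastforce simp: indicator_def)
    then show ?thesis
      unfolding ray_measure_diff[OF E that(1,2)] using that k(2) by (auto simp: measure_radial_measure_Ioc)
  qed
  show ?thesis
  proof (cases "b \<le> a")
    case True then show ?thesis using *[of b a] ab by auto
  next
    case False
    then have "ray_measure E v b - ray_measure E v a = k * (b ^ DIM('a) - a ^ DIM('a))"
      using *[of a b] ab by auto
    then show ?thesis by (simp add: algebra_simps)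
  qed
qed

lemma ray_measure_bounds:
  fixes v :: "'a::euclidean_space"
  assumes E: "E \<in> sets borel" and ab: "0 \<le> a"
  shows "0 \<le> ray_measure E v a" "ray_measure E v a \<le> a ^ DIM('a)"
  using ray_measure_diff_bounds[OF E, of 0 a v] ab by (simp_all add: ray_measure_def power_0_left)

lemma ray_measure_measurable:
  fixes R :: "'a::euclidean_space \<Rightarrow> real"
  assumes [measurable]: "E \<in> sets borel" "R \<in> borel_measurable borel"
  shows "(\<lambda>v. ray_measure E v (R v)) \<in> borel_measurable borel"
proof -
  have "ray_measure E v (R v) = enn2real (\<integral>\<^sup>+s. ennreal (DIM('a) * s ^ (DIM('a) - 1)) * indicator {0<..} s *
      (if s \<le> R v then 1 else 0) * indicator E (s *\<^sub>R v) \<partial>lborel)" for v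
  proof -
    have "emeasure (radial_measure DIM('a)) ({0<..R v} \<inter> {s. s *\<^sub>R v \<in> E}) =
      (\<integral>\<^sup>+s. ennreal (DIM('a) * s ^ (DIM('a) - 1)) * indicator {0<..} s * indicator ({0<..R v} \<inter> {s. s *\<^sub>R v \<in> E}) s \<partial>lborel)"
      unfolding radial_measure_def by (subst emeasure_density) auto
    also have "\<dots> = (\<integral>\<^sup>+s. ennreal (DIM('a) * s ^ (DIM('a) - 1)) * indicator {0<..} s *
      (if s \<le> R v then 1 else 0) * indicator E (s *\<^sub>R v) \<partial>lborel)"
      by (intro nn_integral_cong) (auto split: split_indicator)
    finally show ?thesis unfolding ray_measure_def measure_def by simp
  qed
  then show ?thesis by simp
qed

text \<open>The radial functions \<open>l + m p(v)\<close> are perturbations of a constant by a multiple of a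
  bounded Lipschitz function. To avoid the singularity of \<open>p(x / norm x)\<close> at the origin, \<open>p\<close> is defined
  on the whole space, and it is constant along rays only at distance at least \<open>1/4\<close> from the origin;
  the bodies considered below have radius at least \<open>1/4\<close> in every direction.\<close>

locale radial_profile =
  fixes p :: "'a::euclidean_space \<Rightarrow> real" and M \<Lambda> :: real
  assumes bound: "\<bar>p y\<bar> \<le> M"
    and lipschitz: "\<bar>p x - p y\<bar> \<le> \<Lambda> * norm (x - y)"
    and Lambda_nonneg: "0 \<le> \<Lambda>"
    and radial: "1/4 \<le> norm y \<Longrightarrow> p (sgn y) = p y"
begin

lemma M_nonneg: "0 \<le> M"
  using bound[of 0] by linarith

lemma continuous_p: "continuous_on UNIV p"
proof (rule lipschitz_on_continuous_on)
  show "\<Lambda>-lipschitz_on UNIV p"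
    using lipschitz Lambda_nonneg by (auto simp: lipschitz_on_def dist_norm)
qed

lemma continuous_p' [continuous_intros]: "continuous_on S f \<Longrightarrow> continuous_on S (\<lambda>x. p (f x))"
  using continuous_on_compose2[OF continuous_p] by blast

lemma tendsto_p [tendsto_intros]: "(f \<longlongrightarrow> l) F \<Longrightarrow> ((\<lambda>x. p (f x)) \<longlongrightarrow> p l) F"
  using continuous_p by (simp add: continuous_on_eq_continuous_at isCont_tendsto_compose)

lemma p_measurable [measurable]: "p \<in> borel_measurable borel"
  using continuous_p by (rule borel_measurable_continuous_onI)

text \<open>For \<open>l \<ge> 1/2\<close> and \<open>\<bar>m\<bar> M \<le> 1/4\<close> this is the body with radial function \<open>l + m p\<close>
  (lemma \<open>mem_body_ray\<close>).\<close>

definition body :: "real \<Rightarrow> real \<Rightarrow> 'a set" where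
  "body l m = {y. norm y \<le> l + m * p y}"

lemma mult_p_bound: "\<bar>m * p y\<bar> \<le> \<bar>m\<bar> * M"
  by (simp add: abs_mult bound mult_left_mono)

lemma closed_body: "closed (body l m)"
  unfolding body_def by (intro closed_Collect_le continuous_intros)

lemma sets_body [measurable]: "body l m \<in> sets borel"
  by (intro borel_closed closed_body)

lemma body_subset_cball: "\<bar>m\<bar> * M \<le> c \<Longrightarrow> body l m \<subseteq> cball 0 (l + c)"
proof
  fix y :: 'a assume "\<bar>m\<bar> * M \<le> c" "y \<in> body l m"
  then show "y \<in> cball 0 (l + c)"
    using mult_p_bound[of m y] unfolding body_def mem_Collect_eq mem_cball dist_norm by simp
qed

lemma cball_subset_body: "\<bar>m\<bar> * M \<le> c \<Longrightarrow> cball 0 (l - c) \<subseteq> body l m"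
proof
  fix y :: 'a assume "\<bar>m\<bar> * M \<le> c" "y \<in> cball 0 (l - c)"
  then show "y \<in> body l m"
    using mult_p_bound[of m y] unfolding body_def mem_Collect_eq mem_cball dist_norm by simp
qed

lemma mem_body_ray:
  assumes "1/2 \<le> l" "\<bar>m\<bar> * M \<le> 1/4" "norm v = 1" "0 < s"
  shows "s *\<^sub>R v \<in> body l m \<longleftrightarrow> s \<le> l + m * p v"
proof (cases "1/4 \<le> s")
  case True
  have "p (s *\<^sub>R v) = p (sgn (s *\<^sub>R v))"
    using radial[of "s *\<^sub>R v"] True assms by simp
  also have "sgn (s *\<^sub>R v) = v" using assms by (simp add: sgn_div_norm)
  finally show ?thesis using assms by (simp add: body_def)
next
  case False
  then have "s \<le> l + m * p v" "s \<le> l + m * p (s *\<^sub>R v)"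
    using mult_p_bound[of m v] mult_p_bound[of m "s *\<^sub>R v"] assms(1,2) by linarith+
  then show ?thesis using assms by (simp add: body_def)
qed

lemma radius_bounds:
  assumes "1/2 \<le> l" "\<bar>m\<bar> * M \<le> 1/4"
  shows "1/4 \<le> l + m * p v" "l + m * p v \<le> l + 1/4"
  using mult_p_bound[of m v] assms by auto

lemma integrable_ray_measure:
  assumes "1/2 \<le> l" "\<bar>m\<bar> * M \<le> 1/4" "E \<in> sets borel"
  shows "integrable cone_measure (\<lambda>v. ray_measure E v (l + m * p v))"
proof (rule cone_measure.integrable_const_bound[where B="(l + 1/4) ^ DIM('a)"])
  show "AE v in cone_measure. norm (ray_measure E v (l + m * p v)) \<le> (l + 1/4) ^ DIM('a)"
  proof (rule AE_I2)
    fix v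
    note b = radius_bounds[OF assms(1,2), of v]
    have "ray_measure E v (l + m * p v) \<le> (l + m * p v) ^ DIM('a)"
      using b by (intro ray_measure_bounds assms) auto
    also have "\<dots> \<le> (l + 1/4) ^ DIM('a)" using b by (intro power_mono) auto
    finally show "norm (ray_measure E v (l + m * p v)) \<le> (l + 1/4) ^ DIM('a)"
      using ray_measure_bounds(1)[OF assms(3), of "l + m * p v" v] b by simp
  qed
  show "(\<lambda>v. ray_measure E v (l + m * p v)) \<in> borel_measurable cone_measure"
    using ray_measure_measurable[OF assms(3), of "\<lambda>v. l + m * p v"] by simp
qed

lemma measure_body_Int:
  assumes g: "1/2 \<le> l" "\<bar>m\<bar> * M \<le> 1/4" and E[measurable]: "E \<in> sets borel"
  shows "vol (body l m \<inter> E) = (\<integral>v. ray_measure E v (l + m * p v) \<partial>cone_measure)"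
proof -
  have "emeasure lborel (body l m \<inter> E)
     = (\<integral>\<^sup>+v. emeasure (radial_measure DIM('a)) {s. s *\<^sub>R v \<in> body l m \<inter> E} \<partial>cone_measure)"
    by (rule emeasure_lborel_polar) measurable
  also have "\<dots> = (\<integral>\<^sup>+v. ennreal (ray_measure E v (l + m * p v)) \<partial>cone_measure)"
  proof (rule nn_integral_cong_AE, use AE_cone_measure_norm in eventually_elim)
    fix v :: 'a assume v: "norm v = 1"
    have "emeasure (radial_measure DIM('a)) {s. s *\<^sub>R v \<in> body l m \<inter> E}
        = emeasure (radial_measure DIM('a)) ({0<..l + m * p v} \<inter> {s. s *\<^sub>R v \<in> E})"
      by (rule emeasure_eq_AE, use AE_radial_measure_pos in eventually_elim)
         (auto simp: mem_body_ray[OF g v])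
    then show "emeasure (radial_measure DIM('a)) {s. s *\<^sub>R v \<in> body l m \<inter> E}
        = ennreal (ray_measure E v (l + m * p v))"
      using emeasure_ray_finite[OF E, of 0 "l + m * p v" v]
      by (simp add: ray_measure_def emeasure_eq_ennreal_measure)
  qed
  also have "\<dots> = ennreal (\<integral>v. ray_measure E v (l + m * p v) \<partial>cone_measure)"
    by (rule nn_integral_eq_integral[OF integrable_ray_measure[OF g E]])
       (simp add: ray_measure_def)
  finally show ?thesis
    by (simp add: measure_def integral_nonneg_AE[OF AE_I2] ray_measure_def)
qed

text \<open>The first variation, in direction \<open>a + b p\<close>, of the volume of a body inside a set. The sets
  may vary with the step, provided that along almost every ray they are eventually
  constant near the boundary point of the body; \<open>k\<close> is the indicator of the directions whose boundary
  point lies inside.\<close>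

lemma tendsto_measure_body_Int:
  fixes h :: "nat \<Rightarrow> real" and E :: "nat \<Rightarrow> 'a set"
  assumes lm: "1/2 < l" "\<bar>m\<bar> * M < 1/4"
    and h: "h \<longlonglongrightarrow> 0" "\<And>j. h j \<noteq> 0"
    and E[measurable]: "\<And>j. E j \<in> sets borel"
    and k[measurable]: "k \<in> borel_measurable borel" and k01: "\<And>v. k v = 0 \<or> k v = (1::real)"
    and ev: "AE v in cone_measure. \<exists>\<eta>>0. \<forall>\<^sub>F j in sequentially.
       \<forall>s. \<bar>s - (l + m * p v)\<bar> < \<eta> \<longrightarrow> indicator (E j) (s *\<^sub>R v) = k v"
  shows "(\<lambda>j. (vol (body (l + h j * a) (m + h j * b) \<inter> E j) - vol (body l m \<inter> E j)) / h j)
    \<longlonglongrightarrow> (\<integral>v. DIM('a) * (a + b * p v) * (l + m * p v) ^ (DIM('a) - 1) * k v \<partial>cone_measure)"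
proof -
  let ?n = "DIM('a)"
  define R where "R = (\<lambda>v. l + m * p v)"
  define w where "w = (\<lambda>v. a + b * p v)"
  have Rj: "(l + h j * a) + (m + h j * b) * p v = R v + h j * w v" for j v
    by (simp add: R_def w_def algebra_simps)
  have l_lim: "(\<lambda>j. l + h j * a) \<longlonglongrightarrow> l + 0 * a" "(\<lambda>j. \<bar>m + h j * b\<bar> * M) \<longlonglongrightarrow> \<bar>m + 0 * b\<bar> * M"
    by (intro tendsto_intros h)+
  have "\<forall>\<^sub>F j in sequentially. 1/2 < l + h j * a \<and> l + h j * a < l + 1 \<and> \<bar>m + h j * b\<bar> * M < 1/4"
    using lm by (intro eventually_conj order_tendstoD[OF l_lim(1)] order_tendstoD(2)[OF l_lim(2)]) simp_all
  then obtain N where N: "\<And>j. j \<ge> N \<Longrightarrow> 1/2 < l + h j * a \<and> l + h j * a < l + 1 \<and> \<bar>m + h j * b\<bar> * M < 1/4"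
    unfolding eventually_sequentially by blast
  define H where "H = (\<lambda>j. h (j + N))"
  define F where "F = (\<lambda>j. E (j + N))"
  have F[measurable]: "F j \<in> sets borel" for j by (simp add: F_def)
  have H0: "H j \<noteq> 0" for j by (simp add: H_def h)
  have Hlim: "H \<longlonglongrightarrow> 0" unfolding H_def by (rule LIMSEQ_ignore_initial_segment[OF h(1)])
  have good: "1/2 \<le> l + H j * a" "\<bar>m + H j * b\<bar> * M \<le> 1/4" "l + H j * a \<le> l + 1" for j
    using N[of "j + N"] by (auto simp: H_def)
  have Rb: "0 \<le> R v" "\<bar>R v\<bar> \<le> l + 2" for v
    using radius_bounds[of l m v] lm unfolding R_def by auto
  have RHb: "0 \<le> R v + H j * w v" "\<bar>R v + H j * w v\<bar> \<le> l + 2" for v j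
    using radius_bounds[OF good(1)[of j] good(2)[of j], of v] good(3)[of j] unfolding Rj H_def by auto
  have [measurable]: "R \<in> borel_measurable borel" "w \<in> borel_measurable borel"
    unfolding R_def w_def by measurable
  define W where "W = \<bar>a\<bar> + \<bar>b\<bar> * M"
  have W: "\<bar>w v\<bar> \<le> W" for v
    unfolding w_def W_def using mult_p_bound[of b v] by linarith
  let ?dq = "\<lambda>j v. (ray_measure (F j) v (R v + H j * w v) - ray_measure (F j) v (R v)) / H j"
  have "(\<lambda>j. (\<integral>v. ?dq j v \<partial>cone_measure))
    \<longlonglongrightarrow> (\<integral>v. ?n * w v * R v ^ (?n - 1) * k v \<partial>cone_measure)"
  proof (rule integral_dominated_convergence[where w="\<lambda>_. ?n * (l + 2) ^ (?n - 1) * W"])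
    show "(\<lambda>v. ?n * w v * R v ^ (?n - 1) * k v) \<in> borel_measurable cone_measure"
      by measurable
    show "(\<lambda>v. ?dq j v) \<in> borel_measurable cone_measure" for j
      using ray_measure_measurable[of "F j" R] ray_measure_measurable[of "F j" "\<lambda>v. R v + H j * w v"] by simp
    show "AE v in cone_measure. (\<lambda>j. ?dq j v)
       \<longlonglongrightarrow> ?n * w v * R v ^ (?n - 1) * k v"
      using ev
    proof eventually_elim
      fix v assume "\<exists>\<eta>>0. \<forall>\<^sub>F j in sequentially. \<forall>s. \<bar>s - (l + m * p v)\<bar> < \<eta> \<longrightarrow> indicator (E j) (s *\<^sub>R v) = k v"
      then obtain \<eta> where \<eta>: "\<eta> > 0" and e: "\<forall>\<^sub>F j in sequentially. \<forall>s. \<bar>s - R v\<bar> < \<eta> \<longrightarrow> indicator (E j) (s *\<^sub>R v) = k v"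
        by (auto simp: R_def)
      have e': "\<forall>\<^sub>F j in sequentially. \<forall>s. \<bar>s - R v\<bar> < \<eta> \<longrightarrow> indicator (F j) (s *\<^sub>R v) = k v"
        using e unfolding F_def eventually_sequentially by (meson trans_le_add1)
      have "(\<lambda>j. \<bar>H j * w v\<bar>) \<longlonglongrightarrow> \<bar>0 * w v\<bar>" by (intro tendsto_intros Hlim)
      then have "\<forall>\<^sub>F j in sequentially. \<bar>H j * w v\<bar> < \<eta>"
        using order_tendstoD(2)[of _ _ _ \<eta>] \<eta> by simp
      with e' have eq: "\<forall>\<^sub>F j in sequentially. k v * (((R v + H j * w v) ^ ?n - R v ^ ?n) / H j) =
           ?dq j v"
      proof eventually_elim
        case (elim j)
        have "ray_measure (F j) v (R v + H j * w v) - ray_measure (F j) v (R v) = k v * ((R v + H j * w v) ^ ?n - R v ^ ?n)"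
        proof (rule ray_measure_diff_const)
          fix s assume "min (R v + H j * w v) (R v) \<le> s" "s \<le> max (R v + H j * w v) (R v)"
          then have "\<bar>s - R v\<bar> < \<eta>" using elim(2) by auto
          then show "indicator (F j) (s *\<^sub>R v) = k v" using elim(1) by simp
        qed (use Rb RHb k01 in auto)
        then show ?case by simp
      qed
      have "((\<lambda>x. (R v + x * w v) ^ ?n) has_real_derivative ?n * w v * R v ^ (?n - 1)) (at 0)"
        by (auto intro!: derivative_eq_intros)
      then have "((\<lambda>x. ((R v + x * w v) ^ ?n - R v ^ ?n) / x) \<longlongrightarrow> ?n * w v * R v ^ (?n - 1)) (at 0)"
        by (simp add: has_field_derivative_iff)
      then have "(\<lambda>j. ((R v + H j * w v) ^ ?n - R v ^ ?n) / H j) \<longlonglongrightarrow> ?n * w v * R v ^ (?n - 1)"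
        by (rule filterlim_compose) (auto simp: filterlim_at Hlim H0)
      from Lim_transform_eventually[OF tendsto_mult_left[OF this, of "k v"] eq]
      show "(\<lambda>j. ?dq j v)
       \<longlonglongrightarrow> ?n * w v * R v ^ (?n - 1) * k v"
        by (simp add: mult_ac)
    qed
    show "AE v in cone_measure. norm (?dq j v)
       \<le> ?n * (l + 2) ^ (?n - 1) * W" for j
    proof (rule AE_I2)
      fix v
      have "\<bar>ray_measure (F j) v (R v + H j * w v) - ray_measure (F j) v (R v)\<bar>
         \<le> \<bar>(R v + H j * w v) ^ ?n - R v ^ ?n\<bar>"
        by (intro ray_measure_abs_diff_le Rb RHb F)
      also have "\<dots> \<le> ?n * (l + 2) ^ (?n - 1) * \<bar>(R v + H j * w v) - R v\<bar>"
        by (intro abs_power_diff_le Rb RHb)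
      also have "\<dots> \<le> ?n * (l + 2) ^ (?n - 1) * (\<bar>H j\<bar> * W)"
        using W[of v] lm by (intro mult_left_mono) (auto simp: abs_mult mult_left_mono)
      finally show "norm (?dq j v)
       \<le> ?n * (l + 2) ^ (?n - 1) * W"
        using H0[of j] by (simp add: field_simps)
    qed
  qed simp
  also have "(\<lambda>j. (\<integral>v. ?dq j v \<partial>cone_measure))
     = (\<lambda>j. (vol (body (l + H j * a) (m + H j * b) \<inter> F j) - vol (body l m \<inter> F j)) / H j)"
  proof
    fix j
    note i1 = integrable_ray_measure[OF good(1)[of j] good(2)[of j] F[of j]] 
    note i2 = integrable_ray_measure[OF less_imp_le[OF lm(1)] less_imp_le[OF lm(2)] F[of j]]
    have RH: "(l + H j * a) + (m + H j * b) * p v = R v + H j * w v" for v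
      by (simp add: H_def Rj)
    show "(\<integral>v. ?dq j v \<partial>cone_measure)
     = (vol (body (l + H j * a) (m + H j * b) \<inter> F j) - vol (body l m \<inter> F j)) / H j"
      using i1 i2
      unfolding measure_body_Int[OF good(1)[of j] good(2)[of j] F[of j]] measure_body_Int[OF less_imp_le[OF lm(1)] less_imp_le[OF lm(2)] F[of j]] RH
      by (simp add: R_def Bochner_Integration.integral_diff)
  qed
  finally show ?thesis
    unfolding H_def F_def R_def w_def
    by (rule LIMSEQ_offset)
qed

end

section \<open>Transversality of a boundary and its translates\<close>

text \<open>Two unit vectors on the same half of a great circle through \<open>e\<close>, both away from \<open>\<plusminus>e\<close>, are
  as close to each other as their components along \<open>e\<close>, up to a constant.\<close>

lemma norm_diff_unit_coplanar:
  fixes v w e :: "'a::real_inner"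
  assumes unit: "norm v = 1" "norm w = 1" "norm e = 1"
    and par: "w - (w \<bullet> e) *\<^sub>R e = k *\<^sub>R (v - (v \<bullet> e) *\<^sub>R e)" "0 \<le> k"
    and ab: "\<bar>v \<bullet> e\<bar> \<le> \<alpha>" "\<bar>w \<bullet> e\<bar> \<le> \<alpha>" and c: "0 < c" "c\<^sup>2 + \<alpha>\<^sup>2 \<le> 1"
  shows "norm (v - w) \<le> (1 + 1 / c) * \<bar>v \<bullet> e - w \<bullet> e\<bar>"
proof -
  define a b x y where "a = v \<bullet> e" and "b = w \<bullet> e" and "x = v - a *\<^sub>R e" and "y = w - b *\<^sub>R e"
  have ee: "e \<bullet> e = 1" "v \<bullet> v = 1" "w \<bullet> w = 1" using unit by (auto simp: dot_square_norm)
  have nx: "(norm x)\<^sup>2 = 1 - a\<^sup>2" and ny: "(norm y)\<^sup>2 = 1 - b\<^sup>2"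
    unfolding power2_norm_eq_inner x_def y_def
    using ee by (simp_all add: algebra_simps inner_commute power2_eq_square a_def b_def)
  have yx: "y = k *\<^sub>R x" using par by (simp add: x_def y_def a_def b_def)
  have "a\<^sup>2 \<le> \<alpha>\<^sup>2" "b\<^sup>2 \<le> \<alpha>\<^sup>2"
    using power_mono[OF ab(1), of 2] power_mono[OF ab(2), of 2] by (auto simp: a_def b_def)
  then have "c\<^sup>2 \<le> (norm x)\<^sup>2" "c\<^sup>2 \<le> (norm y)\<^sup>2"
    using nx ny c by auto
  then have cx: "c \<le> norm x" "c \<le> norm y"
    using c by (auto intro: power2_le_imp_le)
  have a1: "\<bar>a\<bar> \<le> 1" "\<bar>b\<bar> \<le> 1"
    using Cauchy_Schwarz_ineq2[of v e] Cauchy_Schwarz_ineq2[of w e] unit by (auto simp: a_def b_def)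
  have "(norm x - norm y) * (norm x + norm y) = (b - a) * (b + a)"
    using nx ny by (simp add: algebra_simps power2_eq_square)
  then have "\<bar>norm x - norm y\<bar> * (norm x + norm y) = \<bar>b - a\<bar> * \<bar>b + a\<bar>"
    by (metis abs_mult abs_of_nonneg add_nonneg_nonneg norm_ge_zero)
  moreover have "\<bar>norm x - norm y\<bar> * (2 * c) \<le> \<bar>norm x - norm y\<bar> * (norm x + norm y)"
    using cx by (intro mult_left_mono) auto
  moreover have "\<bar>b - a\<bar> * \<bar>b + a\<bar> \<le> \<bar>b - a\<bar> * 2"
    using a1 by (intro mult_left_mono) auto
  ultimately have *: "\<bar>norm x - norm y\<bar> \<le> \<bar>a - b\<bar> / c"
    using c abs_minus_commute[of a b] by (simp add: field_simps)
  have "norm (v - w) = norm ((a - b) *\<^sub>R e + (x - y))"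
    by (simp add: x_def y_def algebra_simps)
  also have "\<dots> \<le> \<bar>a - b\<bar> + norm (x - y)"
    by (rule order_trans[OF norm_triangle_ineq]) (simp add: unit)
  also have "norm (x - y) = \<bar>norm x - norm y\<bar>"
  proof -
    have "x - y = (1 - k) *\<^sub>R x" by (simp add: yx algebra_simps)
    then have "norm (x - y) = \<bar>1 - k\<bar> * \<bar>norm x\<bar>" by simp
    also have "\<dots> = \<bar>norm x - k * norm x\<bar>" unfolding abs_mult[symmetric] by (simp add: algebra_simps)
    finally show ?thesis using par(2) by (simp add: yx)
  qed
  finally show ?thesis using * by (simp add: a_def b_def algebra_simps)
qed

lemma exists_small_pos:
  fixes c1 c2 d1 d2 :: real
  assumes "0 \<le> c1" "0 \<le> c2" "0 < d1" "0 < d2"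
  obtains \<epsilon> where "0 < \<epsilon>" "\<epsilon> * c1 \<le> d1" "\<epsilon> * c2 \<le> d2"
proof
  define x where "x = min (d1 / (c1 + 1)) (d2 / (c2 + 1))"
  have *: "x * c \<le> d" if "0 \<le> x" "x \<le> d / (c + 1)" "0 \<le> c" for x c d :: real
    using that by (simp add: pos_le_divide_eq algebra_simps)
  show "0 < x" using assms by (auto simp: x_def)
  then show "x * c1 \<le> d1" "x * c2 \<le> d2" using assms by (auto intro!: * simp: x_def)
qed

context radial_profile
begin

text \<open>The boundary point in direction \<open>v\<close> lies on the boundary of the body translated by \<open>e\<close>.\<close>

definition touch :: "real \<Rightarrow> real \<Rightarrow> 'a \<Rightarrow> 'a \<Rightarrow> bool" where
  "touch l m e v \<longleftrightarrow> norm ((l + m * p v) *\<^sub>R v - e) = l + m * p ((l + m * p v) *\<^sub>R v - e)"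

lemma touch_inner_eq:
  assumes unit: "norm v = 1" "norm e = 1" and t: "touch l m e v"
  defines "R \<equiv> l + m * p v"
  defines "T \<equiv> l + m * p (R *\<^sub>R v - e)"
  shows "2 * R * (v \<bullet> e) = 1 + R\<^sup>2 - T\<^sup>2"
proof -
  have "norm (R *\<^sub>R v - e) = T" using t by (simp add: touch_def R_def T_def)
  then have "T\<^sup>2 = (R *\<^sub>R v - e) \<bullet> (R *\<^sub>R v - e)" by (simp flip: power2_norm_eq_inner)
  also have "\<dots> = R\<^sup>2 - 2 * R * (v \<bullet> e) + 1"
    using unit dot_square_norm[of v] dot_square_norm[of e]
    by (simp add: algebra_simps inner_commute power2_eq_square)
  finally show ?thesis by simp
qed

lemma touch_bounds:
  assumes l: "1/2 < l1" "l1 \<le> l" "l \<le> l2" and m: "\<bar>m\<bar> * M * (4 * (l2 + 2) + 2) \<le> l1 - 1/2"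
      "\<bar>m\<bar> * M * (4 * (l2 + 2) + 2) \<le> 1"
    and v: "norm v = 1" and e: "norm e = 1" and t: "touch l m e v"
  shows "0 \<le> v \<bullet> e" "v \<bullet> e \<le> (1 + 1 / (2 * l1)) / 2"
proof -
  define \<epsilon> where "\<epsilon> = \<bar>m\<bar> * M"
  have e0: "0 \<le> \<epsilon>" using M_nonneg by (simp add: \<epsilon>_def)
  define R where "R = l + m * p v"
  define T where "T = l + m * p (R *\<^sub>R v - e)"
  have "\<epsilon> * 10 \<le> \<epsilon> * (4 * (l2 + 2) + 2)" using l e0 by (intro mult_left_mono) auto
  then have e1: "\<epsilon> * 10 \<le> 1" "\<epsilon> * 10 \<le> l1 - 1/2" using m by (auto simp: \<epsilon>_def)
  have R: "\<bar>R - l\<bar> \<le> \<epsilon>" "\<bar>T - l\<bar> \<le> \<epsilon>"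
    using mult_p_bound[of m v] mult_p_bound[of m "R *\<^sub>R v - e"] by (auto simp: R_def T_def \<epsilon>_def)
  have eq: "2 * R * (v \<bullet> e) = 1 + (R - T) * (R + T)"
    using touch_inner_eq[OF v e t] by (simp add: R_def T_def algebra_simps power2_eq_square)
  have "\<bar>(R - T) * (R + T)\<bar> \<le> (2 * \<epsilon>) * (2 * (l2 + 2))"
    unfolding abs_mult using R e1 l e0 by (intro mult_mono) auto
  then have b: "\<bar>(R - T) * (R + T)\<bar> \<le> \<epsilon> * (4 * (l2 + 2))" by (simp add: algebra_simps)
  have b1: "\<epsilon> * (4 * (l2 + 2)) + 2 * \<epsilon> \<le> 1" "\<epsilon> * (4 * (l2 + 2)) + 2 * \<epsilon> \<le> l1 - 1/2"
    using m by (auto simp: \<epsilon>_def algebra_simps)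
  have Rpos: "0 < R" using R e1 l by linarith
  have "0 \<le> 2 * R * (v \<bullet> e)" unfolding eq using b b1 e0 by linarith
  then show "0 \<le> v \<bullet> e" using Rpos by (simp add: zero_le_mult_iff)
  define \<alpha> where "\<alpha> = (1 + 1 / (2 * l1)) / 2"
  have \<alpha>: "2 * l1 * \<alpha> = l1 + 1/2" "0 < \<alpha>" "\<alpha> \<le> 1" using l by (auto simp: \<alpha>_def field_simps)
  have "\<epsilon> * \<alpha> \<le> \<epsilon>" using \<alpha> e0 by (simp add: mult_left_le)
  have "(l1 - \<epsilon>) * \<alpha> \<le> R * \<alpha>" using R l \<alpha> by (intro mult_right_mono) auto
  then have "l1 + 1/2 - 2 * (\<epsilon> * \<alpha>) \<le> 2 * R * \<alpha>" using \<alpha>(1) by (simp add: algebra_simps)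
  moreover have "2 * R * (v \<bullet> e) \<le> l1 + 1/2 - 2 * \<epsilon>"
    unfolding eq using b b1 by linarith
  ultimately have "2 * R * (v \<bullet> e) \<le> 2 * R * \<alpha>" using \<open>\<epsilon> * \<alpha> \<le> \<epsilon>\<close> by linarith
  then show "v \<bullet> e \<le> (1 + 1 / (2 * l1)) / 2" using Rpos by (simp add: \<alpha>_def)
qed

text \<open>For two touching directions the component along \<open>e\<close> is determined by the values of \<open>p\<close>, so it has a
  small Lipschitz constant when \<open>m\<close> is small.\<close>

lemma touch_inner_lipschitz:
  assumes l: "1/2 \<le> l" "l \<le> l2" and m: "\<bar>m\<bar> * M \<le> 1/4" "\<bar>m\<bar> * \<Lambda> \<le> 1"
    and unit: "norm v = 1" "norm w = 1" "norm e = 1" and t: "touch l m e v" "touch l m e w"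
  shows "\<bar>v \<bullet> e - w \<bullet> e\<bar> \<le> \<bar>m\<bar> * \<Lambda> * (8 * (l2 + 2)\<^sup>2) * norm (v - w)"
proof -
  define \<epsilon> d B where "\<epsilon> = \<bar>m\<bar> * \<Lambda>" and "d = norm (v - w)" and "B = l2 + 2"
  have e0: "0 \<le> \<epsilon>" "0 \<le> d" "\<epsilon> \<le> 1" "2 \<le> B" using Lambda_nonneg m l by (auto simp: \<epsilon>_def d_def B_def)
  have mp: "\<bar>m * p x - m * p y\<bar> \<le> \<epsilon> * norm (x - y)" for x y
  proof -
    have "\<bar>m * p x - m * p y\<bar> = \<bar>m\<bar> * \<bar>p x - p y\<bar>"
      unfolding abs_mult[symmetric] by (simp add: algebra_simps)
    also have "\<dots> \<le> \<bar>m\<bar> * (\<Lambda> * norm (x - y))" by (intro mult_left_mono lipschitz) auto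
    finally show ?thesis by (simp add: \<epsilon>_def)
  qed
  define R S where "R = l + m * p v" and "S = l + m * p w"
  define T U where "T = l + m * p (R *\<^sub>R v - e)" and "U = l + m * p (S *\<^sub>R w - e)"
  have bnd: "1/4 \<le> R" "1/4 \<le> S" "1/4 \<le> T" "1/4 \<le> U" "R \<le> B - 1" "S \<le> B - 1" "T \<le> B - 1" "U \<le> B - 1"
  proof -
    have "1/4 \<le> l + m * p y \<and> l + m * p y \<le> B - 1" for y
      using radius_bounds[OF l(1) m(1), of y] l by (simp add: B_def)
    then show "1/4 \<le> R" "1/4 \<le> S" "1/4 \<le> T" "1/4 \<le> U" "R \<le> B - 1" "S \<le> B - 1" "T \<le> B - 1" "U \<le> B - 1"
      unfolding R_def S_def T_def U_def by blast+
  qed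
  have 1: "2 * R * (v \<bullet> e) = 1 + R\<^sup>2 - T\<^sup>2" and 2: "2 * S * (w \<bullet> e) = 1 + S\<^sup>2 - U\<^sup>2"
    using touch_inner_eq[OF unit(1,3) t(1)] touch_inner_eq[OF unit(2,3) t(2)]
    by (simp_all only: R_def S_def T_def U_def)
  have RS: "\<bar>R - S\<bar> \<le> \<epsilon> * d" using mp[of v w] by (simp add: R_def S_def d_def)
  have "R *\<^sub>R v - S *\<^sub>R w = R *\<^sub>R (v - w) + (R - S) *\<^sub>R w" by (simp add: algebra_simps)
  then have "norm (R *\<^sub>R v - S *\<^sub>R w) \<le> R * d + \<bar>R - S\<bar>"
    using norm_triangle_ineq[of "R *\<^sub>R (v - w)" "(R - S) *\<^sub>R w"] bnd unit by (simp add: d_def)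
  also have "\<dots> \<le> (B - 1) * d + 1 * d"
    using bnd e0 RS mult_right_mono[OF e0(3,2)] mult_right_mono[OF bnd(5) e0(2)] by linarith
  finally have "norm (R *\<^sub>R v - S *\<^sub>R w) \<le> B * d" by (simp add: algebra_simps)
  then have TU: "\<bar>T - U\<bar> \<le> \<epsilon> * (B * d)"
    using mp[of "R *\<^sub>R v - e" "S *\<^sub>R w - e"] mult_left_mono[of _ "B * d" \<epsilon>] e0
    by (force simp: T_def U_def)
  have "2 * R * (v \<bullet> e - w \<bullet> e) = (R - S) * (R + S) - (T - U) * (T + U) - (R - S) * (2 * (w \<bullet> e))"
    using 1 2 by (simp add: algebra_simps power2_eq_square)
  then have "\<bar>2 * R * (v \<bullet> e - w \<bullet> e)\<bar> \<le> \<bar>R - S\<bar> * \<bar>R + S\<bar> + \<bar>T - U\<bar> * \<bar>T + U\<bar> + \<bar>R - S\<bar> * \<bar>2 * (w \<bullet> e)\<bar>"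
    unfolding abs_mult[symmetric] by linarith
  also have "\<bar>R - S\<bar> * \<bar>R + S\<bar> \<le> (\<epsilon> * d) * (2 * B)"
    using RS bnd e0 by (intro mult_mono) auto
  also have "\<bar>T - U\<bar> * \<bar>T + U\<bar> \<le> (\<epsilon> * (B * d)) * (2 * (B - 1))"
    using TU bnd e0 by (intro mult_mono) auto
  also have "\<bar>R - S\<bar> * \<bar>2 * (w \<bullet> e)\<bar> \<le> (\<epsilon> * d) * 2"
    using RS bnd e0 Cauchy_Schwarz_ineq2[of w e] unit by (intro mult_mono) auto
  also have "(\<epsilon> * d) * (2 * B) + (\<epsilon> * (B * d)) * (2 * (B - 1)) + (\<epsilon> * d) * 2 = (\<epsilon> * d) * (2 * B\<^sup>2 + 2)"
    by (simp add: algebra_simps power2_eq_square)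
  also have "\<dots> \<le> (\<epsilon> * d) * (4 * B\<^sup>2)"
    using e0 power_mono[of 2 B 2] by (intro mult_left_mono) auto
  finally have "\<bar>2 * R * (v \<bullet> e - w \<bullet> e)\<bar> \<le> (\<epsilon> * d) * (4 * B\<^sup>2)" by simp
  moreover have "(1/2) * \<bar>v \<bullet> e - w \<bullet> e\<bar> \<le> \<bar>2 * R * (v \<bullet> e - w \<bullet> e)\<bar>"
    unfolding abs_mult using bnd by (intro mult_right_mono) auto
  ultimately show ?thesis by (simp add: \<epsilon>_def d_def B_def algebra_simps)
qed


text \<open>A ray from \<open>-e\<close> projects to an arc of a great circle through \<open>e\<close>. On such an arc the distance of
  two touching directions is at most a multiple of the difference of their components along \<open>e\<close>, which
  is in turn a small multiple of the distance; so they coincide, and the cone over the touching directions meets every ray from \<open>-e\<close> at most once and is negligible. The pieces \<open>S k\<close> cut off the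
  apex of the cone to obtain closed sets.\<close>

lemma touch_null:
  assumes l: "1/2 < l1" "l1 \<le> l" "l \<le> l2"
    and m: "\<bar>m\<bar> * M * (4 * (l2 + 2) + 2) \<le> l1 - 1/2" "\<bar>m\<bar> * M * (4 * (l2 + 2) + 2) \<le> 1" "\<bar>m\<bar> * \<Lambda> \<le> 1"
    and c: "0 < c" "c\<^sup>2 + ((1 + 1 / (2 * l1)) / 2)\<^sup>2 \<le> 1"
    and mc: "\<bar>m\<bar> * \<Lambda> * (8 * (l2 + 2)\<^sup>2) * (1 + 1 / c) < 1" and e: "norm e = 1"
  shows "AE v in cone_measure. \<not> touch l m e v"
proof -
  define F where "F z = norm ((l + m * p (sgn z)) *\<^sub>R sgn z - e) - (l + m * p ((l + m * p (sgn z)) *\<^sub>R sgn z - e))" for z :: 'a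
  define S where "S k = {z \<in> {z. 1 / real (Suc k) \<le> norm z}. F z = 0}" for k
  have S: "z \<in> S k \<longleftrightarrow> 1 / real (Suc k) \<le> norm z \<and> touch l m e (sgn z)" for z k
    by (auto simp: S_def F_def touch_def)
  have "0 \<le> \<bar>m\<bar> * M" using M_nonneg by simp
  then have "\<bar>m\<bar> * M * 10 \<le> \<bar>m\<bar> * M * (4 * (l2 + 2) + 2)" using l by (intro mult_left_mono) auto
  then have mM: "\<bar>m\<bar> * M \<le> 1/4" using m by auto
  define \<alpha> where "\<alpha> = (1 + 1 / (2 * l1)) / 2"
  have "closed (S k)" for k
    unfolding S_def
  proof (rule continuous_closed_preimage_constant)
    have "continuous_on {z::'a. 1 / real (Suc k) \<le> norm z} (\<lambda>z. sgn z)"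
      by (rule continuous_on_sgn[OF continuous_on_id]) auto
    then show "continuous_on {z. 1 / real (Suc k) \<le> norm z} F"
      unfolding F_def by (intro continuous_intros) auto
    show "closed {z::'a. 1 / real (Suc k) \<le> norm z}"
      by (intro closed_Collect_le continuous_intros)
  qed
  moreover have "k = 1" if kx: "- e + k *\<^sub>R x \<in> S j" "0 \<le> k" "- e + x \<in> S j" for k x j
  proof -
    define z w where "z = - e + x" and "w = - e + k *\<^sub>R x"
    have nz: "z \<noteq> 0" "w \<noteq> 0"
      using kx S[of z j] S[of w j] by (auto simp: z_def w_def)
    define v u where "v = sgn z" and "u = sgn w"
    have nv: "norm v = 1" "norm u = 1" using nz by (auto simp: v_def u_def norm_sgn)
    have zv: "z = norm z *\<^sub>R v" "w = norm w *\<^sub>R u"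
      using nz by (auto simp: v_def u_def sgn_div_norm)
    have t: "touch l m e v" "touch l m e u" using kx S[of z j] S[of w j] by (auto simp: z_def w_def v_def u_def)
    have ee: "e \<bullet> e = 1" using e by (simp add: dot_square_norm)
    have vz: "v = inverse (norm z) *\<^sub>R z" "u = inverse (norm w) *\<^sub>R w"
      by (auto simp: v_def u_def sgn_div_norm)
    have perp: "u - (u \<bullet> e) *\<^sub>R e = (k * norm z / norm w) *\<^sub>R (v - (v \<bullet> e) *\<^sub>R e)"
    proof -
      have p1: "w - (w \<bullet> e) *\<^sub>R e = k *\<^sub>R (z - (z \<bullet> e) *\<^sub>R e)"
        using ee by (simp add: w_def z_def algebra_simps)
      have p2: "u - (u \<bullet> e) *\<^sub>R e = inverse (norm w) *\<^sub>R (w - (w \<bullet> e) *\<^sub>R e)"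
        unfolding vz by (simp add: algebra_simps)
      have p3: "v - (v \<bullet> e) *\<^sub>R e = inverse (norm z) *\<^sub>R (z - (z \<bullet> e) *\<^sub>R e)"
        unfolding vz by (simp add: algebra_simps)
      have p4: "k * norm z / norm w * inverse (norm z) = inverse (norm w) * k"
        using nz by (simp add: field_simps)
      show ?thesis unfolding p2 p1 p3 scaleR_scaleR p4 ..
    qed
    note tb = touch_bounds[OF l m(1,2) _ e]
    have "norm (v - u) \<le> (1 + 1 / c) * \<bar>v \<bullet> e - u \<bullet> e\<bar>"
      by (rule norm_diff_unit_coplanar[OF nv e perp _ _ _ c])
         (use kx tb[OF nv(1) t(1)] tb[OF nv(2) t(2)] in auto)
    also have "\<dots> \<le> (1 + 1 / c) * (\<bar>m\<bar> * \<Lambda> * (8 * (l2 + 2)\<^sup>2) * norm (v - u))"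
      using c l by (intro mult_left_mono touch_inner_lipschitz[OF _ _ mM m(3) nv e t]) auto
    also have "\<dots> = (\<bar>m\<bar> * \<Lambda> * (8 * (l2 + 2)\<^sup>2) * (1 + 1 / c)) * norm (v - u)"
      by (simp add: mult_ac)
    finally have "(1 - \<bar>m\<bar> * \<Lambda> * (8 * (l2 + 2)\<^sup>2) * (1 + 1 / c)) * norm (v - u) \<le> 0"
      by (simp add: algebra_simps)
    then have vu: "v = u" using mc by (simp add: mult_le_0_iff)
    have "\<alpha> < 1" using l by (simp add: \<alpha>_def field_simps)
    then have ve: "v \<bullet> e < 1" "0 \<le> v \<bullet> e" using tb[OF nv(1) t(1)] by (auto simp: \<alpha>_def)
    define q where "q = norm w / norm z"
    have q: "w = q *\<^sub>R z" using zv vu nz by (simp add: q_def) (metis scaleR_scaleR divide_inverse mult.assoc mult.commute left_inverse norm_eq_zero scaleR_one)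
    then have 3: "(k - q) *\<^sub>R x = (1 - q) *\<^sub>R e" by (simp add: z_def w_def algebra_simps)
    have "k = q"
    proof (rule ccontr)
      assume "k \<noteq> q"
      then have "x = ((1 - q) / (k - q)) *\<^sub>R e"
        using 3 by (metis (no_types, lifting) divide_inverse_commute eq_iff_diff_eq_0 left_inverse scaleR_one scaleR_scaleR)
      then obtain r where "z = r *\<^sub>R e" by (metis scaleR_left_diff_distrib scaleR_one uminus_add_conv_diff z_def)
      then have "v = (r / \<bar>r\<bar>) *\<^sub>R e" using e by (simp add: v_def sgn_div_norm divide_inverse mult.commute)
      then have "v \<bullet> e = r / \<bar>r\<bar>" using ee by simp
      then have "r = 0" using ve by (cases r "0::real" rule: linorder_cases) auto
      then show False using \<open>z = r *\<^sub>R e\<close> nz by simp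
    qed
    then have "(1 - q) *\<^sub>R e = 0" using 3 by simp
    then show "k = 1" using e \<open>k = q\<close> by auto
  qed
  ultimately have "negligible (S k)" for k
    by (rule starlike_negligible)
  then have "negligible (\<Union>k. S k)" by (intro negligible_countable_Union) auto
  moreover have "(\<Union>k. S k) \<in> sets borel" using \<open>\<And>k. closed (S k)\<close> by (intro sets.countable_UN) auto
  ultimately have null: "emeasure lborel (\<Union>k. S k) = 0"
    by (simp add: negligible_iff_null_sets null_sets_completion_iff null_setsD1)
  define N where "N = {v. norm v = 1 \<and> touch l m e v}"
  have N: "N \<in> sets borel" unfolding N_def touch_def by measurable
  have "{z\<in>cball 0 1. sgn z \<in> N} \<subseteq> (\<Union>k. S k)"
  proof
    fix z assume "z \<in> {z\<in>cball 0 1. sgn z \<in> N}"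
    then have "z \<noteq> 0" "touch l m e (sgn z)" by (auto simp: N_def norm_sgn split: if_splits)
    then obtain k where "1 / real (Suc k) < norm z"
      using reals_Archimedean[of "norm z"] by (auto simp: inverse_eq_divide)
    then show "z \<in> (\<Union>k. S k)" using \<open>touch l m e (sgn z)\<close> S less_imp_le by blast
  qed
  then have "emeasure cone_measure N = 0"
    using null emeasure_mono[of _ "\<Union>k. S k" lborel] \<open>(\<Union>k. S k) \<in> sets borel\<close>
    by (subst emeasure_cone_measure[OF N]) (metis le_zero_eq sets_lborel)
  then have "AE v in cone_measure. v \<notin> N"
    by (intro AE_not_in) (auto simp: null_sets_def N)
  with AE_cone_measure_norm show ?thesis
    by eventually_elim (auto simp: N_def)
qed

text \<open>The condition \<open>1/2 < l1\<close> says that a ball of radius \<open>l1\<close> properly meets its translate by a unit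
  vector. The bound \<open>m1\<close> is uniform in \<open>l\<close> and \<open>e\<close>.\<close>

lemma exists_transversal_range:
  assumes l: "1/2 < l1" "l1 \<le> l2"
  obtains m1 where "0 < m1" "m1 * M < 1/4"
    "\<And>l m e. l1 \<le> l \<Longrightarrow> l \<le> l2 \<Longrightarrow> \<bar>m\<bar> \<le> m1 \<Longrightarrow> norm e = 1 \<Longrightarrow> AE v in cone_measure. \<not> touch l m e v"
proof -
  define \<alpha> where "\<alpha> = (1 + 1 / (2 * l1)) / 2"
  have a: "0 < \<alpha>" "\<alpha> < 1" using l by (auto simp: \<alpha>_def field_simps)
  define c where "c = sqrt (1 - \<alpha>\<^sup>2)"
  have "\<alpha>\<^sup>2 < 1" using a by (simp add: power2_eq_square mult_less_cancel_left2 mult_le_one less_1_mult' mult_strict_mono[of \<alpha> 1 \<alpha> 1, simplified])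
  then have c: "0 < c" "c\<^sup>2 + \<alpha>\<^sup>2 \<le> 1" by (auto simp: c_def)
  have "0 \<le> M * (4 * (l2 + 2) + 2)" "0 \<le> \<Lambda> * (8 * (l2 + 2)\<^sup>2) * (1 + 1 / c)"
    "0 < min (l1 - 1/2) 1" "(0::real) < 1/2"
    using M_nonneg Lambda_nonneg l c by auto
  from exists_small_pos[OF this] obtain m1 where m1: "0 < m1" "m1 * (M * (4 * (l2 + 2) + 2)) \<le> min (l1 - 1/2) 1"
    "m1 * (\<Lambda> * (8 * (l2 + 2)\<^sup>2) * (1 + 1 / c)) \<le> 1/2" .
  show ?thesis
  proof
    show "0 < m1" by fact
    have "m1 * (M * 10) \<le> m1 * (M * (4 * (l2 + 2) + 2))" using m1 M_nonneg l by (intro mult_left_mono) auto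
    also have "\<dots> \<le> 1" using m1 by simp
    finally show "m1 * M < 1/4" by simp
    fix l m e assume lm: "l1 \<le> l" "l \<le> l2" "\<bar>m\<bar> \<le> m1" and e: "norm (e::'a) = 1"
    have 1: "\<bar>m\<bar> * M * (4 * (l2 + 2) + 2) \<le> m1 * (M * (4 * (l2 + 2) + 2))"
      unfolding mult.assoc using lm M_nonneg l by (intro mult_right_mono) auto
    have 2: "\<bar>m\<bar> * \<Lambda> * (8 * (l2 + 2)\<^sup>2) * (1 + 1 / c) \<le> m1 * (\<Lambda> * (8 * (l2 + 2)\<^sup>2) * (1 + 1 / c))"
      unfolding mult.assoc using lm Lambda_nonneg c by (intro mult_right_mono) auto
    have "1 * 1 \<le> (8 * (l2 + 2)\<^sup>2) * (1 + 1 / c)"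
      using c l power_mono[of 2 "l2 + 2" 2] by (intro mult_mono) auto
    then have "\<bar>m\<bar> * \<Lambda> * 1 \<le> \<bar>m\<bar> * \<Lambda> * ((8 * (l2 + 2)\<^sup>2) * (1 + 1 / c))"
      using Lambda_nonneg by (intro mult_left_mono) auto
    then have "\<bar>m\<bar> * \<Lambda> \<le> \<bar>m\<bar> * \<Lambda> * (8 * (l2 + 2)\<^sup>2) * (1 + 1 / c)"
      by (simp only: mult.assoc mult_1_right)
    then have 3: "\<bar>m\<bar> * \<Lambda> \<le> 1" using 2 m1 by linarith
    show "AE v in cone_measure. \<not> touch l m e v"
      by (rule touch_null[OF l(1) lm(1,2) _ _ 3 c[unfolded \<alpha>_def] _ e]) (use 1 2 m1 in linarith)+
  qed
qed


text \<open>Away from touching directions, membership of points near a boundary point in the translated body is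
  stable under perturbation of all parameters.\<close>

lemma eventually_ray_indicator:
  fixes m :: "nat \<Rightarrow> real"
  assumes lim: "l \<longlonglongrightarrow> l0" "m \<longlonglongrightarrow> m0" "e \<longlonglongrightarrow> e0"
    and v: "norm v = 1" and ne: "norm (R *\<^sub>R v - e0) \<noteq> l0 + m0 * p (R *\<^sub>R v - e0)"
  shows "\<exists>\<eta>>0. \<forall>\<^sub>F j in sequentially. \<forall>s. \<bar>s - R\<bar> < \<eta> \<longrightarrow>
    (s *\<^sub>R v - e j \<in> body (l j) (m j) \<longleftrightarrow> R *\<^sub>R v - e0 \<in> body l0 m0)"
proof -
  define \<Phi> where "\<Phi> s l m e = norm (s *\<^sub>R v - e) - (l + m * p (s *\<^sub>R v - e))" for s l m e
  have mem: "s *\<^sub>R v - e \<in> body l m \<longleftrightarrow> \<Phi> s l m e \<le> 0" for s l m e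
    by (simp add: body_def \<Phi>_def)
  define d where "d = \<Phi> R l0 m0 e0"
  have d: "d \<noteq> 0" using ne by (simp add: d_def \<Phi>_def)
  define L where "L = 1 + (\<bar>m0\<bar> + 1) * \<Lambda>"
  have L: "1 \<le> L" using Lambda_nonneg by (simp add: L_def)
  have "(\<lambda>j. \<Phi> R (l j) (m j) (e j)) \<longlonglongrightarrow> d"
    unfolding \<Phi>_def d_def by (intro tendsto_intros lim)
  then have ev1: "\<forall>\<^sub>F j in sequentially. \<bar>\<Phi> R (l j) (m j) (e j) - d\<bar> < \<bar>d\<bar> / 2"
    using tendstoD[of _ d _ "\<bar>d\<bar> / 2"] d by (simp add: dist_real_def)
  have "(\<lambda>j. \<bar>m j\<bar>) \<longlonglongrightarrow> \<bar>m0\<bar>" by (intro tendsto_intros lim)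
  then have ev2: "\<forall>\<^sub>F j in sequentially. \<bar>m j\<bar> < \<bar>m0\<bar> + 1"
    by (rule order_tendstoD) simp
  show ?thesis
  proof (intro exI conjI)
    show "0 < \<bar>d\<bar> / (2 * L)" using d L by simp
    show "\<forall>\<^sub>F j in sequentially. \<forall>s. \<bar>s - R\<bar> < \<bar>d\<bar> / (2 * L) \<longrightarrow>
        (s *\<^sub>R v - e j \<in> body (l j) (m j) \<longleftrightarrow> R *\<^sub>R v - e0 \<in> body l0 m0)"
      using ev1 ev2
    proof eventually_elim
      case (elim j)
      show ?case
      proof (intro allI impI)
        fix s assume s: "\<bar>s - R\<bar> < \<bar>d\<bar> / (2 * L)"
        have sR: "norm ((s *\<^sub>R v - e j) - (R *\<^sub>R v - e j)) = \<bar>s - R\<bar>"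
          using v by (simp flip: scaleR_left_diff_distrib)
        have n: "\<bar>norm (s *\<^sub>R v - e j) - norm (R *\<^sub>R v - e j)\<bar> \<le> \<bar>s - R\<bar>"
          using norm_triangle_ineq3[of "s *\<^sub>R v - e j" "R *\<^sub>R v - e j"] sR by simp
        have "\<bar>m j * p (s *\<^sub>R v - e j) - m j * p (R *\<^sub>R v - e j)\<bar> = \<bar>m j\<bar> * \<bar>p (s *\<^sub>R v - e j) - p (R *\<^sub>R v - e j)\<bar>"
          unfolding abs_mult[symmetric] by (simp add: algebra_simps)
        also have "\<dots> \<le> (\<bar>m0\<bar> + 1) * (\<Lambda> * \<bar>s - R\<bar>)"
          using elim lipschitz[of "s *\<^sub>R v - e j" "R *\<^sub>R v - e j"] unfolding sR
          by (intro mult_mono) auto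
        finally have mp: "\<bar>m j * p (s *\<^sub>R v - e j) - m j * p (R *\<^sub>R v - e j)\<bar> \<le> (\<bar>m0\<bar> + 1) * (\<Lambda> * \<bar>s - R\<bar>)" .
        have "\<bar>\<Phi> s (l j) (m j) (e j) - \<Phi> R (l j) (m j) (e j)\<bar> \<le> L * \<bar>s - R\<bar>"
        proof -
          have "L * \<bar>s - R\<bar> = \<bar>s - R\<bar> + (\<bar>m0\<bar> + 1) * (\<Lambda> * \<bar>s - R\<bar>)"
            by (simp add: L_def algebra_simps)
          then show ?thesis using n mp unfolding \<Phi>_def by linarith
        qed
        also have "\<dots> < L * (\<bar>d\<bar> / (2 * L))" using s L by (intro mult_strict_left_mono) auto
        also have "\<dots> = \<bar>d\<bar> / 2" using L by simp
        finally have "\<bar>\<Phi> s (l j) (m j) (e j) - d\<bar> < \<bar>d\<bar>" using elim by linarith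
        then have "\<Phi> s (l j) (m j) (e j) \<le> 0 \<longleftrightarrow> d \<le> 0" using d by linarith
        then show "s *\<^sub>R v - e j \<in> body (l j) (m j) \<longleftrightarrow> R *\<^sub>R v - e0 \<in> body l0 m0"
          by (simp add: mem d_def)
      qed
    qed
  qed
qed

end

section \<open>First variation of the overlap\<close>

lemma measure_lborel_translation:
  fixes e :: "'a::euclidean_space"
  assumes [measurable]: "A \<in> sets borel"
  shows "vol {x. e + x \<in> A} = vol A"
proof -
  have "measure (distr lborel borel ((+) e)) A = vol ((+) e -` A \<inter> space lborel)"
    by (rule measure_distr) auto
  then show ?thesis by (simp add: lborel_distr_plus vimage_def)
qed

context radial_profile
begin

text \<open>The volume of the intersection of a body with its translate by \<open>e\<close>.\<close>

definition overlap :: "real \<Rightarrow> real \<Rightarrow> 'a \<Rightarrow> real" where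
  "overlap l m e = vol (body l m \<inter> {y. y - e \<in> body l m})"

text \<open>The indicator of the directions whose boundary point lies in the body translated by \<open>e\<close>.\<close>

definition cap :: "real \<Rightarrow> real \<Rightarrow> 'a \<Rightarrow> 'a \<Rightarrow> real" where
  "cap l m e v = indicator (body l m) ((l + m * p v) *\<^sub>R v - e)"

text \<open>The derivative of \<open>overlap l m e - d * vol (body l m)\<close> in direction \<open>(a, b)\<close> with respect
  to \<open>(l, m)\<close>.\<close>

definition excess_slope :: "real \<Rightarrow> real \<Rightarrow> real \<Rightarrow> real \<Rightarrow> real \<Rightarrow> 'a \<Rightarrow> real" where
  "excess_slope d a b l m e = (\<integral>v. DIM('a) * (a + b * p v) * (l + m * p v) ^ (DIM('a) - 1) *
     (cap l m e v + cap l m (- e) v - d) \<partial>cone_measure)"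

lemma cap_measurable [measurable]: "(\<lambda>v. cap l m e v) \<in> borel_measurable borel"
  unfolding cap_def by measurable

lemma cap_measurable_pair [measurable]:
  "(\<lambda>x. cap l m (fst x) (snd x)) \<in> borel_measurable (borel \<Otimes>\<^sub>M borel)"
  unfolding cap_def by measurable

lemma cap_cases: "cap l m e v = 0 \<or> cap l m e v = 1"
  by (auto simp: cap_def indicator_def)

lemma cap_bounds: "0 \<le> cap l m e v" "cap l m e v \<le> 1"
  using cap_cases[of l m e v] by auto

lemma shift_sets [measurable]: "{y. y - e \<in> body l m} \<in> sets borel"
  by measurable

lemma measure_lens_commute:
  "vol (body l m \<inter> {y. y - e \<in> body l' m'}) = vol (body l' m' \<inter> {y. y - - e \<in> body l m})"
proof -
  have "{x. e + x \<in> body l m \<inter> {y. y - e \<in> body l' m'}} = body l' m' \<inter> {y. y - - e \<in> body l m}"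
    by (auto simp: add.commute)
  then show ?thesis
    using measure_lborel_translation[of "body l m \<inter> {y. y - e \<in> body l' m'}" e] by simp
qed

text \<open>Only the untranslated copy moves by a difference quotient here; the translated copy may follow
  any convergent sequence of bodies.\<close>

lemma tendsto_lens_increment:
  assumes lm: "1/2 < l" "\<bar>m\<bar> * M < 1/4" and h: "h \<longlonglongrightarrow> 0" "\<And>j. h j \<noteq> 0"
    and lim: "x \<longlonglongrightarrow> l" "y \<longlonglongrightarrow> m" and nt: "AE v in cone_measure. \<not> touch l m e v"
  shows "(\<lambda>j. (vol (body (l + h j * a) (m + h j * b) \<inter> {z. z - e \<in> body (x j) (y j)})
       - vol (body l m \<inter> {z. z - e \<in> body (x j) (y j)})) / h j)
    \<longlonglongrightarrow> (\<integral>v. DIM('a) * (a + b * p v) * (l + m * p v) ^ (DIM('a) - 1) * cap l m e v \<partial>cone_measure)"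
proof (rule tendsto_measure_body_Int[OF lm h])
  show "AE v in cone_measure. \<exists>\<eta>>0. \<forall>\<^sub>F j in sequentially.
       \<forall>s. \<bar>s - (l + m * p v)\<bar> < \<eta> \<longrightarrow> indicator {z. z - e \<in> body (x j) (y j)} (s *\<^sub>R v) = cap l m e v"
    using nt AE_cone_measure_norm
  proof eventually_elim
    case (elim v)
    from eventually_ray_indicator[OF lim tendsto_const elim(2), of "l + m * p v" e]
    show ?case
      using elim(1) by (auto simp: touch_def cap_def indicator_def)
  qed
qed (use cap_cases in auto)

lemma integrable_weighted:
  assumes "g \<in> borel_measurable borel" "\<And>v. \<bar>g v\<bar> \<le> C"
  shows "integrable cone_measure (\<lambda>v. DIM('a) * (a + b * p v) * (l + m * p v) ^ (DIM('a) - 1) * g v)"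
proof (rule cone_measure.integrable_const_bound)
  show "AE v in cone_measure. norm (DIM('a) * (a + b * p v) * (l + m * p v) ^ (DIM('a) - 1) * g v)
     \<le> DIM('a) * (\<bar>a\<bar> + \<bar>b\<bar> * M) * (\<bar>l\<bar> + \<bar>m\<bar> * M) ^ (DIM('a) - 1) * C"
  proof (rule AE_I2)
    fix v
    have "\<bar>a + b * p v\<bar> \<le> \<bar>a\<bar> + \<bar>b\<bar> * M" "\<bar>l + m * p v\<bar> \<le> \<bar>l\<bar> + \<bar>m\<bar> * M"
      using mult_p_bound[of b v] mult_p_bound[of m v] by linarith+
    then show "norm (DIM('a) * (a + b * p v) * (l + m * p v) ^ (DIM('a) - 1) * g v)
     \<le> DIM('a) * (\<bar>a\<bar> + \<bar>b\<bar> * M) * (\<bar>l\<bar> + \<bar>m\<bar> * M) ^ (DIM('a) - 1) * C"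
      using assms(2)[of v] M_nonneg unfolding real_norm_def abs_mult power_abs
      by (intro mult_mono power_mono mult_nonneg_nonneg) auto
  qed
  show "(\<lambda>v. DIM('a) * (a + b * p v) * (l + m * p v) ^ (DIM('a) - 1) * g v) \<in> borel_measurable cone_measure"
    using assms(1) by simp
qed

lemma excess_has_derivative_line:
  assumes lm: "1/2 < l" "\<bar>m\<bar> * M < 1/4"
    and nt: "AE v in cone_measure. \<not> touch l m e v" "AE v in cone_measure. \<not> touch l m (- e) v"
  shows "((\<lambda>h. overlap (l + h * a) (m + h * b) e - d * vol (body (l + h * a) (m + h * b)))
    has_real_derivative excess_slope d a b l m e) (at 0)"
  unfolding has_field_derivative_iff tendsto_at_iff_sequentially
proof (intro allI impI)
  fix X :: "nat \<Rightarrow> real" assume "\<forall>i. X i \<in> UNIV - {0}" and X: "X \<longlonglongrightarrow> 0"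
  then have X0: "X i \<noteq> 0" for i by auto
  let ?I = "\<lambda>g. \<integral>v. DIM('a) * (a + b * p v) * (l + m * p v) ^ (DIM('a) - 1) * g v \<partial>cone_measure"
  define A where "A j = body (l + X j * a) (m + X j * b)" for j
  let ?split = "\<lambda>j. (vol (A j \<inter> {z. z - e \<in> A j}) - vol (body l m \<inter> {z. z - e \<in> A j})) / X j
    + (vol (A j \<inter> {z. z - - e \<in> body l m}) - vol (body l m \<inter> {z. z - - e \<in> body l m})) / X j
    - d * ((vol (A j \<inter> UNIV) - vol (body l m \<inter> UNIV)) / X j)"
  let ?quot = "\<lambda>h. ((overlap (l + h * a) (m + h * b) e - d * vol (body (l + h * a) (m + h * b))) -
    (overlap (l + 0 * a) (m + 0 * b) e - d * vol (body (l + 0 * a) (m + 0 * b)))) / (h - 0)"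
  have lim: "(\<lambda>j. l + X j * a) \<longlonglongrightarrow> l" "(\<lambda>j. m + X j * b) \<longlonglongrightarrow> m"
    using tendsto_add[OF tendsto_const tendsto_mult_right[OF X]] by (metis add.right_neutral mult_zero_left)+
  \<comment> \<open>The two copies are moved one after the other; a translation by \<open>-e\<close> turns the movement of the
    second copy into one of the first.\<close>
  note inc1 = tendsto_lens_increment[OF lm X X0 lim nt(1), of a b]
  note inc2 = tendsto_lens_increment[OF lm X X0 tendsto_const tendsto_const nt(2), of a b]
  have "(\<lambda>j. (vol (A j \<inter> UNIV) - vol (body l m \<inter> UNIV)) / X j) \<longlonglongrightarrow> ?I (\<lambda>v. 1)"
    unfolding A_def
    by (rule tendsto_measure_body_Int[OF lm X X0]) (auto intro!: exI[of _ 1])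
  then have "(\<lambda>j. ?split j)
    \<longlonglongrightarrow> ?I (cap l m e) + ?I (cap l m (- e)) - d * ?I (\<lambda>v. 1)"
    using inc1 inc2 unfolding A_def by (intro tendsto_intros)
  also have "?I (cap l m e) + ?I (cap l m (- e)) - d * ?I (\<lambda>v. 1) = excess_slope d a b l m e"
  proof -
    have i: "integrable cone_measure (\<lambda>v. DIM('a) * (a + b * p v) * (l + m * p v) ^ (DIM('a) - 1) * cap l m e v)"
      "integrable cone_measure (\<lambda>v. DIM('a) * (a + b * p v) * (l + m * p v) ^ (DIM('a) - 1) * cap l m (- e) v)"
      "integrable cone_measure (\<lambda>v. DIM('a) * (a + b * p v) * (l + m * p v) ^ (DIM('a) - 1) * 1)"
      using cap_bounds by (intro integrable_weighted[where C=1]; simp)+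
    let ?F = "\<lambda>g v. DIM('a) * (a + b * p v) * (l + m * p v) ^ (DIM('a) - 1) * g v"
    have "excess_slope d a b l m e = (\<integral>v. (?F (cap l m e) v + ?F (cap l m (- e)) v) - d * ?F (\<lambda>v. 1) v \<partial>cone_measure)"
      unfolding excess_slope_def by (intro Bochner_Integration.integral_cong) (auto simp: algebra_simps)
    also have "\<dots> = ?I (cap l m e) + ?I (cap l m (- e)) - d * ?I (\<lambda>v. 1)"
      using Bochner_Integration.integral_diff[OF Bochner_Integration.integrable_add[OF i(1,2)] integrable_mult_right[OF i(3), of d]]
        Bochner_Integration.integral_add[OF i(1,2)] by simp
    finally show ?thesis by simp
  qed
  also have "(\<lambda>j. ?split j)
     = ?quot \<circ> X"
  proof
    fix j
    have "vol (A j \<inter> {z. z - - e \<in> body l m}) = vol (body l m \<inter> {z. z - e \<in> A j})"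
      unfolding A_def measure_lens_commute[of l m e] ..
    moreover have "vol (body l m \<inter> {z. z - - e \<in> body l m}) = overlap l m e"
      unfolding overlap_def measure_lens_commute[of l m e] ..
    moreover have "vol (A j \<inter> {z. z - e \<in> A j}) = overlap (l + X j * a) (m + X j * b) e"
      by (simp add: overlap_def A_def)
    ultimately show "?split j
     = (?quot \<circ> X) j"
      using X0[of j] by (simp add: A_def diff_divide_distrib add_divide_distrib algebra_simps)
  qed
  finally show "(?quot \<circ> X)
    \<longlonglongrightarrow> excess_slope d a b l m e" .
qed

lemma tendsto_excess_slope:
  assumes lim: "a \<longlonglongrightarrow> a0" "b \<longlonglongrightarrow> b0" "l \<longlonglongrightarrow> l0" "m \<longlonglongrightarrow> m0" "e \<longlonglongrightarrow> e0"
    and nt: "AE v in cone_measure. \<not> touch l0 m0 e0 v" "AE v in cone_measure. \<not> touch l0 m0 (- e0) v"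
  shows "(\<lambda>j. excess_slope d (a j) (b j) (l j) (m j) (e j)) \<longlonglongrightarrow> excess_slope d a0 b0 l0 m0 e0"
proof -
  have "\<exists>K. \<forall>j. \<bar>f j\<bar> \<le> K" if "f \<longlonglongrightarrow> f0" for f :: "nat \<Rightarrow> real" and f0
    using convergent_imp_Bseq[OF convergentI[OF that]] by (auto simp: Bseq_def)
  then obtain A B L N where bnd: "\<And>j. \<bar>a j\<bar> \<le> A" "\<And>j. \<bar>b j\<bar> \<le> B" "\<And>j. \<bar>l j\<bar> \<le> L" "\<And>j. \<bar>m j\<bar> \<le> N"
    using lim(1-4) by meson
  have nn: "0 \<le> A" "0 \<le> B" "0 \<le> L" "0 \<le> N" using bnd[of 0] by linarith+
  have capev: "\<forall>\<^sub>F j in sequentially. cap (l j) (m j) (f j) v = cap l0 m0 f0 v"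
    if "f \<longlonglongrightarrow> f0" "norm v = 1" "\<not> touch l0 m0 f0 v" for f f0 v
  proof -
    from eventually_ray_indicator[OF lim(3,4) that(1,2), of "l0 + m0 * p v"] that(3)
    obtain \<eta> where \<eta>: "\<eta> > 0" "\<forall>\<^sub>F j in sequentially. \<forall>s. \<bar>s - (l0 + m0 * p v)\<bar> < \<eta> \<longrightarrow>
      (s *\<^sub>R v - f j \<in> body (l j) (m j) \<longleftrightarrow> (l0 + m0 * p v) *\<^sub>R v - f0 \<in> body l0 m0)"
      by (auto simp: touch_def)
    have "(\<lambda>j. l j + m j * p v) \<longlonglongrightarrow> l0 + m0 * p v" by (intro tendsto_intros lim)
    then have "\<forall>\<^sub>F j in sequentially. \<bar>l j + m j * p v - (l0 + m0 * p v)\<bar> < \<eta>"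
      using tendstoD[of "\<lambda>j. l j + m j * p v" "l0 + m0 * p v" sequentially \<eta>] \<eta>(1) by (simp add: dist_real_def)
    with \<eta>(2) show ?thesis
      by eventually_elim (simp add: cap_def indicator_def)
  qed
  let ?F = "\<lambda>j v. DIM('a) * (a j + b j * p v) * (l j + m j * p v) ^ (DIM('a) - 1) *
    (cap (l j) (m j) (e j) v + cap (l j) (m j) (- e j) v - d)"
  let ?C = "DIM('a) * (A + B * M) * (L + N * M) ^ (DIM('a) - 1) * (2 + \<bar>d\<bar>)"
  show ?thesis
    unfolding excess_slope_def
  proof (rule integral_dominated_convergence[where w="\<lambda>_. ?C"])
    show "AE v in cone_measure. (\<lambda>j. ?F j v)
      \<longlonglongrightarrow> DIM('a) * (a0 + b0 * p v) * (l0 + m0 * p v) ^ (DIM('a) - 1) * (cap l0 m0 e0 v + cap l0 m0 (- e0) v - d)"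
      using nt AE_cone_measure_norm
    proof eventually_elim
      case (elim v)
      show ?case
        using capev[OF lim(5) elim(3,1)] capev[OF tendsto_minus[OF lim(5)] elim(3,2)]
        by (intro tendsto_intros lim tendsto_eventually)
    qed
    show "AE v in cone_measure. norm (?F j v)
      \<le> ?C" for j
    proof (rule AE_I2)
      fix v
      have "\<bar>b j\<bar> * M \<le> B * M" "\<bar>m j\<bar> * M \<le> N * M"
        using bnd[of j] M_nonneg by (auto intro: mult_right_mono)
      then have "\<bar>a j + b j * p v\<bar> \<le> A + B * M" "\<bar>l j + m j * p v\<bar> \<le> L + N * M"
        using mult_p_bound[of "b j" v] mult_p_bound[of "m j" v] bnd[of j] by linarith+
      moreover have "\<bar>cap (l j) (m j) (e j) v + cap (l j) (m j) (- e j) v - d\<bar> \<le> 2 + \<bar>d\<bar>"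
        using cap_bounds[of "l j" "m j" "e j" v] cap_bounds[of "l j" "m j" "- e j" v] by linarith
      ultimately show "norm (?F j v)
      \<le> ?C"
        using M_nonneg nn unfolding real_norm_def abs_mult power_abs
        by (intro mult_mono power_mono mult_nonneg_nonneg) auto
    qed
  qed auto
qed

end

section \<open>Rotation invariance and lenses of balls\<close>

text \<open>The measure that maps \<open>A\<close> to \<open>|T\<^sup>-\<^sup>1(A)|\<close> is translation invariant. For the unit ball \<open>B\<close>,
  Fubini's theorem gives \<open>|B| |T\<^sup>-\<^sup>1(A)| = |T\<^sup>-\<^sup>1(B)| |A|\<close>, and \<open>T\<close> preserves \<open>B\<close>.\<close>

lemma emeasure_lborel_orthogonal_vimage:
  fixes T :: "'a::euclidean_space \<Rightarrow> 'a"
  assumes T: "orthogonal_transformation T" and A: "A \<in> sets borel"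
  shows "emeasure lborel (T -` A) = emeasure lborel A"
proof -
  have lin: "linear T" using T by (rule orthogonal_transformation_linear)
  have [measurable]: "T \<in> borel_measurable borel"
    by (intro borel_measurable_continuous_onI linear_continuous_on linear_linear[THEN iffD2] lin)
  note A[measurable]
  have transl: "(\<integral>\<^sup>+y. f (x + y) \<partial>lborel) = (\<integral>\<^sup>+y. f y \<partial>lborel)" if [measurable]: "f \<in> borel_measurable borel" for f and x :: 'a
    by (subst (2) lborel_distr_plus[of x, symmetric]) (simp add: nn_integral_distr)
  let ?B = "cball 0 1 :: 'a set"
  have B[measurable]: "?B \<in> sets borel" by auto
  have TB: "norm (T x) = norm x" for x by (rule orthogonal_transformation_norm[OF T])
  have TA[measurable]: "T -` A \<in> sets borel"
    using measurable_sets[of T borel borel A] by simp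
  have "(\<integral>\<^sup>+y. indicator A (T y) \<partial>lborel) = (\<integral>\<^sup>+y. indicator (T -` A) y \<partial>lborel)"
    by (intro nn_integral_cong) (simp add: indicator_def)
  then have "emeasure lborel ?B * emeasure lborel (T -` A) = (\<integral>\<^sup>+x. indicator ?B x * (\<integral>\<^sup>+y. indicator A (T y) \<partial>lborel) \<partial>lborel)"
    using TA by (simp add: nn_integral_multc)
  also have "\<dots> = (\<integral>\<^sup>+x. (\<integral>\<^sup>+y. indicator ?B x * indicator A (x + T y) \<partial>lborel) \<partial>lborel)"
  proof (rule nn_integral_cong)
    fix x :: 'a
    obtain x' where x': "x = T x'" using orthogonal_transformation_surj[OF T] by (metis surjD)
    have "(\<integral>\<^sup>+y. indicator A (x + T y) \<partial>lborel) = (\<integral>\<^sup>+y. indicator A (T (x' + y)) \<partial>lborel)"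
      by (simp add: x' linear_add[OF lin])
    also have "\<dots> = (\<integral>\<^sup>+y. indicator A (T y) \<partial>lborel)"
      by (rule transl[of "\<lambda>y. indicator A (T y)"]) measurable
    finally show "indicator ?B x * (\<integral>\<^sup>+y. indicator A (T y) \<partial>lborel) = (\<integral>\<^sup>+y. indicator ?B x * indicator A (x + T y) \<partial>lborel)"
      by (subst nn_integral_cmult) auto
  qed
  also have "\<dots> = (\<integral>\<^sup>+y. (\<integral>\<^sup>+x. indicator ?B x * indicator A (x + T y) \<partial>lborel) \<partial>lborel)"
    by (rule lborel_pair.Fubini') measurable
  also have "\<dots> = (\<integral>\<^sup>+y. (\<integral>\<^sup>+x. indicator ?B (x - T y) * indicator A x \<partial>lborel) \<partial>lborel)"
  proof (rule nn_integral_cong)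
    fix y :: 'a
    show "(\<integral>\<^sup>+x. indicator ?B x * indicator A (x + T y) \<partial>lborel) = (\<integral>\<^sup>+x. indicator ?B (x - T y) * indicator A x \<partial>lborel)"
      using transl[of "\<lambda>x. indicator ?B (x - T y) * indicator A x" "T y"] by (simp add: add.commute)
  qed
  also have "\<dots> = (\<integral>\<^sup>+x. (\<integral>\<^sup>+y. indicator ?B (x - T y) * indicator A x \<partial>lborel) \<partial>lborel)"
    by (rule lborel_pair.Fubini') measurable
  also have "\<dots> = (\<integral>\<^sup>+x. emeasure lborel ?B * indicator A x \<partial>lborel)"
  proof (rule nn_integral_cong)
    fix x :: 'a
    obtain x' where x': "x = T x'" using orthogonal_transformation_surj[OF T] by (metis surjD)
    have "(\<integral>\<^sup>+y. indicator ?B (x - T y) \<partial>lborel) = (\<integral>\<^sup>+y. indicator (cball x' 1) y \<partial>lborel)"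
    proof (rule nn_integral_cong)
      fix y
      have "norm (x - T y) = norm (x' - y)" using TB[of "x' - y"] by (simp add: x' linear_diff[OF lin])
      then show "indicator ?B (x - T y) = (indicator (cball x' 1) y :: ennreal)"
        by (simp only: indicator_def mem_cball dist_norm diff_0 norm_minus_cancel)
    qed
    also have "\<dots> = emeasure lborel (cball x' 1)" by simp
    also have "\<dots> = (\<integral>\<^sup>+y. indicator (cball x' 1) (x' + y) \<partial>lborel)"
      by (subst transl) auto
    also have "\<dots> = (\<integral>\<^sup>+y. indicator ?B y \<partial>lborel)"
      by (intro nn_integral_cong) (simp add: indicator_def dist_norm)
    finally show "(\<integral>\<^sup>+y. indicator ?B (x - T y) * indicator A x \<partial>lborel) = emeasure lborel ?B * indicator A x"
      by (subst nn_integral_multc) auto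
  qed
  also have "\<dots> = emeasure lborel ?B * emeasure lborel A"
    by (subst nn_integral_cmult) auto
  finally have "emeasure lborel ?B * emeasure lborel (T -` A) = emeasure lborel ?B * emeasure lborel A" .
  moreover have "emeasure lborel ?B \<noteq> 0"
    using content_cball_pos[of 1 "0::'a"] by (auto simp: measure_def)
  moreover have "emeasure lborel ?B \<noteq> \<infinity>" using emeasure_lborel_cball_finite[of "0::'a" 1] by simp
  ultimately show ?thesis
    by (simp add: ennreal_mult_cancel_left)
qed

lemma reflection_exists:
  fixes u w :: "'a::euclidean_space"
  assumes "norm u = norm w"
  shows "\<exists>T. orthogonal_transformation T \<and> T u = w \<and> T w = u"
proof (cases "u = w")
  case True
  then show ?thesis using orthogonal_transformation_id by (intro exI[of _ "\<lambda>x. x"]) simp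
next
  case False
  define a where "a = u - w"
  have a: "a \<bullet> a \<noteq> 0" using False by (simp add: a_def)
  define c where "c = 2 / (a \<bullet> a)"
  have c: "c * (a \<bullet> a) = 2" using a by (simp add: c_def)
  define T where "T x = x - (c * (x \<bullet> a)) *\<^sub>R a" for x
  have 1: "linear T"
    by (rule linearI) (simp_all only: T_def inner_add_left inner_scaleR_left distrib_left scaleR_left_distrib
        scaleR_right_diff_distrib scaleR_scaleR mult.left_commute add_diff_add)
  moreover have "T x \<bullet> T y = x \<bullet> y" for x y
  proof -
    have "T x \<bullet> T y = x \<bullet> y - c * (y \<bullet> a) * (x \<bullet> a) - c * (x \<bullet> a) * (y \<bullet> a)
        + (c * (a \<bullet> a)) * (c * (x \<bullet> a) * (y \<bullet> a))"
      unfolding T_def inner_diff_left inner_diff_right inner_scaleR_left inner_scaleR_right inner_commute[of a y]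
      by algebra
    then show ?thesis unfolding c by simp
  qed
  ultimately have T: "orthogonal_transformation T"
    by (simp add: orthogonal_transformation_def)
  have uw: "u \<bullet> u = w \<bullet> w" using assms by (metis dot_square_norm)
  have "2 * (u \<bullet> a) = a \<bullet> a" "2 * (w \<bullet> a) = - (a \<bullet> a)"
    using uw by (simp_all add: a_def algebra_simps inner_commute)
  then have "c * (2 * (u \<bullet> a)) = 2" "c * (2 * (w \<bullet> a)) = - 2" using c by simp_all
  then have "c * (u \<bullet> a) = 1" "c * (w \<bullet> a) = - 1" by simp_all
  then have "T u = u - a" "T w = w + a" by (simp_all add: T_def)
  then show ?thesis using T by (intro exI[of _ T]) (simp add: a_def)
qed

lemma sets_scaled_vimage:
  fixes A :: "'a::euclidean_space set"
  assumes "A \<in> sets borel"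
  shows "{y. c *\<^sub>R y \<in> A} \<in> sets borel"
  using measurable_sets[of "\<lambda>y. c *\<^sub>R y" borel borel A] assms by (simp add: vimage_def)

lemma measure_lborel_scaled:
  fixes A :: "'a::euclidean_space set"
  assumes c: "0 < c" and A[measurable]: "A \<in> sets borel"
  shows "vol {y. c *\<^sub>R y \<in> A} * c ^ DIM('a) = vol A"
proof -
  have "emeasure lborel A = emeasure (density (distr lborel borel (\<lambda>x. 0 + c *\<^sub>R x)) (\<lambda>_. ennreal (\<bar>c\<bar>^DIM('a)))) A"
  proof -
    have L: "(lborel :: 'a measure) = density (distr lborel borel (\<lambda>x. 0 + c *\<^sub>R x)) (\<lambda>_. ennreal (\<bar>c\<bar>^DIM('a)))"
      using c by (intro lborel_affine) simp
    show ?thesis by (subst (1) L) (rule refl)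
  qed
  also have "\<dots> = ennreal (c ^ DIM('a)) * emeasure lborel {y. c *\<^sub>R y \<in> A}"
    using c by (simp add: emeasure_density_const emeasure_distr vimage_def)
  finally have "enn2real (emeasure lborel A) = enn2real (ennreal (c ^ DIM('a)) * emeasure lborel {y. c *\<^sub>R y \<in> A})"
    by simp
  then show ?thesis using c by (simp add: measure_def enn2real_mult)
qed

lemma measure_cball_scaled:
  assumes "0 < r"
  shows "vol (cball (c::'a::euclidean_space) r) = r ^ DIM('a) * vol (cball (0::'a) 1)"
proof -
  have "vol (cball c r) = vol {x. c + x \<in> cball c r}"
    by (rule measure_lborel_translation[symmetric]) auto
  also have "{x. c + x \<in> cball c r} = cball 0 r" by (auto simp: dist_norm)
  also have "vol (cball (0::'a) r) = vol {y. r *\<^sub>R y \<in> cball (0::'a) r} * r ^ DIM('a)"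
    using assms by (intro measure_lborel_scaled[symmetric]) auto
  also have "{y. r *\<^sub>R y \<in> cball (0::'a) r} = cball 0 1" using assms by auto
  finally show ?thesis by simp
qed

text \<open>The volume of the intersection of two balls of radius \<open>r\<close>, with centres \<open>0\<close> and \<open>x\<close>.\<close>

definition lens :: "real \<Rightarrow> 'a::euclidean_space \<Rightarrow> real" where
  "lens r x = vol (cball 0 r \<inter> cball x r)"

lemma lens_rotate:
  fixes x y :: "'a::euclidean_space"
  assumes "norm x = norm y"
  shows "lens r x = lens r y"
proof -
  obtain T where T: "orthogonal_transformation T" "T x = y" using reflection_exists[OF assms] by blast
  have "T -` (cball 0 r \<inter> cball y r) = cball 0 r \<inter> cball x r"
  proof -
    have "dist y (T z) = dist x z" for z
      using orthogonal_transformation_norm[OF T(1), of "x - z"] T(2)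
      by (simp add: dist_norm linear_diff[OF orthogonal_transformation_linear[OF T(1)]])
    then show ?thesis
      using orthogonal_transformation_norm[OF T(1)] by auto
  qed
  then show ?thesis
    using emeasure_lborel_orthogonal_vimage[OF T(1), of "cball 0 r \<inter> cball y r"]
    by (simp add: lens_def measure_def)
qed

text \<open>The cone measure of a spherical cap with axis \<open>u\<close>.\<close>

definition cap_measure :: "real \<Rightarrow> 'a::euclidean_space \<Rightarrow> real" where
  "cap_measure c u = measure cone_measure {v. c \<le> u \<bullet> v}"

lemma cap_measure_rotate:
  fixes x y :: "'a::euclidean_space"
  assumes "norm x = norm y"
  shows "cap_measure c x = cap_measure c y"
proof -
  obtain T where T: "orthogonal_transformation T" "T x = y" using reflection_exists[OF assms] by blast
  have in_T: "T a \<bullet> T b = a \<bullet> b" for a b using T(1) by (simp add: orthogonal_transformation_def)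
  have sgnT: "sgn (T z) = T (sgn z)" for z
    using orthogonal_transformation_norm[OF T(1)] orthogonal_transformation_linear[OF T(1)]
    by (simp add: sgn_div_norm linear_scale)
  define S where "S u = {z::'a. z \<in> cball 0 1 \<and> sgn z \<in> {v. c \<le> u \<bullet> v}}" for u
  have S: "emeasure cone_measure {v. c \<le> u \<bullet> v} = emeasure lborel (S u)" for u :: 'a
    unfolding S_def by (rule emeasure_cone_measure) measurable
  have S_sets: "S y \<in> sets borel"
    unfolding S_def by measurable
  have "z \<in> T -` S y \<longleftrightarrow> z \<in> S x" for z
    unfolding S_def T(2)[symmetric] by (simp add: sgnT in_T orthogonal_transformation_norm[OF T(1)])
  then have "T -` S y = S x" by blast
  then show ?thesis
    using emeasure_lborel_orthogonal_vimage[OF T(1) S_sets] by (simp add: cap_measure_def measure_def S)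
qed

text \<open>After a translation along \<open>v\<close> that aligns the midpoints of the centres, the lens with the larger
  distance is contained in the other one, by convexity.\<close>

lemma lens_antimono:
  fixes v :: "'a::euclidean_space"
  assumes s: "0 \<le> s" "s \<le> s'"
  shows "lens r (s' *\<^sub>R v) \<le> lens r (s *\<^sub>R v)"
proof (cases "s' = 0")
  case True then show ?thesis using s by simp
next
  case False
  then have s': "s' > 0" using s by linarith
  define d where "d = (s' - s) / 2"
  have cc: "norm (y - (\<theta> * s') *\<^sub>R v) \<le> r" if "norm y \<le> r" "norm (y - s' *\<^sub>R v) \<le> r" "0 \<le> \<theta>" "\<theta> \<le> 1" for y \<theta>
  proof -
    have "y - (\<theta> * s') *\<^sub>R v = (1 - \<theta>) *\<^sub>R y + \<theta> *\<^sub>R (y - s' *\<^sub>R v)" by (simp add: algebra_simps)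
    also have "norm \<dots> \<le> (1 - \<theta>) * norm y + \<theta> * norm (y - s' *\<^sub>R v)"
      using that by (intro order_trans[OF norm_triangle_ineq]) simp
    also have "\<dots> \<le> (1 - \<theta>) * r + \<theta> * r" using that by (intro add_mono mult_left_mono) auto
    finally show ?thesis by (simp add: algebra_simps)
  qed
  have "lens r (s' *\<^sub>R v) = vol {x. d *\<^sub>R v + x \<in> cball 0 r \<inter> cball (s' *\<^sub>R v) r}"
    unfolding lens_def by (rule measure_lborel_translation[symmetric]) auto
  also have "\<dots> \<le> lens r (s *\<^sub>R v)"
    unfolding lens_def
  proof (rule measure_mono_fmeasurable)
    show "{x. d *\<^sub>R v + x \<in> cball 0 r \<inter> cball (s' *\<^sub>R v) r} \<subseteq> cball 0 r \<inter> cball (s *\<^sub>R v) r"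
    proof safe
      fix x assume x: "d *\<^sub>R v + x \<in> cball 0 r" "d *\<^sub>R v + x \<in> cball (s' *\<^sub>R v) r"
      define y where "y = d *\<^sub>R v + x"
      have y: "norm y \<le> r" "norm (y - s' *\<^sub>R v) \<le> r"
        using x unfolding y_def[symmetric] by (auto simp: dist_norm norm_minus_commute)
      have 1: "d / s' * s' = d" "(d + s) / s' * s' = d + s" using s' by auto
      have th: "0 \<le> d / s'" "d / s' \<le> 1" "0 \<le> (d + s) / s'" "(d + s) / s' \<le> 1"
        using s s' by (auto simp: d_def field_simps)
      show "x \<in> cball 0 r" using cc[OF y th(1,2)] unfolding 1 by (simp add: y_def)
      show "x \<in> cball (s *\<^sub>R v) r"
        using cc[OF y th(3,4)] unfolding 1 by (simp add: y_def dist_norm norm_minus_commute algebra_simps)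
    qed
    show "{x. d *\<^sub>R v + x \<in> cball 0 r \<inter> cball (s' *\<^sub>R v) r} \<in> sets lborel"
      using closed_vimage[of "cball 0 r \<inter> cball (s' *\<^sub>R v) r" "\<lambda>x. d *\<^sub>R v + x"]
      by (auto simp: vimage_def intro!: borel_closed continuous_intros)
    show "cball 0 r \<inter> cball (s *\<^sub>R v) r \<in> fmeasurable lborel"
    proof (rule fmeasurableI)
      show "emeasure lborel (cball 0 r \<inter> cball (s *\<^sub>R v) r) < \<infinity>"
        using emeasure_mono[of "cball 0 r \<inter> cball (s *\<^sub>R v) r" "cball 0 r" lborel] emeasure_lborel_cball_finite[of "0::'a" r]
        by (auto intro: le_less_trans)
    qed auto
  qed
  finally show ?thesis .
qed

lemma lens_scaled:
  fixes v :: "'a::euclidean_space"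
  assumes "0 < l"
  shows "lens (l * r) v = l ^ DIM('a) * lens r (v /\<^sub>R l)"
proof -
  have "{y. l *\<^sub>R y \<in> cball 0 (l * r) \<inter> cball v (l * r)} = cball 0 r \<inter> cball (v /\<^sub>R l) r"
  proof -
    have "norm (v - l *\<^sub>R y) = l * norm (v /\<^sub>R l - y)" for y
    proof -
      have "v - l *\<^sub>R y = l *\<^sub>R (v /\<^sub>R l - y)" using assms by (simp add: algebra_simps)
      then show ?thesis using assms by simp
    qed
    then show ?thesis using assms by (auto simp: dist_norm)
  qed
  then show ?thesis
    using measure_lborel_scaled[OF assms, of "cball 0 (l * r) \<inter> cball v (l * r)"]
    by (simp add: lens_def mult.commute)
qed

text \<open>The sector \<open>C\<close> over the cap, together with its image under \<open>x \<mapsto> e - x\<close>, covers the lens; already the half \<open>H\<close> of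
  the lens is contained in \<open>C\<close>, and \<open>C - H\<close> contains a neighbourhood \<open>U\<close> of \<open>e / 4\<close>.\<close>

lemma lens_lt_cap:
  fixes e :: "'a::euclidean_space"
  assumes l: "1/2 < l" and e: "norm e = 1"
  shows "lens l e < 2 * (l ^ DIM('a) * cap_measure (1 / (2 * l)) e)"
proof -
  have ee: "e \<bullet> e = 1" using e by (simp add: dot_square_norm)
  define C where "C = cball 0 l \<inter> {y. norm y \<le> 2 * l * (y \<bullet> e)}"
  define H where "H = cball 0 l \<inter> cball e l \<inter> {y. 1/2 \<le> y \<bullet> e}"
  define U where "U = {y. norm y < 2 * l * (y \<bullet> e)} \<inter> ball 0 l \<inter> {y. y \<bullet> e < 1/2}"
  have meas[measurable]: "C \<in> sets borel" "H \<in> sets borel" "U \<in> sets borel"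
    by (auto simp: C_def H_def U_def intro!: sets.Int borel_closed borel_open closed_Collect_le open_Collect_less continuous_intros)
  have fin: "S \<in> fmeasurable lborel" if "S \<subseteq> cball 0 l" "S \<in> sets borel" for S :: "'a set"
  proof (rule fmeasurableI)
    show "emeasure lborel S < \<infinity>"
      using emeasure_mono[OF that(1), of lborel] emeasure_lborel_cball_finite[of "0::'a" l] by (auto intro: le_less_trans)
  qed (use that in auto)
  have fm: "C \<in> fmeasurable lborel" "H \<in> fmeasurable lborel" "U \<in> fmeasurable lborel"
    by (auto intro!: fin simp: C_def H_def U_def)
  have "open U" unfolding U_def by (intro open_Int open_Collect_less open_ball continuous_intros)
  moreover have "(1/4) *\<^sub>R e \<in> U" using l e ee by (auto simp: U_def)
  ultimately obtain r where r: "r > 0" "ball ((1/4) *\<^sub>R e) r \<subseteq> U" by (meson openE)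
  have "0 < vol (ball ((1/4) *\<^sub>R e) r)" using r(1) by (rule content_ball_pos)
  also have "\<dots> \<le> vol U" using r fm by (intro measure_mono_fmeasurable) auto
  finally have Upos: "0 < vol U" .
  have "vol H + vol U = vol (H \<union> U)"
  proof (rule measure_Union[symmetric])
    show "H \<inter> U = {}" by (auto simp: H_def U_def)
  qed (use fm in \<open>auto simp: fmeasurable_def\<close>)
  also have "\<dots> \<le> vol C"
  proof (intro measure_mono_fmeasurable)
    show "H \<union> U \<subseteq> C"
    proof safe
      fix y assume "y \<in> H"
      then have "norm y \<le> l" "1/2 \<le> y \<bullet> e" by (auto simp: H_def)
      moreover have "2 * l * (1/2) \<le> 2 * l * (y \<bullet> e)" using l \<open>1/2 \<le> y \<bullet> e\<close> by (intro mult_left_mono) auto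
      ultimately show "y \<in> C" by (auto simp: C_def)
    next
      fix y assume "y \<in> U" then show "y \<in> C" by (auto simp: U_def C_def)
    qed
  qed (use fm in auto)
  finally have HC: "vol H < vol C" using Upos by linarith
  have um: "orthogonal_transformation (uminus :: 'a \<Rightarrow> 'a)"
    by (simp add: orthogonal_transformation_neg orthogonal_transformation_id)
  have [measurable]: "uminus -` H \<in> sets borel"
    using measurable_sets[of uminus borel borel H] by simp
  have [measurable]: "{x. e - x \<in> H} \<in> sets borel" by measurable
  have mH': "vol {x. e - x \<in> H} = vol H"
  proof -
    have "{x. e - x \<in> H} = {x. - e + x \<in> uminus -` H}" by auto
    then have "vol {x. e - x \<in> H} = vol (uminus -` H)"
      using measure_lborel_translation[of "uminus -` H" "- e"] by simp
    also have "\<dots> = vol H"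
      using emeasure_lborel_orthogonal_vimage[OF um, of H] by (simp add: measure_def)
    finally show ?thesis .
  qed
  have "lens l e \<le> vol (H \<union> {x. e - x \<in> H})"
    unfolding lens_def
  proof (intro measure_mono_fmeasurable)
    show "cball 0 l \<inter> cball e l \<subseteq> H \<union> {x. e - x \<in> H}"
      using ee by (auto simp: H_def dist_norm norm_minus_commute inner_diff_left)
    have "{x. e - x \<in> H} \<subseteq> cball 0 l" by (auto simp: H_def dist_norm)
    then show "H \<union> {x. e - x \<in> H} \<in> fmeasurable lborel"
      by (intro fmeasurable.Un[OF fm(2)] fin) auto
  qed auto
  also have "\<dots> \<le> vol H + vol {x. e - x \<in> H}"
    by (intro measure_Un_le) auto
  finally have "lens l e < 2 * vol C" using mH' HC by linarith
  also have "vol C = l ^ DIM('a) * cap_measure (1 / (2 * l)) e"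
  proof -
    have "emeasure lborel C = (\<integral>\<^sup>+v. emeasure (radial_measure DIM('a)) {s. s *\<^sub>R v \<in> C} \<partial>cone_measure)"
      by (rule emeasure_lborel_polar) measurable
    also have "\<dots> = (\<integral>\<^sup>+v. ennreal (l ^ DIM('a)) * indicator {v. 1 / (2 * l) \<le> e \<bullet> v} v \<partial>cone_measure)"
    proof (rule nn_integral_cong_AE, use AE_cone_measure_norm in eventually_elim)
      fix v :: 'a assume v: "norm v = 1"
      have iff: "0 < s \<Longrightarrow> s *\<^sub>R v \<in> C \<longleftrightarrow> s \<le> l \<and> 1 / (2 * l) \<le> e \<bullet> v" for s
        using v l by (auto simp: C_def field_simps inner_commute)
      have "emeasure (radial_measure DIM('a)) {s. s *\<^sub>R v \<in> C}
        = emeasure (radial_measure DIM('a)) (if 1 / (2 * l) \<le> e \<bullet> v then {0<..l} else {})"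
        by (rule emeasure_eq_AE, use AE_radial_measure_pos in eventually_elim) (auto simp: iff)
      then show "emeasure (radial_measure DIM('a)) {s. s *\<^sub>R v \<in> C}
        = ennreal (l ^ DIM('a)) * indicator {v. 1 / (2 * l) \<le> e \<bullet> v} v"
        using l by (auto simp: emeasure_radial_measure_Ioc)
    qed
    also have "\<dots> = ennreal (l ^ DIM('a)) * emeasure cone_measure {v. 1 / (2 * l) \<le> e \<bullet> v}"
      by (subst nn_integral_cmult) auto
    finally show ?thesis using l by (simp add: cap_measure_def measure_def enn2real_mult)
  qed
  finally show ?thesis .
qed

section \<open>Differentiation under the integral and implicit roots\<close>

lemma tendsto_at_if_sequences_within:
  fixes f :: "real \<Rightarrow> real"
  assumes t: "\<bar>t\<bar> < \<tau>"
    and seq: "\<And>Z. Z \<longlonglongrightarrow> t \<Longrightarrow> (\<And>i. Z i \<noteq> t) \<Longrightarrow> (\<And>i::nat. \<bar>Z i\<bar> < \<tau>) \<Longrightarrow> (\<lambda>i. f (Z i)) \<longlonglongrightarrow> a"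
  shows "(f \<longlongrightarrow> a) (at t)"
proof -
  have "(f \<longlongrightarrow> a) (at t within {-\<tau><..<\<tau>})"
    unfolding tendsto_at_iff_sequentially
  proof (intro allI impI)
    fix Z assume Z: "\<forall>i. Z i \<in> {-\<tau><..<\<tau>} - {t}" "Z \<longlonglongrightarrow> t"
    have "\<bar>Z i\<bar> < \<tau>" "Z i \<noteq> t" for i using Z(1)[rule_format, of i] by auto
    then show "(f \<circ> Z) \<longlonglongrightarrow> a" unfolding o_def by (intro seq Z)
  qed
  then show ?thesis using t by (subst (asm) at_within_open) auto
qed

lemma has_derivative_integral_param:
  fixes f f' :: "real \<Rightarrow> 'a \<Rightarrow> real"
  assumes M: "finite_measure M" and t: "\<bar>t\<bar> < \<tau>"
    and int: "\<And>t. \<bar>t\<bar> < \<tau> \<Longrightarrow> integrable M (f t)"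
    and der: "\<And>t x. \<bar>t\<bar> < \<tau> \<Longrightarrow> x \<in> space M \<Longrightarrow> ((\<lambda>t. f t x) has_real_derivative f' t x) (at t)"
    and bnd: "\<And>t x. \<bar>t\<bar> < \<tau> \<Longrightarrow> x \<in> space M \<Longrightarrow> \<bar>f' t x\<bar> \<le> C"
  shows "f' t \<in> borel_measurable M"
    and "((\<lambda>t. \<integral>x. f t x \<partial>M) has_real_derivative (\<integral>x. f' t x \<partial>M)) (at t)"
proof -
  interpret finite_measure M by fact
  have dq: "(\<lambda>i. (f (X i) x - f t x) / (X i - t)) \<longlonglongrightarrow> f' t x"
    if "X \<longlonglongrightarrow> t" "\<And>i. X i \<noteq> t" "x \<in> space M" for X :: "nat \<Rightarrow> real" and x
    using der[OF t that(3)] that(1,2)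
    unfolding has_field_derivative_iff tendsto_at_iff_sequentially by (auto simp: o_def)
  define \<epsilon> where "\<epsilon> = \<tau> - \<bar>t\<bar>"
  have \<epsilon>: "0 < \<epsilon>" using t by (simp add: \<epsilon>_def)
  define Y where "Y i = t + \<epsilon> / real (i + 2)" for i
  have Ylim: "Y \<longlonglongrightarrow> t"
  proof -
    have "(\<lambda>i. t + \<epsilon> * inverse (real (i + 2))) \<longlonglongrightarrow> t + \<epsilon> * 0"
      by (intro tendsto_intros LIMSEQ_ignore_initial_segment[OF lim_inverse_n])
    then show ?thesis unfolding Y_def by (simp add: divide_inverse)
  qed
  have Yt: "Y i \<noteq> t" "\<bar>Y i\<bar> < \<tau>" for i
  proof -
    have "\<epsilon> / real (i + 2) < \<epsilon>" using \<epsilon> by (simp add: field_simps add_pos_nonneg)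
    moreover have "0 < \<epsilon> / real (i + 2)" using \<epsilon> by simp
    ultimately show "Y i \<noteq> t" "\<bar>Y i\<bar> < \<tau>" unfolding Y_def \<epsilon>_def by linarith+
  qed
  note [measurable] = borel_measurable_integrable[OF int]
  show meas[measurable]: "f' t \<in> borel_measurable M"
  proof (rule borel_measurable_LIMSEQ_real)
    show "\<And>x. x \<in> space M \<Longrightarrow> (\<lambda>i. (f (Y i) x - f t x) / (Y i - t)) \<longlonglongrightarrow> f' t x"
      by (rule dq[OF Ylim Yt(1)])
    show "(\<lambda>x. (f (Y i) x - f t x) / (Y i - t)) \<in> borel_measurable M" for i
      using int[OF Yt(2), of i] int[OF t] by measurable
  qed
  show "((\<lambda>t. \<integral>x. f t x \<partial>M) has_real_derivative (\<integral>x. f' t x \<partial>M)) (at t)"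
    unfolding has_field_derivative_iff
  proof (rule tendsto_at_if_sequences_within[OF t])
    fix Z :: "nat \<Rightarrow> real" assume Z: "Z \<longlonglongrightarrow> t" "\<And>i. Z i \<noteq> t" "\<And>i. \<bar>Z i\<bar> < \<tau>"
    have "(\<lambda>i. \<integral>x. (f (Z i) x - f t x) / (Z i - t) \<partial>M) \<longlonglongrightarrow> (\<integral>x. f' t x \<partial>M)"
    proof (rule integral_dominated_convergence[where w="\<lambda>_. C"])
      show "AE x in M. (\<lambda>i. (f (Z i) x - f t x) / (Z i - t)) \<longlonglongrightarrow> f' t x"
        using dq[OF Z(1,2)] by (intro AE_I2)
      show "(\<lambda>x. (f (Z i) x - f t x) / (Z i - t)) \<in> borel_measurable M" for i
        using int[OF Z(3), of i] int[OF t] by measurable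
      show "AE x in M. norm ((f (Z i) x - f t x) / (Z i - t)) \<le> C" for i
      proof (rule AE_I2)
        fix x assume x: "x \<in> space M"
        have "\<bar>f (Z i) x - f t x\<bar> \<le> C * \<bar>Z i - t\<bar>"
        proof -
          have "norm (f (Z i) x - f t x) \<le> C * norm (Z i - t)"
          proof (rule field_differentiable_bound[of "{-\<tau><..<\<tau>}" "\<lambda>s. f s x" "\<lambda>s. f' s x"])
            show "((\<lambda>s. f s x) has_field_derivative f' s x) (at s within {-\<tau><..<\<tau>})" if "s \<in> {-\<tau><..<\<tau>}" for s
              using der[of s x] x that by (auto intro: has_field_derivative_at_within)
            show "norm (f' s x) \<le> C" if "s \<in> {-\<tau><..<\<tau>}" for s
              using bnd[of s x] x that by auto
          qed (use Z(3)[of i] t in auto)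
          then show ?thesis by simp
        qed
        then show "norm ((f (Z i) x - f t x) / (Z i - t)) \<le> C"
          using Z(2)[of i] by (simp add: field_simps)
      qed
    qed auto
    also have "(\<lambda>i. \<integral>x. (f (Z i) x - f t x) / (Z i - t) \<partial>M)
        = (\<lambda>i. ((\<integral>x. f (Z i) x \<partial>M) - (\<integral>x. f t x \<partial>M)) / (Z i - t))"
      using Bochner_Integration.integral_diff[OF int[OF Z(3)] int[OF t]] by simp
    finally show "(\<lambda>i. ((\<integral>x. f (Z i) x \<partial>M) - (\<integral>x. f t x \<partial>M)) / (Z i - t)) \<longlonglongrightarrow> (\<integral>x. f' t x \<partial>M)" .
  qed
qed

lemma continuous_on_integral_param:
  fixes f :: "real \<Rightarrow> 'a \<Rightarrow> real"
  assumes M: "finite_measure M"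
    and meas: "\<And>t. t \<in> S \<Longrightarrow> f t \<in> borel_measurable M"
    and cont: "\<And>x. x \<in> space M \<Longrightarrow> continuous_on S (\<lambda>t. f t x)"
    and bnd: "\<And>t x. t \<in> S \<Longrightarrow> x \<in> space M \<Longrightarrow> \<bar>f t x\<bar> \<le> C"
  shows "continuous_on S (\<lambda>t. \<integral>x. f t x \<partial>M)"
  unfolding continuous_on_sequentially
proof (intro allI impI ballI)
  interpret finite_measure M by fact
  fix X :: "nat \<Rightarrow> real" and t assume t: "t \<in> S" and X: "(\<forall>n. X n \<in> S) \<and> X \<longlonglongrightarrow> t"
  show "((\<lambda>t. \<integral>x. f t x \<partial>M) \<circ> X) \<longlonglongrightarrow> (\<integral>x. f t x \<partial>M)"
    unfolding o_def
  proof (rule integral_dominated_convergence[where w="\<lambda>_. C"])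
    show "AE x in M. (\<lambda>i. f (X i) x) \<longlonglongrightarrow> f t x"
      using cont t X unfolding continuous_on_sequentially by (intro AE_I2) (simp add: o_def)
  qed (use meas t X bnd in auto)
qed

text \<open>No continuity of the root \<open>r\<close> is assumed: the lower bound on \<open>Gl\<close> and the upper bound on \<open>Gt\<close> make it
  Lipschitz. Then \<open>r s - r t\<close> is \<open>- (G s (r t) - G t (r t)) / Gl s (\<xi> s)\<close> with an intermediate point \<open>\<xi> s\<close>.\<close>

lemma has_derivative_implicit_root:
  fixes G Gl Gt :: "real \<Rightarrow> real \<Rightarrow> real"
  assumes t: "\<bar>t\<bar> < \<tau>" and c: "0 < c"
    and dl: "\<And>t l. \<bar>t\<bar> < \<tau> \<Longrightarrow> a \<le> l \<Longrightarrow> l \<le> b \<Longrightarrow> (G t has_real_derivative Gl t l) (at l)"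
    and dt: "\<And>t l. \<bar>t\<bar> < \<tau> \<Longrightarrow> a \<le> l \<Longrightarrow> l \<le> b \<Longrightarrow> ((\<lambda>t. G t l) has_real_derivative Gt t l) (at t)"
    and cont: "continuous_on ({-\<tau><..<\<tau>} \<times> {a..b}) (\<lambda>(t, l). Gl t l)"
    and lb: "\<And>t l. \<bar>t\<bar> < \<tau> \<Longrightarrow> a \<le> l \<Longrightarrow> l \<le> b \<Longrightarrow> c \<le> Gl t l"
    and ub: "\<And>t l. \<bar>t\<bar> < \<tau> \<Longrightarrow> a \<le> l \<Longrightarrow> l \<le> b \<Longrightarrow> \<bar>Gt t l\<bar> \<le> C"
    and r: "\<And>t. \<bar>t\<bar> < \<tau> \<Longrightarrow> a \<le> r t \<and> r t \<le> b \<and> G t (r t) = 0"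
  shows "(r has_real_derivative (- Gt t (r t) / Gl t (r t))) (at t)"
proof -
  have mvt: "\<exists>\<xi>. min (r t) (r s) \<le> \<xi> \<and> \<xi> \<le> max (r t) (r s) \<and> - G s (r t) = Gl s \<xi> * (r s - r t)"
    if s: "\<bar>s\<bar> < \<tau>" for s
  proof (cases "r s = r t")
    case True then show ?thesis using r[OF s] by (intro exI[of _ "r t"]) auto
  next
    case False
    have *: "\<exists>z>x. z < y \<and> G s y - G s x = (y - x) * Gl s z" if "x < y" "a \<le> x" "y \<le> b" for x y
      using MVT2[of x y "G s" "Gl s"] that dl[OF s] by auto
    from False consider "r s < r t" | "r t < r s" by linarith
    then show ?thesis
    proof cases
      case 1
      then obtain z where "r s < z" "z < r t" "G s (r t) - G s (r s) = (r t - r s) * Gl s z"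
        using *[of "r s" "r t"] r[OF s] r[OF t] by auto
      then show ?thesis using r[OF s] by (intro exI[of _ z]) (auto simp: algebra_simps)
    next
      case 2
      then obtain z where "r t < z" "z < r s" "G s (r s) - G s (r t) = (r s - r t) * Gl s z"
        using *[of "r t" "r s"] r[OF s] r[OF t] by auto
      then show ?thesis using r[OF s] by (intro exI[of _ z]) (auto simp: algebra_simps)
    qed
  qed
  define \<xi> where "\<xi> s = (SOME \<xi>. min (r t) (r s) \<le> \<xi> \<and> \<xi> \<le> max (r t) (r s) \<and> - G s (r t) = Gl s \<xi> * (r s - r t))" for s
  have \<xi>: "min (r t) (r s) \<le> \<xi> s" "\<xi> s \<le> max (r t) (r s)" "- G s (r t) = Gl s (\<xi> s) * (r s - r t)"
    if s: "\<bar>s\<bar> < \<tau>" for s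
    using someI_ex[OF mvt[OF s]] unfolding \<xi>_def by auto
  have \<xi>ab: "a \<le> \<xi> s" "\<xi> s \<le> b" if s: "\<bar>s\<bar> < \<tau>" for s
    using \<xi>[OF s] r[OF s] r[OF t] by auto
  have rt: "a \<le> r t" "r t \<le> b" "G t (r t) = 0" using r[OF t] by auto
  have lip: "\<bar>r s - r t\<bar> \<le> C / c * \<bar>s - t\<bar>" if s: "\<bar>s\<bar> < \<tau>" for s
  proof -
    have "norm (G s (r t) - G t (r t)) \<le> C * norm (s - t)"
    proof (rule field_differentiable_bound[of "{-\<tau><..<\<tau>}" "\<lambda>s. G s (r t)" "\<lambda>s. Gt s (r t)"])
      show "((\<lambda>s. G s (r t)) has_field_derivative Gt s (r t)) (at s within {-\<tau><..<\<tau>})" if "s \<in> {-\<tau><..<\<tau>}" for s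
        using dt[of s "r t"] rt that by (auto intro: has_field_derivative_at_within)
      show "norm (Gt s (r t)) \<le> C" if "s \<in> {-\<tau><..<\<tau>}" for s
        using ub[of s "r t"] rt that by auto
    qed (use s t in auto)
    then have 1: "\<bar>G s (r t)\<bar> \<le> C * \<bar>s - t\<bar>" using rt by simp
    have "c * \<bar>r s - r t\<bar> \<le> \<bar>Gl s (\<xi> s)\<bar> * \<bar>r s - r t\<bar>"
      using lb[OF s \<xi>ab[OF s]] c by (intro mult_right_mono) auto
    also have "\<dots> = \<bar>G s (r t)\<bar>" using \<xi>(3)[OF s] by (simp flip: abs_mult)
    finally show ?thesis using 1 c by (simp add: field_simps)
  qed
  show ?thesis
    unfolding has_field_derivative_iff
  proof (rule tendsto_at_if_sequences_within[OF t])
    fix Z :: "nat \<Rightarrow> real" assume Z: "Z \<longlonglongrightarrow> t" "\<And>i. Z i \<noteq> t" "\<And>i. \<bar>Z i\<bar> < \<tau>"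
    have "(\<lambda>i. \<xi> (Z i)) \<longlonglongrightarrow> r t"
    proof (rule Lim_transform2[OF tendsto_const], rule tendsto_rabs_zero_cancel,
        rule tendsto_sandwich[OF _ _ tendsto_const])
      have "(\<lambda>i. C / c * \<bar>Z i - t\<bar>) \<longlonglongrightarrow> C / c * \<bar>t - t\<bar>" by (intro tendsto_intros Z)
      then show "(\<lambda>i. C / c * \<bar>Z i - t\<bar>) \<longlonglongrightarrow> 0" by simp
      show "\<forall>\<^sub>F i in sequentially. \<bar>r t - \<xi> (Z i)\<bar> \<le> C / c * \<bar>Z i - t\<bar>"
      proof (rule always_eventually, rule allI)
        fix i
        have "\<bar>r t - \<xi> (Z i)\<bar> \<le> \<bar>r (Z i) - r t\<bar>" using \<xi>[OF Z(3), of i] by auto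
        also have "\<dots> \<le> C / c * \<bar>Z i - t\<bar>" by (rule lip[OF Z(3)])
        finally show "\<bar>r t - \<xi> (Z i)\<bar> \<le> C / c * \<bar>Z i - t\<bar>" .
      qed
    qed simp
    then have lim: "(\<lambda>i. (Z i, \<xi> (Z i))) \<longlonglongrightarrow> (t, r t)" by (intro tendsto_Pair Z)
    have "-\<tau> < Z i \<and> Z i < \<tau>" for i using Z(3)[of i] by linarith
    then have "(Z i, \<xi> (Z i)) \<in> {-\<tau><..<\<tau>} \<times> {a..b}" for i using \<xi>ab[OF Z(3)] by auto
    moreover have "(t, r t) \<in> {-\<tau><..<\<tau>} \<times> {a..b}" using t rt by auto
    ultimately have Glim: "(\<lambda>i. Gl (Z i) (\<xi> (Z i))) \<longlonglongrightarrow> Gl t (r t)"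
      using cont lim unfolding continuous_on_sequentially by (fastforce simp: o_def)
    have "(\<lambda>i. (G (Z i) (r t) - G t (r t)) / (Z i - t)) \<longlonglongrightarrow> Gt t (r t)"
      using dt[OF t rt(1,2)] Z(1,2)
      unfolding has_field_derivative_iff tendsto_at_iff_sequentially by (auto simp: o_def)
    then have "(\<lambda>i. - ((G (Z i) (r t) - G t (r t)) / (Z i - t)) / Gl (Z i) (\<xi> (Z i))) \<longlonglongrightarrow> - Gt t (r t) / Gl t (r t)"
      using lb[OF t rt(1,2)] c by (intro tendsto_intros Glim) auto
    also have "(\<lambda>i. - ((G (Z i) (r t) - G t (r t)) / (Z i - t)) / Gl (Z i) (\<xi> (Z i)))
       = (\<lambda>i. (r (Z i) - r t) / (Z i - t))"
    proof
      fix i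
      have "Gl (Z i) (\<xi> (Z i)) \<noteq> 0" using lb[OF Z(3)[of i] \<xi>ab[OF Z(3)[of i]]] c by auto
      then have eq: "r (Z i) - r t = - G (Z i) (r t) / Gl (Z i) (\<xi> (Z i))"
        using \<xi>(3)[OF Z(3), of i] by (simp add: field_simps)
      show "- ((G (Z i) (r t) - G t (r t)) / (Z i - t)) / Gl (Z i) (\<xi> (Z i)) = (r (Z i) - r t) / (Z i - t)"
        by (simp add: eq rt mult.commute)
    qed
    finally show "(\<lambda>i. (r (Z i) - r t) / (Z i - t)) \<longlonglongrightarrow> - Gt t (r t) / Gl t (r t)" .
  qed
qed

section \<open>The critical dilation of the ball\<close>

lemma measure_cone_measure_UNIV:
  "measure (cone_measure :: 'a::euclidean_space measure) UNIV = vol (cball (0::'a) 1)"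
proof -
  have "{z\<in>cball (0::'a) 1. sgn z \<in> UNIV} = cball 0 1" by auto
  then show ?thesis
    using emeasure_cone_measure[of "UNIV :: 'a set"] by (simp add: measure_def)
qed

lemma measure_mono_cball:
  fixes A :: "'a::euclidean_space set"
  assumes "A \<subseteq> B" "B \<subseteq> cball c r" "A \<in> sets borel" "B \<in> sets borel"
  shows "vol A \<le> vol B"
proof (rule measure_mono_fmeasurable)
  show "B \<in> fmeasurable lborel"
  proof (rule fmeasurableI)
    show "emeasure lborel B < \<infinity>"
      using emeasure_mono[OF assms(2), of lborel] emeasure_lborel_cball_finite[of c r] by (auto intro: le_less_trans)
  qed (use assms in auto)
qed (use assms in auto)

lemma lens_subset_cball:
  fixes e :: "'a::euclidean_space"
  assumes e: "norm e = 1" and l: "1/4 \<le> l\<^sup>2"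
  shows "cball 0 l \<inter> cball e l \<subseteq> cball (e /\<^sub>R 2) (sqrt (l\<^sup>2 - 1/4))"
proof
  fix y assume "y \<in> cball 0 l \<inter> cball e l"
  then have y: "norm y \<le> l" "norm (y - e) \<le> l" by (auto simp: dist_norm norm_minus_commute)
  have "(norm (y - e /\<^sub>R 2))\<^sup>2 = ((norm y)\<^sup>2 + (norm (y - e))\<^sup>2) / 2 - (norm e)\<^sup>2 / 4"
    unfolding power2_norm_eq_inner by (simp add: inner_diff_left inner_diff_right inner_commute field_simps)
  also have "\<dots> \<le> (l\<^sup>2 + l\<^sup>2) / 2 - 1 / 4"
    using power_mono[OF y(1), of 2] power_mono[OF y(2), of 2] e by simp
  finally have "norm (y - e /\<^sub>R 2) \<le> sqrt (l\<^sup>2 - 1/4)"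
    by (intro real_le_rsqrt) simp
  then show "y \<in> cball (e /\<^sub>R 2) (sqrt (l\<^sup>2 - 1/4))" by (simp add: dist_norm norm_minus_commute)
qed

context radial_profile
begin

text \<open>Nonnegativity of the excess says that \<open>e\<close> lies in the convolution body of \<open>body l m\<close> at level \<open>d\<close>.\<close>

definition excess :: "real \<Rightarrow> real \<Rightarrow> real \<Rightarrow> 'a \<Rightarrow> real" where
  "excess d l m e = overlap l m e - d * vol (body l m)"

lemma body_0: "body l 0 = cball 0 l"
  by (auto simp: body_def)

lemma overlap_0: "overlap l 0 e = lens l e"
proof -
  have "{y. y - e \<in> cball 0 l} = cball e l" by (auto simp: dist_norm norm_minus_commute)
  then show ?thesis by (simp add: overlap_def lens_def body_0)
qed

lemma excess_0: "excess d l 0 e = lens l e - d * vol (cball (0::'a) l)"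
  by (simp add: excess_def overlap_0 body_0)

lemma cap_0:
  assumes "0 < l" "norm v = 1" "norm e = 1"
  shows "cap l 0 e v = indicator {v. 1 / (2 * l) \<le> e \<bullet> v} v"
proof -
  have "norm (l *\<^sub>R v - e) \<le> l \<longleftrightarrow> (norm (l *\<^sub>R v - e))\<^sup>2 \<le> l\<^sup>2"
    using assms by (auto intro: power_mono power2_le_imp_le)
  also have "(norm (l *\<^sub>R v - e))\<^sup>2 = l\<^sup>2 - 2 * l * (e \<bullet> v) + 1"
  proof -
    have "v \<bullet> v = 1" "e \<bullet> e = 1" using assms by (auto simp: dot_square_norm)
    then show ?thesis unfolding power2_norm_eq_inner
      by (simp add: inner_diff_left inner_diff_right inner_commute power2_eq_square)
  qed
  also have "\<dots> \<le> l\<^sup>2 \<longleftrightarrow> 1 / (2 * l) \<le> e \<bullet> v"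
    using assms by (simp add: field_simps)
  finally show ?thesis by (simp add: cap_def body_0 indicator_def)
qed

lemma integral_cap_0:
  fixes l :: real
  assumes "0 < l" "norm e = 1"
  shows "(\<integral>v. cap l 0 e v \<partial>cone_measure) = cap_measure (1 / (2 * l)) e"
proof -
  have "(\<integral>v. cap l 0 e v \<partial>cone_measure) = (\<integral>v. indicator {v. 1 / (2 * l) \<le> e \<bullet> v} v \<partial>cone_measure)"
    by (rule integral_cong_AE, measurable, use AE_cone_measure_norm in eventually_elim)
       (use assms cap_0 in auto)
  then show ?thesis by (simp add: cap_measure_def)
qed

lemma integrable_cap: "integrable cone_measure (cap l m e)"
  using cap_bounds by (intro cone_measure.integrable_const_bound[of _ 1]) auto

lemma excess_slope_ball:
  fixes l :: real
  assumes "0 < l" "norm e = 1"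
  shows "excess_slope d 1 0 l 0 e = DIM('a) * l ^ (DIM('a) - 1) *
    (2 * cap_measure (1 / (2 * l)) e - d * vol (cball (0::'a) 1))"
proof -
  have "excess_slope d 1 0 l 0 e = DIM('a) * l ^ (DIM('a) - 1) *
     (\<integral>v. cap l 0 e v + cap l 0 (- e) v - d \<partial>cone_measure)"
    unfolding excess_slope_def by simp
  also have "(\<integral>v. cap l 0 e v + cap l 0 (- e) v - d \<partial>cone_measure)
     = cap_measure (1 / (2 * l)) e + cap_measure (1 / (2 * l)) (- e) - d * vol (cball (0::'a) 1)"
    using assms integrable_cap by (simp add: integral_cap_0 measure_cone_measure_UNIV)
  finally show ?thesis using cap_measure_rotate[of e "- e"] by simp
qed

lemma excess_slope_ball_rotate:
  fixes l :: real
  assumes "0 < l" "norm v = 1" "norm e = 1"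
  shows "excess_slope d 1 0 l 0 v = excess_slope d 1 0 l 0 e"
  using assms cap_measure_rotate[of v e "1 / (2 * l)"] by (simp only: excess_slope_ball)

lemma param_bound: "\<bar>t\<bar> < \<tau> \<Longrightarrow> \<tau> * M \<le> c \<Longrightarrow> \<bar>t\<bar> * M \<le> c"
  using mult_right_mono[of "\<bar>t\<bar>" \<tau> M] M_nonneg by linarith

lemma excess_slope_ball_pos:
  assumes l: "1/2 < l" and e: "norm e = 1" and 0: "excess d l 0 e = 0"
  shows "0 < excess_slope d 1 0 l 0 e"
proof -
  have "d * (l ^ DIM('a) * vol (cball (0::'a) 1)) < 2 * (l ^ DIM('a) * cap_measure (1 / (2 * l)) e)"
    using lens_lt_cap[OF l e] 0 measure_cball_scaled[of l "0::'a"] l by (simp add: excess_0)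
  then have "0 < l ^ DIM('a) * (2 * cap_measure (1 / (2 * l)) e - d * vol (cball (0::'a) 1))"
    by (simp add: algebra_simps)
  then have "0 < 2 * cap_measure (1 / (2 * l)) e - d * vol (cball (0::'a) 1)"
    using l by (simp add: zero_less_mult_iff)
  then show ?thesis using excess_slope_ball[OF _ e, where l=l and d=d] l by simp
qed

lemma excess_has_derivative_l:
  assumes "1/2 < l" "\<bar>l * t\<bar> * M < 1/4"
    and "AE v in cone_measure. \<not> touch l (l * t) e v" "AE v in cone_measure. \<not> touch l (l * t) (- e) v"
  shows "((\<lambda>l. excess d l (l * t) e) has_real_derivative excess_slope d 1 t l (l * t) e) (at l)"
  using excess_has_derivative_line[OF assms, of 1 t d]
    DERIV_shift[of "\<lambda>l. excess d l (l * t) e" "excess_slope d 1 t l (l * t) e" 0 l]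
  by (simp add: excess_def algebra_simps)

lemma excess_has_derivative_t:
  assumes "1/2 < l" "\<bar>l * t\<bar> * M < 1/4"
    and "AE v in cone_measure. \<not> touch l (l * t) e v" "AE v in cone_measure. \<not> touch l (l * t) (- e) v"
  shows "((\<lambda>t. excess d l (l * t) e) has_real_derivative excess_slope d 0 l l (l * t) e) (at t)"
  using excess_has_derivative_line[OF assms, of 0 l d]
    DERIV_shift[of "\<lambda>t. excess d l (l * t) e" "excess_slope d 0 l l (l * t) e" 0 t]
  by (simp add: excess_def algebra_simps)

lemma touch_ball_null:
  assumes "1/2 < l" "norm e = 1"
  shows "AE v in cone_measure. \<not> touch l 0 e v"
proof -
  from exists_transversal_range[OF assms(1) order_refl] show ?thesis
    using assms by (metis abs_zero less_imp_le order_refl)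
qed

lemma excess_ball_has_derivative:
  assumes "1/2 < l" "norm e = 1"
  shows "((\<lambda>l. excess d l 0 e) has_real_derivative excess_slope d 1 0 l 0 e) (at l)"
  using excess_has_derivative_l[of l 0 e d] touch_ball_null[of l e] touch_ball_null[of l "- e"] assms by simp

text \<open>The excess is nonpositive at the endpoint \<open>a\<close>, because the lens lies in a ball of radius
  \<open>sqrt (a\<^sup>2 - 1/4) = d a\<close>, and nonnegative at the endpoint \<open>b\<close>, because the lens contains a ball of radius
  \<open>b - 1\<close> and Bernoulli's inequality applies.\<close>

lemma exists_level:
  assumes d: "0 < d" "d < 1"
  obtains l0 where "1/2 < l0" "\<And>e. norm e = 1 \<Longrightarrow> excess d l0 0 e = 0"
proof -
  let ?n = "DIM('a)" and ?w = "vol (cball (0::'a) 1)"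
  have w: "0 \<le> ?w" by simp
  obtain e0 :: 'a where e0: "norm e0 = 1" using nonempty_Basis norm_Basis by blast
  define s where "s = sqrt (1 - d\<^sup>2)"
  have dd: "d\<^sup>2 < 1" using d by (simp add: power_less_one_iff)
  have s: "0 < s" "s < 1" "s\<^sup>2 = 1 - d\<^sup>2" using dd d by (auto simp: s_def)
  define a where "a = 1 / (2 * s)"
  have a: "1/2 < a" using s by (simp add: a_def field_simps)
  have "a\<^sup>2 * s\<^sup>2 = 1/4" using s(1) by (simp add: a_def power_divide power_mult_distrib)
  then have "a\<^sup>2 - 1/4 = (a * d)\<^sup>2" unfolding s(3) by (simp add: power_mult_distrib algebra_simps)
  then have sq: "sqrt (a\<^sup>2 - 1/4) = a * d" using a d by simp
  have a4: "1/4 \<le> a\<^sup>2" using power_mono[of "1/2" a 2] a by (simp add: power_divide)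
  have "lens a e0 \<le> vol (cball (e0 /\<^sub>R 2) (a * d))"
    unfolding lens_def using lens_subset_cball[OF e0 a4] unfolding sq by (intro measure_mono_cball) auto
  also have "\<dots> = a ^ ?n * d ^ ?n * ?w" using a d by (subst measure_cball_scaled) (auto simp: power_mult_distrib)
  also have "\<dots> \<le> a ^ ?n * d * ?w"
    using a d power_decreasing[of 1 ?n d] by (intro mult_right_mono mult_left_mono) auto
  finally have low: "excess d a 0 e0 \<le> 0"
    using a by (simp add: excess_0 measure_cball_scaled[of a] mult_ac)
  define b where "b = max a (?n / (1 - d))"
  have "1 \<le> N / (1 - d)" if "1 \<le> N" for N using that d by (simp add: field_simps)
  moreover have "1 \<le> real ?n" using DIM_positive[where 'a='a] by linarith
  ultimately have "1 \<le> ?n / (1 - d)" by blast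
  then have b: "a \<le> b" "?n / (1 - d) \<le> b" "1 \<le> b" by (auto simp: b_def)
  have "d \<le> 1 - ?n / b"
  proof -
    have "?n \<le> b * (1 - d)" using b(2) d by (simp add: field_simps)
    then have "?n / b \<le> 1 - d" using b(3) by (simp add: field_simps)
    then show ?thesis by simp
  qed
  also have "\<dots> = 1 + ?n * (- 1 / b)" by simp
  also have "\<dots> \<le> (1 + (- 1 / b)) ^ ?n" using b(3) by (intro Bernoulli_inequality) (simp add: field_simps)
  finally have "d * b ^ ?n \<le> (1 + (- 1 / b)) ^ ?n * b ^ ?n" using b by (intro mult_right_mono) auto
  also have "\<dots> = (b - 1) ^ ?n" using b(3) by (simp add: field_simps flip: power_mult_distrib)
  finally have db: "d * b ^ ?n \<le> (b - 1) ^ ?n" .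
  have high: "0 \<le> excess d b 0 e0"
  proof (cases "b = 1")
    case True
    then show ?thesis using db d by (simp add: power_0_left)
  next
    case False
    have "d * b ^ ?n * ?w \<le> (b - 1) ^ ?n * ?w" by (rule mult_right_mono[OF db w])
    also have "(b - 1) ^ ?n * ?w = vol (cball (0::'a) (b - 1))"
      using False b by (subst measure_cball_scaled) auto
    also have "\<dots> \<le> lens b e0"
      unfolding lens_def
    proof (rule measure_mono_cball)
      show "cball 0 (b - 1) \<subseteq> cball 0 b \<inter> cball e0 b"
        using e0 norm_triangle_ineq4[of e0] by (auto simp: dist_norm) (smt (verit))
    qed auto
    finally show ?thesis
      using b by (simp add: excess_0 measure_cball_scaled[of b] mult_ac)
  qed
  have "\<exists>l\<ge>a. l \<le> b \<and> excess d l 0 e0 = 0"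
  proof (rule IVT'[OF low high b(1)])
    show "continuous_on {a..b} (\<lambda>l. excess d l 0 e0)"
      using a by (intro continuous_at_imp_continuous_on ballI DERIV_isCont[OF excess_ball_has_derivative[OF _ e0]]) auto
  qed
  then obtain l0 where "a \<le> l0" "excess d l0 0 e0 = 0" by blast
  then have l0: "a \<le> l0" "lens l0 e0 = d * vol (cball (0::'a) l0)" by (simp_all add: excess_0)
  show ?thesis
  proof (rule that)
    show "1/2 < l0" using a l0 by simp
    fix e :: 'a assume "norm e = 1"
    then have "lens l0 e = lens l0 e0" using e0 by (intro lens_rotate) simp
    then show "excess d l0 0 e = 0" using l0 by (simp add: excess_0)
  qed
qed

lemma body_scaled:
  assumes l: "1/2 \<le> l" "\<bar>l * t\<bar> * M \<le> 1/4" "\<bar>t\<bar> * M \<le> 1/4"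
  shows "l *\<^sub>R y \<in> body l (l * t) \<longleftrightarrow> y \<in> body 1 t"
proof (cases "y = 0")
  case True
  then show ?thesis using radius_bounds[OF l(1,2), of 0] radius_bounds[of 1 t 0] l by (simp add: body_def)
next
  case False
  define v where "v = sgn y"
  have v: "norm v = 1" "y = norm y *\<^sub>R v" using False by (auto simp: v_def norm_sgn sgn_div_norm)
  have "l *\<^sub>R y = (l * norm y) *\<^sub>R v" using v by (metis scaleR_scaleR)
  then have "l *\<^sub>R y \<in> body l (l * t) \<longleftrightarrow> l * norm y \<le> l + l * t * p v"
    using mem_body_ray[OF l(1,2) v(1), of "l * norm y"] False l by simp
  also have "\<dots> \<longleftrightarrow> norm y \<le> 1 + t * p v"
  proof -
    have "l + l * t * p v = l * (1 + t * p v)" by (simp add: algebra_simps)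
    then show ?thesis using l by simp
  qed
  also have "\<dots> \<longleftrightarrow> y \<in> body 1 t"
    using mem_body_ray[of 1 t v "norm y"] v False l by simp
  finally show ?thesis .
qed

text \<open>The dilation \<open>l\<close> of the body at unit translation corresponds to the translation \<open>v / l\<close> of the
  undilated body.\<close>

lemma excess_scaled:
  assumes l: "1/2 \<le> l" "\<bar>l * t\<bar> * M \<le> 1/4" "\<bar>t\<bar> * M \<le> 1/4"
  shows "excess d l (l * t) v = l ^ DIM('a) * (overlap 1 t (v /\<^sub>R l) - d * vol (body 1 t))"
proof -
  have l0: "0 < l" using l by simp
  have 1: "{y. l *\<^sub>R y \<in> body l (l * t)} = body 1 t" by (simp add: body_scaled[OF l])
  have 2: "{y. l *\<^sub>R y \<in> body l (l * t) \<inter> {y. y - v \<in> body l (l * t)}} = body 1 t \<inter> {y. y - v /\<^sub>R l \<in> body 1 t}"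
  proof -
    have "l *\<^sub>R y - v = l *\<^sub>R (y - v /\<^sub>R l)" for y using l0 by (simp add: algebra_simps)
    then show ?thesis using body_scaled[OF l] by auto
  qed
  show ?thesis
    using measure_lborel_scaled[OF l0, of "body l (l * t)"]
      measure_lborel_scaled[OF l0, of "body l (l * t) \<inter> {y. y - v \<in> body l (l * t)}"]
    unfolding 1 2 by (simp add: excess_def overlap_def algebra_simps)
qed

lemma overlap_bounds:
  assumes "\<bar>t\<bar> * M \<le> k"
  shows "lens (1 - k) x \<le> overlap 1 t x" "overlap 1 t x \<le> lens (1 + k) x"
proof -
  have 1: "cball 0 (1 - k) \<subseteq> body 1 t" "body 1 t \<subseteq> cball 0 (1 + k)"
    using cball_subset_body[OF assms, of 1] body_subset_cball[OF assms, of 1] by auto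
  have 2: "y \<in> cball x r \<longleftrightarrow> y - x \<in> cball 0 r" for y r by (simp add: dist_norm norm_minus_commute)
  show "lens (1 - k) x \<le> overlap 1 t x"
    unfolding lens_def overlap_def using 1
    by (intro measure_mono_cball[of _ _ 0 "1 + k"]) (auto simp: 2 simp del: mem_cball)
  show "overlap 1 t x \<le> lens (1 + k) x"
    unfolding lens_def overlap_def using 1
    by (intro measure_mono_cball[of _ _ 0 "1 + k"]) (auto simp: 2 simp del: mem_cball)
qed

lemma volume_bounds:
  assumes "\<bar>t\<bar> * M \<le> k" "k < 1"
  shows "(1 - k) ^ DIM('a) * vol (cball (0::'a) 1) \<le> vol (body 1 t)"
    "vol (body 1 t) \<le> (1 + k) ^ DIM('a) * vol (cball (0::'a) 1)"
proof -
  have "0 \<le> \<bar>t\<bar> * M" using M_nonneg by simp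
  then have k: "0 \<le> k" using assms by linarith
  have 1: "cball 0 (1 - k) \<subseteq> body 1 t" "body 1 t \<subseteq> cball 0 (1 + k)"
    using cball_subset_body[OF assms(1), of 1] body_subset_cball[OF assms(1), of 1] by auto
  show "(1 - k) ^ DIM('a) * vol (cball (0::'a) 1) \<le> vol (body 1 t)"
    using 1 assms by (subst measure_cball_scaled[symmetric]) (auto intro!: measure_mono_cball[of _ _ 0 "1 + k"])
  show "vol (body 1 t) \<le> (1 + k) ^ DIM('a) * vol (cball (0::'a) 1)"
    using 1 k by (subst measure_cball_scaled[symmetric]) (auto intro!: measure_mono_cball[of _ _ 0 "1 + k"])
qed

lemma overlap_measurable: "(\<lambda>x. overlap l m x) \<in> borel_measurable borel"
proof -
  have "overlap l m x = enn2real (\<integral>\<^sup>+y. indicator (body l m) y * indicator (body l m) (y - x) \<partial>lborel)" for x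
  proof -
    have "emeasure lborel (body l m \<inter> {y. y - x \<in> body l m}) = (\<integral>\<^sup>+y. indicator (body l m \<inter> {y. y - x \<in> body l m}) y \<partial>lborel)"
      by simp
    also have "\<dots> = (\<integral>\<^sup>+y. indicator (body l m) y * indicator (body l m) (y - x) \<partial>lborel)"
      by (intro nn_integral_cong) (auto split: split_indicator)
    finally show ?thesis by (simp add: overlap_def measure_def)
  qed
  then show ?thesis by simp
qed

section \<open>The radial function of the convolution body\<close>


text \<open>The convolution body at level \<open>d\<close> of the body with radial function \<open>1 + t p\<close>.\<close>

definition level_set :: "real \<Rightarrow> real \<Rightarrow> 'a set" where
  "level_set d t = {x. d * vol (body 1 t) \<le> overlap 1 t x}"

lemma continuous_on_excess_slope:
  assumes m1: "\<And>l m e. a \<le> l \<Longrightarrow> l \<le> b \<Longrightarrow> \<bar>m\<bar> \<le> m1 \<Longrightarrow> norm e = 1 \<Longrightarrow> AE v in cone_measure. \<not> touch l m e v"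
    and \<tau>: "0 < a" "b * \<tau> \<le> m1" and X: "X \<subseteq> {-\<tau>..\<tau>} \<times> {a..b} \<times> sphere 0 1"
    and AB: "continuous_on X A" "continuous_on X B"
  shows "continuous_on X (\<lambda>z. excess_slope d (A z) (B z) (fst (snd z)) (fst (snd z) * fst z) (snd (snd z)))"
  unfolding continuous_on_sequentially
proof (intro allI ballI impI)
  fix x z assume z: "z \<in> X" and x: "(\<forall>n. x n \<in> X) \<and> x \<longlonglongrightarrow> z"
  have lim: "(\<lambda>n. A (x n)) \<longlonglongrightarrow> A z" "(\<lambda>n. B (x n)) \<longlonglongrightarrow> B z"
    using AB x z unfolding continuous_on_sequentially by (auto simp: o_def)
  have zz: "\<bar>fst z\<bar> \<le> \<tau>" "a \<le> fst (snd z)" "fst (snd z) \<le> b" "norm (snd (snd z)) = 1"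
    using z X by (auto simp: abs_le_iff)
  have "\<bar>fst (snd z) * fst z\<bar> \<le> b * \<tau>"
    unfolding abs_mult using zz \<tau> by (intro mult_mono) auto
  then have "\<bar>fst (snd z) * fst z\<bar> \<le> m1" using \<tau> by linarith
  note nt = m1[OF zz(2,3) this]
  show "((\<lambda>z. excess_slope d (A z) (B z) (fst (snd z)) (fst (snd z) * fst z) (snd (snd z))) \<circ> x) \<longlonglongrightarrow>
      excess_slope d (A z) (B z) (fst (snd z)) (fst (snd z) * fst z) (snd (snd z))"
    unfolding o_def
    by (rule tendsto_excess_slope[OF lim]) (use x zz nt in \<open>auto intro!: tendsto_intros\<close>)
qed

lemma isCont_lens:
  fixes e :: 'a
  assumes "1/2 < l" "norm e = 1"
  shows "isCont (\<lambda>l. lens l e) l"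
  using DERIV_isCont[OF excess_ball_has_derivative[OF assms, of 0]] by (simp add: excess_0)

lemma excess_ball_increasing:
  assumes "1/2 < l" "l < l'" "norm e = 1"
    and pos: "\<And>x. l \<le> x \<Longrightarrow> x \<le> l' \<Longrightarrow> 0 < excess_slope d 1 0 x 0 e"
  shows "excess d l 0 e < excess d l' 0 e"
proof (rule DERIV_pos_imp_increasing[OF assms(2)])
  fix x assume "l \<le> x" "x \<le> l'"
  then show "\<exists>y. ((\<lambda>l. excess d l 0 e) has_real_derivative y) (at x) \<and> 0 < y"
    using pos excess_ball_has_derivative[of x e d] assms by (intro exI[of _ "excess_slope d 1 0 x 0 e"]) auto
qed

text \<open>A tolerance \<open>k\<close> for comparing the perturbed body with balls of radius \<open>1 - k\<close> and \<open>1 + k\<close>; the strict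
  inequalities at \<open>a\<close> and \<open>b\<close> survive it.\<close>

lemma exists_tolerance:
  assumes l: "1/2 < a" "a < b" and e: "norm e = 1"
    and neg: "excess d a 0 e < 0" and pos: "0 < excess d b 0 e"
  obtains k where "0 < k" "k < 1"
    "d * ((b * (1 + k)) ^ DIM('a) * vol (cball (0::'a) 1)) < lens (b * (1 - k)) e"
    "lens (a * (1 + k)) e < d * ((a * (1 - k)) ^ DIM('a) * vol (cball (0::'a) 1))"
proof -
  let ?w = "vol (cball (0::'a) 1)"
  have 1: "((\<lambda>k. lens (b * (1 - k)) e - d * ((b * (1 + k)) ^ DIM('a) * ?w)) \<longlongrightarrow>
      lens (b * (1 - 0)) e - d * ((b * (1 + 0)) ^ DIM('a) * ?w)) (at_right 0)"
    using l e by (intro tendsto_intros isCont_tendsto_compose[OF isCont_lens]) auto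
  have 2: "((\<lambda>k. lens (a * (1 + k)) e - d * ((a * (1 - k)) ^ DIM('a) * ?w)) \<longlongrightarrow>
      lens (a * (1 + 0)) e - d * ((a * (1 - 0)) ^ DIM('a) * ?w)) (at_right 0)"
    using l e by (intro tendsto_intros isCont_tendsto_compose[OF isCont_lens]) auto
  have "\<forall>\<^sub>F k in at_right 0. 0 < lens (b * (1 - k)) e - d * ((b * (1 + k)) ^ DIM('a) * ?w)"
    using order_tendstoD(1)[OF 1, of 0] pos l by (simp add: excess_0 measure_cball_scaled[of b])
  moreover have "\<forall>\<^sub>F k in at_right 0. lens (a * (1 + k)) e - d * ((a * (1 - k)) ^ DIM('a) * ?w) < 0"
    using order_tendstoD(2)[OF 2, of 0] neg l by (simp add: excess_0 measure_cball_scaled[of a])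
  moreover have "\<forall>\<^sub>F k in at_right 0. 0 < k \<and> k < (1::real)"
    unfolding eventually_at_right_field by (intro exI[of _ 1]) auto
  ultimately have "\<forall>\<^sub>F k in at_right 0. 0 < lens (b * (1 - k)) e - d * ((b * (1 + k)) ^ DIM('a) * ?w) \<and>
     lens (a * (1 + k)) e - d * ((a * (1 - k)) ^ DIM('a) * ?w) < 0 \<and> 0 < k \<and> k < (1::real)"
    by eventually_elim simp
  from eventually_happens[OF this] obtain k where "0 < lens (b * (1 - k)) e - d * ((b * (1 + k)) ^ DIM('a) * ?w)"
     "lens (a * (1 + k)) e - d * ((a * (1 - k)) ^ DIM('a) * ?w) < 0" "0 < k" "k < (1::real)"
    by (auto simp: trivial_limit_at_right_real)
  then show ?thesis using that[of k] by simp
qed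

lemma level_set_near:
  assumes b: "0 < b" and d: "0 < d" and k: "\<bar>t\<bar> * M \<le> k" "k < 1"
    and lens: "d * ((b * (1 + k)) ^ DIM('a) * vol (cball (0::'a) 1)) < lens (b * (1 - k)) v"
    and s: "0 \<le> s" "s \<le> 1 / b"
  shows "d * vol (body 1 t) < overlap 1 t (s *\<^sub>R v)"
proof -
  let ?w = "vol (cball (0::'a) 1)"
  have "b ^ DIM('a) * (d * vol (body 1 t)) \<le> b ^ DIM('a) * (d * ((1 + k) ^ DIM('a) * ?w))"
    using b d volume_bounds[OF k] by (intro mult_left_mono) auto
  also have "\<dots> = d * ((b * (1 + k)) ^ DIM('a) * ?w)" by (simp add: power_mult_distrib)
  also have "\<dots> < b ^ DIM('a) * lens (1 - k) (v /\<^sub>R b)" using lens lens_scaled[OF b] by metis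
  also have "\<dots> \<le> b ^ DIM('a) * lens (1 - k) (s *\<^sub>R v)"
    using lens_antimono[OF s, of "1 - k" v] b by (intro mult_left_mono) (auto simp: divide_inverse)
  also have "\<dots> \<le> b ^ DIM('a) * overlap 1 t (s *\<^sub>R v)"
    using overlap_bounds[OF k(1)] b by (intro mult_left_mono) auto
  finally show ?thesis using b by simp
qed

lemma level_set_far:
  assumes a: "0 < a" and d: "0 < d" and k: "\<bar>t\<bar> * M \<le> k" "k < 1"
    and lens: "lens (a * (1 + k)) v < d * ((a * (1 - k)) ^ DIM('a) * vol (cball (0::'a) 1))"
    and s: "1 / a \<le> s"
  shows "overlap 1 t (s *\<^sub>R v) < d * vol (body 1 t)"
proof -
  let ?w = "vol (cball (0::'a) 1)"
  have "a ^ DIM('a) * overlap 1 t (s *\<^sub>R v) \<le> a ^ DIM('a) * lens (1 + k) (s *\<^sub>R v)"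
    using overlap_bounds[OF k(1)] a by (intro mult_left_mono) auto
  also have "\<dots> \<le> a ^ DIM('a) * lens (1 + k) (v /\<^sub>R a)"
    using lens_antimono[OF _ s, of "1 + k" v] a by (intro mult_left_mono) (auto simp: divide_inverse)
  also have "\<dots> < d * ((a * (1 - k)) ^ DIM('a) * ?w)" using lens lens_scaled[OF a] by metis
  also have "\<dots> = a ^ DIM('a) * (d * ((1 - k) ^ DIM('a) * ?w))" by (simp add: power_mult_distrib)
  also have "\<dots> \<le> a ^ DIM('a) * (d * vol (body 1 t))"
    using a d volume_bounds[OF k] by (intro mult_left_mono) auto
  finally show ?thesis using a by simp
qed

text \<open>In every direction the level set is a segment of length \<open>1 / r t v\<close>. Near the critical
  dilation \<open>l0\<close> the excess is strictly increasing in the dilation, which yields the root \<open>r t v\<close>; for all other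
  distances the comparison with balls decides membership.\<close>

lemma level_set_radius:
  assumes d: "0 < d" "d < 1"
  obtains \<tau> r r' l0 C where "0 < \<tau>" "\<tau> * M \<le> 1/4" "1/2 < l0"
    "\<And>t v. \<bar>t\<bar> < \<tau> \<Longrightarrow> norm v = 1 \<Longrightarrow> 1/2 < r t v"
    "\<And>t v s. \<bar>t\<bar> < \<tau> \<Longrightarrow> norm v = 1 \<Longrightarrow> 0 < s \<Longrightarrow> s *\<^sub>R v \<in> level_set d t \<longleftrightarrow> s \<le> 1 / r t v"
    "\<And>t v. \<bar>t\<bar> < \<tau> \<Longrightarrow> norm v = 1 \<Longrightarrow> ((\<lambda>t. r t v) has_real_derivative r' t v) (at t)"
    "\<And>t v. \<bar>t\<bar> < \<tau> \<Longrightarrow> norm v = 1 \<Longrightarrow> \<bar>r' t v\<bar> \<le> C"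
    "\<And>v. norm v = 1 \<Longrightarrow> continuous_on {-\<tau><..<\<tau>} (\<lambda>t. r' t v)"
    "\<And>v. norm v = 1 \<Longrightarrow> r 0 v = l0"
    "\<And>v. norm v = 1 \<Longrightarrow> r' 0 v = - excess_slope d 0 l0 l0 0 v / excess_slope d 1 0 l0 0 v"
    "\<And>v. norm v = 1 \<Longrightarrow> excess d l0 0 v = 0"
proof -
  obtain l0 where l0: "1/2 < l0" "\<And>e. norm e = 1 \<Longrightarrow> excess d l0 0 e = 0"
    using exists_level[OF d] by blast
  obtain e0 :: 'a where e0: "norm e0 = 1" using nonempty_Basis norm_Basis by blast
  define a where "a = (l0 + 1/2) / 2"
  define b where "b = l0 + 1"
  have ab: "1/2 < a" "a < l0" "l0 < b" using l0 by (auto simp: a_def b_def)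
  obtain m1 where m1: "0 < m1" "m1 * M < 1/4"
    "\<And>l m e. a \<le> l \<Longrightarrow> l \<le> b \<Longrightarrow> \<bar>m\<bar> \<le> m1 \<Longrightarrow> norm e = 1 \<Longrightarrow> AE v in cone_measure. \<not> touch l m e v"
    by (rule exists_transversal_range[of a b]) (use ab in auto)
  define \<tau>0 where "\<tau>0 = m1 / b"
  have \<tau>0: "0 < \<tau>0" "b * \<tau>0 \<le> m1" using m1 ab by (auto simp: \<tau>0_def)
  define X where "X = {-\<tau>0..\<tau>0} \<times> {a..b} \<times> (sphere 0 1 :: 'a set)"
  have X: "(t, l, v) \<in> X \<longleftrightarrow> \<bar>t\<bar> \<le> \<tau>0 \<and> a \<le> l \<and> l \<le> b \<and> norm v = 1" for t l v
    by (auto simp: X_def)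
  have "compact X" unfolding X_def by (intro compact_Times compact_Icc compact_sphere)
  define Gl where "Gl z = excess_slope d 1 (fst z) (fst (snd z)) (fst (snd z) * fst z) (snd (snd z))" for z
  define Gt where "Gt z = excess_slope d 0 (fst (snd z)) (fst (snd z)) (fst (snd z) * fst z) (snd (snd z))" for z
  have a0: "0 < a" and XX: "X \<subseteq> {-\<tau>0..\<tau>0} \<times> {a..b} \<times> sphere 0 1" using ab by (auto simp: X_def)
  have contl: "continuous_on X Gl"
    unfolding Gl_def[abs_def]
    by (rule continuous_on_excess_slope[OF m1(3) a0 \<tau>0(2) XX, where A="\<lambda>_. 1" and B=fst]) (auto intro!: continuous_intros)
  have contt: "continuous_on X Gt"
    unfolding Gt_def[abs_def]
    by (rule continuous_on_excess_slope[OF m1(3) a0 \<tau>0(2) XX, where A="\<lambda>_. 0" and B="\<lambda>z. fst (snd z)"]) (auto intro!: continuous_intros)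
  obtain C where C: "\<And>z. z \<in> X \<Longrightarrow> \<bar>Gt z\<bar> \<le> C"
    using compact_imp_bounded[OF compact_continuous_image[OF contt \<open>compact X\<close>]]
    unfolding bounded_iff by auto
  define q where "q = Gl (0, l0, e0)"
  have q: "0 < q" using excess_slope_ball_pos[OF l0(1) e0 l0(2)[OF e0]] by (simp add: q_def Gl_def)
  have Gl0: "Gl (0, l0, v) = q" if "norm v = 1" for v
    using excess_slope_ball_rotate[of l0 v e0 d] that e0 l0(1) by (simp add: q_def Gl_def)
  \<comment> \<open>Uniform continuity on the compact set \<open>X\<close> makes the lower bound \<open>q / 2\<close> independent of the direction.\<close>
  have "uniformly_continuous_on X Gl" by (rule compact_uniformly_continuous[OF contl \<open>compact X\<close>])
  then obtain \<eta> where \<eta>: "0 < \<eta>" "\<And>z z'. z \<in> X \<Longrightarrow> z' \<in> X \<Longrightarrow> dist z' z < \<eta> \<Longrightarrow> dist (Gl z') (Gl z) < q / 2"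
    unfolding uniformly_continuous_on_def using q half_gt_zero by metis
  define h where "h = min (\<eta> / 2) (min (l0 - a) 1)"
  have h: "0 < h" "h \<le> \<eta> / 2" "h \<le> l0 - a" "h \<le> b - l0" using \<eta>(1) ab unfolding h_def b_def min_def by (auto split: if_splits)
  define L1 L2 where "L1 = l0 - h" and "L2 = l0 + h"
  have L: "a \<le> L1" "L1 < l0" "l0 < L2" "L2 \<le> b" "1/2 < L1" using h ab by (auto simp: L1_def L2_def)
  have Glow: "q / 2 \<le> Gl (t, l, v)" if "\<bar>t\<bar> < \<eta> / 2" "\<bar>t\<bar> \<le> \<tau>0" "L1 \<le> l" "l \<le> L2" "norm v = 1" for t l v
  proof -
    have "dist (t, l, v) (0, l0, v) \<le> \<bar>t\<bar> + \<bar>l - l0\<bar>"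
      using sqrt_sum_squares_le_sum_abs[of t "l - l0"] by (simp add: dist_Pair_Pair dist_real_def)
    also have "\<dots> < \<eta>" using that h by (auto simp: L1_def L2_def)
    finally have "dist (Gl (t, l, v)) (Gl (0, l0, v)) < q / 2"
      using that L \<tau>0 by (intro \<eta>(2)) (auto simp: X)
    then show ?thesis unfolding Gl0[OF that(5)] dist_real_def by linarith
  qed
  have slope0: "0 < excess_slope d 1 0 x 0 e0" if "L1 \<le> x" "x \<le> L2" for x
    using Glow[of 0 x e0] that \<eta> \<tau>0 q e0 by (simp add: Gl_def)
  have "excess d L1 0 e0 < excess d l0 0 e0" "excess d l0 0 e0 < excess d L2 0 e0"
    using L e0 slope0 by (auto intro!: excess_ball_increasing)
  then have "excess d L1 0 e0 < 0" "0 < excess d L2 0 e0" using l0 e0 by auto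
  from exists_tolerance[OF _ _ e0 this] L obtain k where k: "0 < k" "k < 1"
    "d * ((L2 * (1 + k)) ^ DIM('a) * vol (cball (0::'a) 1)) < lens (L2 * (1 - k)) e0"
    "lens (L1 * (1 + k)) e0 < d * ((L1 * (1 - k)) ^ DIM('a) * vol (cball (0::'a) 1))"
    by auto
  define \<tau> where "\<tau> = min (min \<tau>0 (\<eta> / 2)) (min k (1/4) / (M + 1))"
  have M1: "0 < M + 1" using M_nonneg by simp
  have "0 < min k (1/4) / (M + 1)" using k(1) M1 by (intro divide_pos_pos) auto
  then have "0 < \<tau>" using \<tau>0(1) \<eta>(1) by (simp add: \<tau>_def)
  moreover have "\<tau> \<le> \<tau>0" "\<tau> \<le> \<eta> / 2" "\<tau> \<le> min k (1/4) / (M + 1)" unfolding \<tau>_def by linarith+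
  ultimately have \<tau>: "0 < \<tau>" "\<tau> \<le> \<tau>0" "\<tau> \<le> \<eta> / 2" "\<tau> \<le> min k (1/4) / (M + 1)" by auto
  then have "\<tau> * (M + 1) \<le> min k (1/4)"
    using M1 by (simp only: pos_le_divide_eq)
  then have tauM: "\<tau> * M \<le> min k (1/4)" using \<tau> by (simp add: algebra_simps)
  have tM: "\<bar>t\<bar> * M \<le> k" "\<bar>t\<bar> * M \<le> 1/4" if "\<bar>t\<bar> < \<tau>" for t
    using param_bound[OF that, of k] param_bound[OF that, of "1/4"] tauM by simp_all
  have ltM: "\<bar>l * t\<bar> \<le> m1" "\<bar>l * t\<bar> * M < 1/4" if "\<bar>t\<bar> < \<tau>" "L1 \<le> l" "l \<le> L2" for t l
  proof -
    have "\<bar>l * t\<bar> \<le> b * \<tau>0" unfolding abs_mult using that \<tau> L ab by (intro mult_mono) auto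
    then show *: "\<bar>l * t\<bar> \<le> m1" using \<tau>0 by linarith
    show "\<bar>l * t\<bar> * M < 1/4" using mult_right_mono[OF * M_nonneg] m1 by linarith
  qed
  define E where "E v t l = excess d l (l * t) v" for v t l
  have Escaled: "E v t l = l ^ DIM('a) * (overlap 1 t (v /\<^sub>R l) - d * vol (body 1 t))"
    if "\<bar>t\<bar> < \<tau>" "L1 \<le> l" "l \<le> L2" for v t l
    unfolding E_def using that L ltM[OF that] tM[OF that(1)] by (intro excess_scaled) auto
  have dl: "(E v t has_real_derivative Gl (t, l, v)) (at l)"
    and dt: "((\<lambda>t. E v t l) has_real_derivative Gt (t, l, v)) (at t)"
    if "norm v = 1" "\<bar>t\<bar> < \<tau>" "L1 \<le> l" "l \<le> L2" for v t l
    unfolding E_def[abs_def] Gl_def Gt_def fst_conv snd_conv using that L ltM[OF that(2-4)]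
    by (intro excess_has_derivative_l excess_has_derivative_t m1(3); simp)+
  have lens_e0: "lens x v = lens x e0" if "norm v = 1" for x and v :: 'a
    by (rule lens_rotate) (simp add: that e0)
  have near: "d * vol (body 1 t) < overlap 1 t (s *\<^sub>R v)"
    if "norm v = 1" "\<bar>t\<bar> < \<tau>" "0 < s" "s \<le> 1 / L2" for v t s
  proof (rule level_set_near[OF _ d(1) tM(1)[OF that(2)] k(2)])
    show "d * ((L2 * (1 + k)) ^ DIM('a) * vol (cball (0::'a) 1)) < lens (L2 * (1 - k)) v"
      unfolding lens_e0[OF that(1)] by (rule k(3))
  qed (use that L in auto)
  have far: "overlap 1 t (s *\<^sub>R v) < d * vol (body 1 t)"
    if "norm v = 1" "\<bar>t\<bar> < \<tau>" "1 / L1 \<le> s" for v t s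
  proof (rule level_set_far[OF _ d(1) tM(1)[OF that(2)] k(2)])
    show "lens (L1 * (1 + k)) v < d * ((L1 * (1 - k)) ^ DIM('a) * vol (cball (0::'a) 1))"
      unfolding lens_e0[OF that(1)] by (rule k(4))
  qed (use that L in auto)
  have mono: "E v t l < E v t l'" if "norm v = 1" "\<bar>t\<bar> < \<tau>" "L1 \<le> l" "l < l'" "l' \<le> L2" for v t l l'
  proof (rule DERIV_pos_imp_increasing[OF that(4)])
    fix x assume x: "l \<le> x" "x \<le> l'"
    then have "q / 2 \<le> Gl (t, x, v)" using that \<tau> by (intro Glow) auto
    then have "0 < Gl (t, x, v)" using q by linarith
    then show "\<exists>y. (E v t has_real_derivative y) (at x) \<and> 0 < y"
      using dl[OF that(1,2), of x] that(3,5) x by (intro exI[of _ "Gl (t, x, v)"]) auto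
  qed
  have E_neg: "E v t L1 < 0" if v: "norm v = 1" and t: "\<bar>t\<bar> < \<tau>" for v t
  proof -
    have "overlap 1 t (v /\<^sub>R L1) - d * vol (body 1 t) < 0"
      using far[OF v t order_refl] by (simp add: inverse_eq_divide)
    then show ?thesis
      using L by (subst Escaled[OF t]) (auto intro: mult_pos_neg)
  qed
  have E_pos: "0 < E v t L2" if v: "norm v = 1" and t: "\<bar>t\<bar> < \<tau>" for v t
  proof -
    have "0 < overlap 1 t (v /\<^sub>R L2) - d * vol (body 1 t)"
      using near[OF v t _ order_refl] L by (simp add: inverse_eq_divide)
    then show ?thesis
      using L by (subst Escaled[OF t]) auto
  qed
  have root: "\<exists>l. L1 \<le> l \<and> l \<le> L2 \<and> E v t l = 0" if v: "norm v = 1" and t: "\<bar>t\<bar> < \<tau>" for v t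
  proof -
    have "continuous_on {L1..L2} (E v t)"
      by (intro continuous_at_imp_continuous_on ballI DERIV_isCont[OF dl[OF v t]]) auto
    then show ?thesis
      using IVT'[of "E v t" L1 0 L2] L less_imp_le[OF E_neg[OF v t]] less_imp_le[OF E_pos[OF v t]] by auto
  qed
  define r where "r t v = (SOME l. L1 \<le> l \<and> l \<le> L2 \<and> E v t l = 0)" for t v
  have r: "L1 \<le> r t v \<and> r t v \<le> L2 \<and> E v t (r t v) = 0" if "norm v = 1" "\<bar>t\<bar> < \<tau>" for v t
    unfolding r_def by (rule someI_ex[OF root[OF that]])
  define r' where "r' t v = - Gt (t, r t v, v) / Gl (t, r t v, v)" for t v
  have C0: "\<bar>Gt (t, l, v)\<bar> \<le> C" if "norm v = 1" "\<bar>t\<bar> < \<tau>" "L1 \<le> l" "l \<le> L2" for v t l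
    using C[of "(t, l, v)"] that \<tau> L by (auto simp: X)
  have Gl0': "q / 2 \<le> Gl (t, l, v)" if "norm v = 1" "\<bar>t\<bar> < \<tau>" "L1 \<le> l" "l \<le> L2" for v t l
    using that \<tau> by (intro Glow) auto
  have sub: "(\<lambda>(t, l). (t, l, v)) ` ({-\<tau><..<\<tau>} \<times> {L1..L2}) \<subseteq> X" if "norm v = 1" for v
    using \<tau> L that by (auto simp: X)
  have pc: "continuous_on ({-\<tau><..<\<tau>} \<times> {L1..L2}) (\<lambda>(t, l). (t, l, v))" for v
    unfolding case_prod_beta by (intro continuous_intros)
  have contl': "continuous_on ({-\<tau><..<\<tau>} \<times> {L1..L2}) (\<lambda>(t, l). Gl (t, l, v))"
    and contt': "continuous_on ({-\<tau><..<\<tau>} \<times> {L1..L2}) (\<lambda>(t, l). Gt (t, l, v))" if "norm v = 1" for v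
    using continuous_on_compose2[OF contl pc sub[OF that]] continuous_on_compose2[OF contt pc sub[OF that]]
    by (simp_all add: case_prod_beta)
  have dr: "((\<lambda>t. r t v) has_real_derivative r' t v) (at t)" if v: "norm v = 1" and t: "\<bar>t\<bar> < \<tau>" for v t
    unfolding r'_def
    by (rule has_derivative_implicit_root[where G="E v" and Gl="\<lambda>t l. Gl (t, l, v)" and Gt="\<lambda>t l. Gt (t, l, v)" and a=L1 and b=L2 and c="q / 2" and C=C and \<tau>=\<tau>])
       (use t q in simp, use q in simp, erule (2) dl[OF v], erule (2) dt[OF v], rule contl'[OF v],
        erule (2) Gl0'[OF v], erule (2) C0[OF v], erule r[OF v])
  have r0: "r 0 v = l0" if "norm v = 1" for v
  proof (rule ccontr)
    have "E v 0 l0 = 0" using l0(2)[OF that] by (simp add: E_def)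
    moreover assume "r 0 v \<noteq> l0"
    ultimately show False
      using mono[OF that, of 0 "r 0 v" l0] mono[OF that, of 0 l0 "r 0 v"] r[OF that, of 0] \<tau> L
      by (cases "r 0 v < l0") auto
  qed
  show ?thesis
  proof (rule that[of \<tau> l0 r r' "C / (q / 2)"])
    show "0 < \<tau>" "\<tau> * M \<le> 1/4" "1/2 < l0" using \<tau> tauM l0 by auto
    fix v :: 'a assume v: "norm v = 1"
    show "r 0 v = l0" by (rule r0[OF v])
    show "excess d l0 0 v = 0" by (rule l0(2)[OF v])
    show "r' 0 v = - excess_slope d 0 l0 l0 0 v / excess_slope d 1 0 l0 0 v"
      by (simp add: r'_def r0[OF v] Gt_def Gl_def)
    show "continuous_on {-\<tau><..<\<tau>} (\<lambda>t. r' t v)"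
    proof -
      have rc: "continuous_on {-\<tau><..<\<tau>} (\<lambda>t. r t v)"
        by (intro continuous_at_imp_continuous_on ballI DERIV_isCont[OF dr[OF v]]) auto
      have im: "(\<lambda>t. (t, r t v)) ` {-\<tau><..<\<tau>} \<subseteq> {-\<tau><..<\<tau>} \<times> {L1..L2}"
        using r[OF v] by auto
      have pc: "continuous_on {-\<tau><..<\<tau>} (\<lambda>t. (t, r t v))" by (intro continuous_intros rc)
      have nz: "Gl (t, r t v, v) \<noteq> 0" if "t \<in> {-\<tau><..<\<tau>}" for t
      proof -
        have "\<bar>t\<bar> < \<tau>" using that by auto
        then have "q / 2 \<le> Gl (t, r t v, v)" using Gl0'[OF v] r[OF v] by blast
        then show ?thesis using q by auto
      qed
      show ?thesis
        unfolding r'_def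
        using continuous_on_compose2[OF contl'[OF v] pc im] continuous_on_compose2[OF contt'[OF v] pc im] nz
        by (intro continuous_intros) auto
    qed
    fix t assume t: "\<bar>t\<bar> < \<tau>"
    show "1/2 < r t v" using r[OF v t] L by auto
    show "((\<lambda>t. r t v) has_real_derivative r' t v) (at t)" by (rule dr[OF v t])
    have "\<bar>r' t v\<bar> = \<bar>Gt (t, r t v, v)\<bar> / \<bar>Gl (t, r t v, v)\<bar>" by (simp add: r'_def abs_divide)
    also have "\<dots> \<le> C / (q / 2)"
    proof (rule frac_le)
      show Cb: "\<bar>Gt (t, r t v, v)\<bar> \<le> C" using C0[OF v t] r[OF v t] by blast
      then show "0 \<le> C" by linarith
      have "q / 2 \<le> Gl (t, r t v, v)" using Gl0'[OF v t] r[OF v t] by blast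
      then show "q / 2 \<le> \<bar>Gl (t, r t v, v)\<bar>" by linarith
    qed (use q in simp)
    finally show "\<bar>r' t v\<bar> \<le> C / (q / 2)" .
    fix s :: real assume s: "0 < s"
    note rr = r[OF v t]
    have rpos: "0 < r t v" using rr L by auto
    consider "s \<le> 1 / L2" | "1 / L1 \<le> s" | "1 / L2 \<le> s" "s \<le> 1 / L1" by linarith
    then show "s *\<^sub>R v \<in> level_set d t \<longleftrightarrow> s \<le> 1 / r t v"
    proof cases
      case 1
      have "1 / L2 \<le> 1 / r t v" using rr L rpos by (intro divide_left_mono) auto
      then show ?thesis using near[OF v t s 1] 1 by (simp add: level_set_def)
    next
      case 2
      have "L1 \<noteq> r t v" using rr E_neg[OF v t] by auto
      then have "1 / r t v < 1 / L1" using rr L by (intro divide_strict_left_mono) auto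
      then show ?thesis using far[OF v t 2] 2 by (simp add: level_set_def)
    next
      case 3
      define l where "l = 1 / s"
      have l: "L1 \<le> l" "l \<le> L2" "0 < l" using 3 s L by (auto simp: l_def field_simps)
      have sl: "s = inverse l" using s by (simp add: l_def)
      have "s *\<^sub>R v \<in> level_set d t \<longleftrightarrow> 0 \<le> E v t l"
      proof -
        have "\<not> l ^ DIM('a) \<le> 0" using zero_less_power[OF l(3)] by (simp only: not_le)
        then show ?thesis
          unfolding Escaled[OF t l(1,2)] using l by (simp add: level_set_def zero_le_mult_iff sl)
      qed
      also have "\<dots> \<longleftrightarrow> r t v \<le> l"
        using mono[OF v t, of l "r t v"] mono[OF v t, of "r t v" l] rr l
        by (cases l "r t v" rule: linorder_cases) auto
      also have "\<dots> \<longleftrightarrow> s \<le> 1 / r t v" using s rpos by (simp add: l_def field_simps)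
      finally show ?thesis .
    qed
  qed
qed

section \<open>Derivative of the normalized volume\<close>


lemma volume_eq_integral:
  assumes "\<bar>t\<bar> * M \<le> 1/4"
  shows "vol (body 1 t) = (\<integral>v. (1 + t * p v) ^ DIM('a) \<partial>cone_measure)"
proof -
  have "ray_measure UNIV v (1 + t * p v) = (1 + t * p v) ^ DIM('a)" for v :: 'a
    using radius_bounds[of 1 t v] assms
    by (simp add: ray_measure_def measure_radial_measure_Ioc)
  then show ?thesis using measure_body_Int[of 1 t UNIV] assms by simp
qed

lemma volume_has_derivative:
  assumes \<tau>: "0 < \<tau>" "\<tau> * M \<le> 1/4"
  defines "W' \<equiv> \<lambda>t. \<integral>v. DIM('a) * (1 + t * p v) ^ (DIM('a) - 1) * p v \<partial>cone_measure"
  shows "\<And>t. \<bar>t\<bar> < \<tau> \<Longrightarrow> ((\<lambda>t. vol (body 1 t)) has_real_derivative W' t) (at t)"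
    and "continuous_on {-\<tau><..<\<tau>} W'"
proof -
  have tM: "\<bar>t\<bar> * M \<le> 1/4" if "\<bar>t\<bar> < \<tau>" for t
    using param_bound[OF that \<tau>(2)] .
  have b: "\<bar>1 + t * p v\<bar> \<le> 2" if "\<bar>t\<bar> < \<tau>" for t v
    using radius_bounds[of 1 t v] tM[OF that] by auto
  have b': "\<bar>DIM('a) * (1 + t * p v) ^ (DIM('a) - 1) * p v\<bar> \<le> DIM('a) * 2 ^ (DIM('a) - 1) * M" if "\<bar>t\<bar> < \<tau>" for t v
  proof -
    have "\<bar>1 + t * p v\<bar> ^ (DIM('a) - 1) \<le> 2 ^ (DIM('a) - 1)"
      by (rule power_mono[OF b[OF that]]) simp
    then show ?thesis
      unfolding abs_mult power_abs using bound M_nonneg by (intro mult_mono mult_nonneg_nonneg) auto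
  qed
  show "((\<lambda>t. vol (body 1 t)) has_real_derivative W' t) (at t)" if t: "\<bar>t\<bar> < \<tau>" for t
  proof -
    have "((\<lambda>t. \<integral>v. (1 + t * p v) ^ DIM('a) \<partial>cone_measure) has_real_derivative W' t) (at t)"
      unfolding W'_def
    proof (rule has_derivative_integral_param(2)[OF cone_measure.finite_measure_axioms t])
      show "integrable cone_measure (\<lambda>v. (1 + s * p v) ^ DIM('a))" if "\<bar>s\<bar> < \<tau>" for s
        using power_mono[OF b[OF that], of _ "DIM('a)"]
        by (intro cone_measure.integrable_const_bound[of _ "2 ^ DIM('a)"] AE_I2) (auto simp: power_abs)
      show "((\<lambda>t. (1 + t * p v) ^ DIM('a)) has_real_derivative DIM('a) * (1 + s * p v) ^ (DIM('a) - 1) * p v) (at s)" for s v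
        by (auto intro!: derivative_eq_intros)
    qed (rule b')
    then show ?thesis
    proof (rule has_field_derivative_transform_within_open[where S="{-\<tau><..<\<tau>}"])
      show "(\<integral>v. (1 + s * p v) ^ DIM('a) \<partial>cone_measure) = vol (body 1 s)" if "s \<in> {-\<tau><..<\<tau>}" for s
        using that by (intro volume_eq_integral[symmetric] tM) auto
    qed (use t in auto)
  qed
  show "continuous_on {-\<tau><..<\<tau>} W'"
    unfolding W'_def
    by (rule continuous_on_integral_param[OF cone_measure.finite_measure_axioms])
       (auto intro!: continuous_intros b'[simplified])
qed

lemma sets_level_set [measurable]: "level_set d t \<in> sets borel"
proof -
  have [measurable]: "(\<lambda>x. overlap 1 t x) \<in> borel_measurable borel" by (rule overlap_measurable)
  show ?thesis unfolding level_set_def by measurable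
qed

text \<open>By Fubini's theorem the integral over \<open>v\<close> can be evaluated first. By rotation invariance the cap
  indicators contribute the same for every direction \<open>u\<close>, namely, up to a factor, the slope in the dilation.\<close>

lemma integral_excess_slope:
  assumes l: "0 < l" and e: "norm e = 1"
  shows "(\<integral>v. excess_slope d 0 l l 0 v \<partial>cone_measure) = l * excess_slope d 1 0 l 0 e * (\<integral>u. p u \<partial>cone_measure)"
proof -
  let ?n = "DIM('a)" and ?w = "vol (cball (0::'a) 1)"
  let ?c = "cap_measure (1 / (2 * l)) e"
  interpret P: pair_sigma_finite "cone_measure :: 'a measure" "cone_measure :: 'a measure" ..
  interpret PF: finite_measure "(cone_measure :: 'a measure) \<Otimes>\<^sub>M (cone_measure :: 'a measure)"
    by (intro finite_measure_pair_measure cone_measure.finite_measure_axioms)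
  let ?g = "\<lambda>v u. ?n * (0 + l * p u) * (l + 0 * p u) ^ (?n - 1) * (cap l 0 v u + cap l 0 (- v) u - d)"
  have capm: "(\<lambda>x. cap l 0 (- fst x) (snd x)) \<in> borel_measurable (borel \<Otimes>\<^sub>M borel)"
    unfolding cap_def by measurable
  have "(\<integral>v. excess_slope d 0 l l 0 v \<partial>cone_measure) = (\<integral>v. (\<integral>u. ?g v u \<partial>cone_measure) \<partial>cone_measure)"
    unfolding excess_slope_def ..
  also have "\<dots> = (\<integral>u. (\<integral>v. ?g v u \<partial>cone_measure) \<partial>cone_measure)"
  proof (rule P.Fubini_integral[symmetric])
    show "integrable (cone_measure \<Otimes>\<^sub>M cone_measure) (\<lambda>(v, u). ?g v u)"
    proof (rule PF.integrable_const_bound[of _ "?n * (l * M) * l ^ (?n - 1) * (2 + \<bar>d\<bar>)"])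
      show "AE x in cone_measure \<Otimes>\<^sub>M cone_measure. norm (case x of (v, u) \<Rightarrow> ?g v u) \<le> ?n * (l * M) * l ^ (?n - 1) * (2 + \<bar>d\<bar>)"
      proof (rule AE_I2, clarify)
        fix v u :: 'a
        have "\<bar>cap l 0 v u + cap l 0 (- v) u - d\<bar> \<le> 2 + \<bar>d\<bar>"
          using cap_bounds[of l 0 v u] cap_bounds[of l 0 "- v" u] by linarith
        then show "norm (?g v u) \<le> ?n * (l * M) * l ^ (?n - 1) * (2 + \<bar>d\<bar>)"
          unfolding real_norm_def abs_mult power_abs using l bound[of u] M_nonneg
          by (intro mult_mono power_mono mult_nonneg_nonneg) (auto simp: abs_mult)
      qed
      show "(\<lambda>(v, u). ?g v u) \<in> borel_measurable (cone_measure \<Otimes>\<^sub>M cone_measure)"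
        using cap_measurable_pair[of l 0] capm unfolding case_prod_beta by measurable
    qed
  qed
  also have "\<dots> = (\<integral>u. (?n * l ^ ?n * (2 * ?c - d * ?w)) * p u \<partial>cone_measure)"
  proof (rule integral_cong_AE)
    show "(\<lambda>u. \<integral>v. ?g v u \<partial>cone_measure) \<in> borel_measurable cone_measure"
    proof (rule cone_measure.borel_measurable_lebesgue_integral)
      show "(\<lambda>(u, v). ?g v u) \<in> borel_measurable (cone_measure \<Otimes>\<^sub>M cone_measure)"
        unfolding case_prod_beta cap_def by measurable
    qed
    show "AE u in cone_measure. (\<integral>v. ?g v u \<partial>cone_measure) = (?n * l ^ ?n * (2 * ?c - d * ?w)) * p u"
      using AE_cone_measure_norm
    proof eventually_elim
      fix u :: 'a assume u: "norm u = 1"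
      have ii: "integrable cone_measure (indicator {v. 1 / (2 * l) \<le> x \<bullet> v} :: 'a \<Rightarrow> real)" for x :: 'a
        by (intro cone_measure.integrable_const_bound[of _ 1] AE_I2) (auto simp: indicator_def)
      have cu: "cap_measure (1 / (2 * l)) u = ?c" "cap_measure (1 / (2 * l)) (- u) = ?c"
        using u e by (auto intro: cap_measure_rotate)
      have "(\<integral>v. cap l 0 v u + cap l 0 (- v) u - d \<partial>cone_measure)
        = (\<integral>v. indicator {v. 1 / (2 * l) \<le> u \<bullet> v} v + indicator {v. 1 / (2 * l) \<le> - u \<bullet> v} v - d \<partial>cone_measure)"
      proof (rule integral_cong_AE)
        show "AE v in cone_measure. cap l 0 v u + cap l 0 (- v) u - d = indicator {v. 1 / (2 * l) \<le> u \<bullet> v} v + indicator {v. 1 / (2 * l) \<le> - u \<bullet> v} v - d"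
          using AE_cone_measure_norm
          by eventually_elim (use l u in \<open>simp add: cap_0 indicator_def inner_commute\<close>)
        show "(\<lambda>v. cap l 0 v u + cap l 0 (- v) u - d) \<in> borel_measurable cone_measure"
          unfolding cap_def by measurable
      qed measurable
      also have "\<dots> = 2 * ?c - d * ?w"
        using cu ii[of u] ii[of "- u"] by (simp add: cap_measure_def measure_cone_measure_UNIV)
      finally have i: "(\<integral>v. cap l 0 v u + cap l 0 (- v) u - d \<partial>cone_measure) = 2 * ?c - d * ?w" .
      have "l * l ^ (?n - 1) = l ^ ?n" by (simp add: power_eq_if)
      then show "(\<integral>v. ?g v u \<partial>cone_measure) = (?n * l ^ ?n * (2 * ?c - d * ?w)) * p u"
        using i by (simp add: mult_ac)
    qed
  qed simp
  also have "\<dots> = (?n * l ^ ?n * (2 * ?c - d * ?w)) * (\<integral>u. p u \<partial>cone_measure)" by simp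
  also have "?n * l ^ ?n * (2 * ?c - d * ?w) = l * excess_slope d 1 0 l 0 e"
  proof -
    have "l * l ^ (?n - 1) = l ^ ?n" by (simp add: power_eq_if)
    then show ?thesis using excess_slope_ball[OF l e, of d] by (simp add: mult_ac)
  qed
  finally show ?thesis .
qed

text \<open>With \<open>V\<close> and \<open>W\<close> the volumes of the level set and of the body, at \<open>t = 0\<close> both logarithmic
  derivatives equal the dimension times the mean of \<open>p\<close> over the sphere.\<close>

lemma level_set_ratio_has_derivative:
  assumes d: "0 < d" "d < 1"
  obtains \<tau> Q where "0 < \<tau>" "\<tau> * M \<le> 1/4"
    "\<And>t. \<bar>t\<bar> < \<tau> \<Longrightarrow> ((\<lambda>t. vol (level_set d t) / vol (body 1 t)) has_real_derivative Q t) (at t)"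
    "continuous_on {-\<tau><..<\<tau>} Q" "Q 0 = 0"
proof -
  let ?n = "DIM('a)" and ?w = "vol (cball (0::'a) 1)"
  obtain \<tau> r r' l0 C where \<tau>: "0 < \<tau>" "\<tau> * M \<le> 1/4" and l0: "1/2 < l0"
    and r: "\<And>t v. \<bar>t\<bar> < \<tau> \<Longrightarrow> norm v = 1 \<Longrightarrow> 1/2 < r t v"
    and mem: "\<And>t v s. \<bar>t\<bar> < \<tau> \<Longrightarrow> norm v = 1 \<Longrightarrow> 0 < s \<Longrightarrow> s *\<^sub>R v \<in> level_set d t \<longleftrightarrow> s \<le> 1 / r t v"
    and dr: "\<And>t v. \<bar>t\<bar> < \<tau> \<Longrightarrow> norm v = 1 \<Longrightarrow> ((\<lambda>t. r t v) has_real_derivative r' t v) (at t)"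
    and C: "\<And>t v. \<bar>t\<bar> < \<tau> \<Longrightarrow> norm v = 1 \<Longrightarrow> \<bar>r' t v\<bar> \<le> C"
    and cont: "\<And>v. norm v = 1 \<Longrightarrow> continuous_on {-\<tau><..<\<tau>} (\<lambda>t. r' t v)"
    and r0: "\<And>v. norm v = 1 \<Longrightarrow> r 0 v = l0"
    and r'0: "\<And>v. norm v = 1 \<Longrightarrow> r' 0 v = - excess_slope d 0 l0 l0 0 v / excess_slope d 1 0 l0 0 v"
    and ex0: "\<And>v. norm v = 1 \<Longrightarrow> excess d l0 0 v = 0"
    by (rule level_set_radius[OF d]) blast
  obtain e0 :: 'a where e0: "norm e0 = 1" using nonempty_Basis norm_Basis by blast
  have C0: "0 \<le> C" using C[of 0 e0] \<tau> e0 by simp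
  \<comment> \<open>The value \<open>0\<close> off the sphere does not affect the integrals and makes \<open>f\<close> differentiable in \<open>t\<close> everywhere.\<close>
  define f where "f t v = (if norm v = 1 then (1 / r t v) ^ ?n else 0)" for t v
  define f' where "f' t v = (if norm v = 1 then - (?n * (1 / r t v) ^ (?n - 1) * (r' t v / (r t v)\<^sup>2)) else 0)" for t v
  have inv: "0 \<le> 1 / r t v" "1 / r t v \<le> 2" if "\<bar>t\<bar> < \<tau>" "norm v = 1" for t v
    using r[OF that] by (auto simp: field_simps)
  have ray: "emeasure (radial_measure ?n) {s. s *\<^sub>R v \<in> level_set d t} = ennreal ((1 / r t v) ^ ?n)"
    if "\<bar>t\<bar> < \<tau>" "norm v = 1" for t v
  proof -
    have "emeasure (radial_measure ?n) {s. s *\<^sub>R v \<in> level_set d t} = emeasure (radial_measure ?n) {0<..1 / r t v}"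
      by (rule emeasure_eq_AE, use AE_radial_measure_pos in eventually_elim) (auto simp: mem[OF that])
    then show ?thesis using inv[OF that] by (simp add: emeasure_radial_measure_Ioc power_0_left)
  qed
  have fm: "f t \<in> borel_measurable cone_measure" if t: "\<bar>t\<bar> < \<tau>" for t
  proof -
    have "f t = (\<lambda>v. if norm v = 1 then enn2real (emeasure (radial_measure ?n) {s. s *\<^sub>R v \<in> level_set d t}) else 0)"
      using ray[OF t] inv[OF t] by (auto simp: f_def fun_eq_iff simp del: power_one_over)
    also have "\<dots> \<in> borel_measurable cone_measure" by measurable
    finally show ?thesis .
  qed
  have fb: "\<bar>f t v\<bar> \<le> 2 ^ ?n" if "\<bar>t\<bar> < \<tau>" for t v
    using inv[OF that, of v] power_mono[of "1 / r t v" 2 ?n] by (auto simp: f_def simp del: power_one_over)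
  have fint: "integrable cone_measure (f t)" if "\<bar>t\<bar> < \<tau>" for t
    using fm[OF that] fb[OF that] by (intro cone_measure.integrable_const_bound[of _ "2 ^ ?n"]) auto
  have V: "vol (level_set d t) = (\<integral>v. f t v \<partial>cone_measure)" if t: "\<bar>t\<bar> < \<tau>" for t
  proof -
    have "emeasure lborel (level_set d t) = (\<integral>\<^sup>+v. emeasure (radial_measure ?n) {s. s *\<^sub>R v \<in> level_set d t} \<partial>cone_measure)"
      by (rule emeasure_lborel_polar) measurable
    also have "\<dots> = (\<integral>\<^sup>+v. ennreal (f t v) \<partial>cone_measure)"
      by (rule nn_integral_cong_AE, use AE_cone_measure_norm in eventually_elim) (simp add: f_def ray[OF t])
    also have "\<dots> = ennreal (\<integral>v. f t v \<partial>cone_measure)"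
      using inv[OF t] by (intro nn_integral_eq_integral fint t) (auto simp: f_def simp del: power_one_over)
    finally show ?thesis
      using inv[OF t] by (simp add: measure_def integral_nonneg_AE f_def del: power_one_over)
  qed
  have df: "((\<lambda>t. f t v) has_real_derivative f' t v) (at t)" if t: "\<bar>t\<bar> < \<tau>" for t v
  proof (cases "norm v = 1")
    case True
    have "((\<lambda>t. (1 / r t v) ^ ?n) has_real_derivative ?n * (1 / r t v) ^ (?n - 1) * (- (r' t v / (r t v)\<^sup>2))) (at t)"
      using r[OF t True] by (auto intro!: derivative_eq_intros dr[OF t True] simp: power2_eq_square)
    then show ?thesis using True by (simp add: f_def f'_def)
  qed (simp add: f_def f'_def)
  have fb': "\<bar>f' t v\<bar> \<le> ?n * 2 ^ (?n - 1) * (C * 4)" if t: "\<bar>t\<bar> < \<tau>" for t v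
  proof (cases "norm v = 1")
    case True
    have "\<bar>r' t v / (r t v)\<^sup>2\<bar> = \<bar>r' t v\<bar> * (1 / r t v)\<^sup>2" using r[OF t True] by (simp add: abs_divide power_divide)
    also have "\<dots> \<le> C * 2\<^sup>2" using C[OF t True] inv[OF t True] C0 by (intro mult_mono power_mono) auto
    finally have 1: "\<bar>r' t v / (r t v)\<^sup>2\<bar> \<le> C * 4" by simp
    have "\<bar>f' t v\<bar> = ?n * \<bar>1 / r t v\<bar> ^ (?n - 1) * \<bar>r' t v / (r t v)\<^sup>2\<bar>"
      using True by (simp add: f'_def abs_mult power_abs)
    also have "\<dots> \<le> ?n * 2 ^ (?n - 1) * (C * 4)"
    proof -
      have "\<bar>1 / r t v\<bar> ^ (?n - 1) \<le> 2 ^ (?n - 1)"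
        using inv[OF t True] by (intro power_mono) auto
      then show ?thesis using 1 by (intro mult_mono mult_nonneg_nonneg) auto
    qed
    finally show ?thesis .
  qed (simp add: f'_def C0)
  have f'c: "continuous_on {-\<tau><..<\<tau>} (\<lambda>t. f' t v)" for v
  proof (cases "norm v = 1")
    case True
    have rc: "continuous_on {-\<tau><..<\<tau>} (\<lambda>t. r t v)"
      by (intro continuous_at_imp_continuous_on ballI DERIV_isCont[OF dr[OF _ True]]) auto
    have "r t v \<noteq> 0" if "t \<in> {-\<tau><..<\<tau>}" for t
    proof -
      have "\<bar>t\<bar> < \<tau>" using that by auto
      then show ?thesis using r[OF _ True, of t] by auto
    qed
    then show ?thesis unfolding f'_def using True by (auto intro!: continuous_intros rc cont[OF True])
  qed (simp add: f'_def)
  define V' where "V' t = (\<integral>v. f' t v \<partial>cone_measure)" for t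
  define W' where "W' t = (\<integral>v. ?n * (1 + t * p v) ^ (?n - 1) * p v \<partial>cone_measure)" for t
  have f'm: "f' t \<in> borel_measurable cone_measure" if "\<bar>t\<bar> < \<tau>" for t
    by (rule has_derivative_integral_param(1)[OF cone_measure.finite_measure_axioms that fint df fb'])
  have dV: "((\<lambda>t. vol (level_set d t)) has_real_derivative V' t) (at t)" if t: "\<bar>t\<bar> < \<tau>" for t
  proof -
    have "((\<lambda>t. \<integral>v. f t v \<partial>cone_measure) has_real_derivative V' t) (at t)"
      unfolding V'_def
      by (rule has_derivative_integral_param(2)[OF cone_measure.finite_measure_axioms t fint df fb'])
    then show ?thesis
      by (rule has_field_derivative_transform_within_open[where S="{-\<tau><..<\<tau>}"]) (use t V in auto)
  qed
  have cV: "continuous_on {-\<tau><..<\<tau>} V'"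
    unfolding V'_def
    by (rule continuous_on_integral_param[OF cone_measure.finite_measure_axioms _ f'c]) (auto intro!: f'm fb')
  note dW = volume_has_derivative(1)[OF \<tau>, folded W'_def] and cW = volume_has_derivative(2)[OF \<tau>, folded W'_def]
  have tM: "\<bar>t\<bar> * M \<le> 1/4" if "\<bar>t\<bar> < \<tau>" for t
    using param_bound[OF that \<tau>(2)] .
  have w: "0 < ?w" by (rule content_cball_pos) simp
  have Wpos: "0 < vol (body 1 t)" if "\<bar>t\<bar> < \<tau>" for t
  proof -
    have "0 < (1 - 1/4) ^ ?n * ?w" using w by simp
    also have "\<dots> \<le> vol (body 1 t)" using tM[OF that] by (intro volume_bounds) auto
    finally show ?thesis .
  qed
  define Q where "Q t = (V' t * vol (body 1 t) - vol (level_set d t) * W' t) /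
     (vol (body 1 t) * vol (body 1 t))" for t
  show ?thesis
  proof (rule that[OF \<tau>])
    show "((\<lambda>t. vol (level_set d t) / vol (body 1 t)) has_real_derivative Q t) (at t)" if "\<bar>t\<bar> < \<tau>" for t
      unfolding Q_def using Wpos[OF that] by (intro DERIV_divide dV dW that) auto
    have cc: "continuous_on {-\<tau><..<\<tau>} (\<lambda>t. vol (level_set d t))" "continuous_on {-\<tau><..<\<tau>} (\<lambda>t. vol (body 1 t))"
      by (intro continuous_at_imp_continuous_on ballI DERIV_isCont[OF dV] DERIV_isCont[OF dW]; auto)+
    have nz: "vol (body 1 t) \<noteq> 0" if "t \<in> {-\<tau><..<\<tau>}" for t
    proof -
      have "\<bar>t\<bar> < \<tau>" using that by auto
      then show ?thesis using Wpos by fastforce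
    qed
    show "continuous_on {-\<tau><..<\<tau>} Q"
      unfolding Q_def[abs_def] using nz by (intro continuous_intros cV cW cc) auto
    show "Q 0 = 0"
    proof -
      let ?J = "\<integral>u. p u \<partial>cone_measure"
      define q where "q = excess_slope d 1 0 l0 0 e0"
      have q: "0 < q" unfolding q_def by (rule excess_slope_ball_pos[OF l0 e0 ex0[OF e0]])
      have qv: "excess_slope d 1 0 l0 0 v = q" if "norm v = 1" for v :: 'a
        using excess_slope_ball_rotate[of l0 v e0 d] that e0 l0 by (simp add: q_def)
      have W0: "vol (body 1 0) = ?w" by (simp add: body_0)
      have W'0: "W' 0 = ?n * ?J" by (simp add: W'_def)
      have "V' 0 = (\<integral>v. ?n * (1 / l0) ^ (?n - 1) / (l0\<^sup>2 * q) * excess_slope d 0 l0 l0 0 v \<partial>cone_measure)"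
        unfolding V'_def
      proof (rule integral_cong_AE)
        show "f' 0 \<in> borel_measurable cone_measure" using f'm[of 0] \<tau> by simp
        show "(\<lambda>v. ?n * (1 / l0) ^ (?n - 1) / (l0\<^sup>2 * q) * excess_slope d 0 l0 l0 0 v) \<in> borel_measurable cone_measure"
        proof -
          have "(\<lambda>v. excess_slope d 0 l0 l0 0 v) \<in> borel_measurable cone_measure"
            unfolding excess_slope_def
          proof (rule cone_measure.borel_measurable_lebesgue_integral)
            show "(\<lambda>(v, u). ?n * (0 + l0 * p u) * (l0 + 0 * p u) ^ (?n - 1) * (cap l0 0 v u + cap l0 0 (- v) u - d))
               \<in> borel_measurable (cone_measure \<Otimes>\<^sub>M cone_measure)"
              unfolding case_prod_beta cap_def by measurable
          qed
          then show ?thesis by simp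
        qed
        show "AE v in cone_measure. f' 0 v = ?n * (1 / l0) ^ (?n - 1) / (l0\<^sup>2 * q) * excess_slope d 0 l0 l0 0 v"
          using AE_cone_measure_norm
          by eventually_elim (simp add: f'_def r0 r'0 qv divide_simps)
      qed
      also have "\<dots> = ?n * (1 / l0) ^ (?n - 1) / (l0\<^sup>2 * q) * (l0 * q * ?J)"
        using integral_excess_slope[of l0 e0 d] l0 e0 by (simp add: q_def)
      also have "\<dots> = ?n * (1 / l0) ^ ?n * ?J"
      proof -
        have "(1 / l0) ^ ?n = (1 / l0) * (1 / l0) ^ (?n - 1)" by (simp add: power_eq_if)
        then show ?thesis using q l0 by (simp add: power2_eq_square field_simps)
      qed
      finally have V'0: "V' 0 = ?n * (1 / l0) ^ ?n * ?J" .
      have "vol (level_set d 0) = (\<integral>v. f 0 v \<partial>cone_measure)" using V[of 0] \<tau> by simp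
      also have "\<dots> = (\<integral>v. (1 / l0) ^ ?n \<partial>(cone_measure :: 'a measure))"
      proof (rule integral_cong_AE)
        show "f 0 \<in> borel_measurable cone_measure" using fm[of 0] \<tau> by simp
        show "AE v in cone_measure. f 0 v = (1 / l0) ^ ?n"
          using AE_cone_measure_norm by eventually_elim (simp add: f_def r0)
      qed simp
      finally have "vol (level_set d 0) = (\<integral>v. (1 / l0) ^ ?n \<partial>(cone_measure :: 'a measure))" .
      then have V0: "vol (level_set d 0) = (1 / l0) ^ ?n * ?w"
        by (simp add: measure_cone_measure_UNIV)
      show ?thesis unfolding Q_def V'0 V0 W0 W'0 by simp
    qed
  qed
qed

end

section \<open>Radial sets with continuously differentiable radial function\<close>

lemma norm_sgn_diff_le:
  fixes x y :: "'a::real_normed_vector"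
  assumes "x \<noteq> 0" "y \<noteq> 0"
  shows "norm x * norm (sgn x - sgn y) \<le> 2 * norm (x - y)"
proof -
  have "norm x *\<^sub>R (sgn x - sgn y) = (x - y) + (norm y - norm x) *\<^sub>R sgn y"
    using assms by (simp add: sgn_div_norm algebra_simps)
  then have "norm x * norm (sgn x - sgn y) = norm ((x - y) + (norm y - norm x) *\<^sub>R sgn y)"
    by (metis abs_norm_cancel norm_scaleR)
  also have "\<dots> \<le> norm (x - y) + \<bar>norm y - norm x\<bar>"
    using assms by (intro order_trans[OF norm_triangle_ineq]) (simp add: norm_sgn)
  also have "\<bar>norm y - norm x\<bar> \<le> norm (x - y)" by (metis norm_minus_commute norm_triangle_ineq3)
  finally show ?thesis by simp
qed

text \<open>The extension of \<open>\<rho>\<close> from the sphere that is constant along rays, cut off linearly near the origin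
  so as to be Lipschitz.\<close>

definition cone_extension :: "('a::euclidean_space \<Rightarrow> real) \<Rightarrow> 'a \<Rightarrow> real" where
  "cone_extension \<rho> y = min 1 (4 * norm y) * \<rho> (sgn y)"

lemma cone_extension_sphere: "norm v = 1 \<Longrightarrow> cone_extension \<rho> v = \<rho> v"
  by (simp add: cone_extension_def sgn_div_norm)

lemma radial_profile_cone_extension:
  fixes \<rho> :: "'a::euclidean_space \<Rightarrow> real"
  assumes M: "\<And>v. norm v = 1 \<Longrightarrow> \<bar>\<rho> v\<bar> \<le> M" and L: "L-lipschitz_on (sphere 0 1) \<rho>"
  shows "radial_profile (cone_extension \<rho>) M (4 * M + 8 * L)"
proof
  obtain e0 :: 'a where "norm e0 = 1" using nonempty_Basis norm_Basis by blast
  then have M0: "0 \<le> M" using M[of e0] by simp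
  have L0: "0 \<le> L" using L by (rule lipschitz_on_nonneg)
  show "0 \<le> 4 * M + 8 * L" using M0 L0 by simp
  have lip0: "\<bar>cone_extension \<rho> x - cone_extension \<rho> 0\<bar> \<le> (4 * M + 8 * L) * norm (x - 0)" for x
  proof (cases "x = 0")
    case False
    have "\<bar>min 1 (4 * norm x) * \<rho> (sgn x)\<bar> \<le> (4 * norm x) * M"
      unfolding abs_mult using False M[of "sgn x"] by (intro mult_mono) (auto simp: norm_sgn)
    also have "\<dots> \<le> (4 * M + 8 * L) * norm x" using L0 by (simp add: algebra_simps)
    finally show ?thesis by (simp add: cone_extension_def)
  qed simp
  have lip1: "\<bar>cone_extension \<rho> x - cone_extension \<rho> y\<bar> \<le> (4 * M + 8 * L) * norm (x - y)"
    if "x \<noteq> 0" "y \<noteq> 0" "norm y \<le> norm x" for x y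
  proof -
    define a b where "a = min 1 (4 * norm x)" and "b = min 1 (4 * norm y)"
    have ab: "\<bar>a - b\<bar> \<le> 4 * norm (x - y)" "0 \<le> b" "b \<le> 4 * norm x"
      using that norm_triangle_ineq3[of x y] by (auto simp: a_def b_def min_def)
    have "\<bar>\<rho> (sgn x) - \<rho> (sgn y)\<bar> \<le> L * norm (sgn x - sgn y)"
      using lipschitz_onD[OF L, of "sgn x" "sgn y"] that by (auto simp: dist_norm norm_sgn)
    then have "b * \<bar>\<rho> (sgn x) - \<rho> (sgn y)\<bar> \<le> (4 * norm x) * (L * norm (sgn x - sgn y))"
      using ab L0 by (intro mult_mono) auto
    also have "\<dots> \<le> 4 * L * (2 * norm (x - y))"
      using mult_left_mono[OF norm_sgn_diff_le[OF that(1,2)], of "4 * L"] L0 by (simp add: mult_ac)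
    finally have 1: "b * \<bar>\<rho> (sgn x) - \<rho> (sgn y)\<bar> \<le> 8 * L * norm (x - y)" by simp
    have 2: "\<bar>a - b\<bar> * \<bar>\<rho> (sgn x)\<bar> \<le> (4 * norm (x - y)) * M"
      using ab M[of "sgn x"] that by (intro mult_mono) (auto simp: norm_sgn)
    have "cone_extension \<rho> x - cone_extension \<rho> y = (a - b) * \<rho> (sgn x) + b * (\<rho> (sgn x) - \<rho> (sgn y))"
      by (simp add: cone_extension_def a_def b_def algebra_simps)
    then have "\<bar>cone_extension \<rho> x - cone_extension \<rho> y\<bar> \<le> \<bar>a - b\<bar> * \<bar>\<rho> (sgn x)\<bar> + b * \<bar>\<rho> (sgn x) - \<rho> (sgn y)\<bar>"
      using abs_triangle_ineq[of "(a - b) * \<rho> (sgn x)" "b * (\<rho> (sgn x) - \<rho> (sgn y))"] ab by (simp add: abs_mult)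
    then show ?thesis using 1 2 by (simp add: algebra_simps)
  qed
  show "\<bar>cone_extension \<rho> x - cone_extension \<rho> y\<bar> \<le> (4 * M + 8 * L) * norm (x - y)" for x y
  proof -
    consider "y = 0" | "x = 0" | "x \<noteq> 0" "y \<noteq> 0" "norm y \<le> norm x" | "x \<noteq> 0" "y \<noteq> 0" "norm x \<le> norm y"
      by linarith
    then show ?thesis
    proof cases
      case 1 then show ?thesis using lip0[of x] by simp
    next
      case 2 then show ?thesis using lip0[of y] by (simp add: abs_minus_commute)
    next
      case 3 then show ?thesis by (rule lip1)
    next
      case 4 then show ?thesis using lip1[of y x] by (simp add: abs_minus_commute norm_minus_commute)
    qed
  qed
  show "\<bar>cone_extension \<rho> y\<bar> \<le> M" for y
  proof (cases "y = 0")
    case False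
    have "\<bar>min 1 (4 * norm y) * \<rho> (sgn y)\<bar> \<le> 1 * M"
      unfolding abs_mult using False M[of "sgn y"] by (intro mult_mono) (auto simp: norm_sgn)
    then show ?thesis by (simp add: cone_extension_def)
  qed (simp add: cone_extension_def M0)
  show "cone_extension \<rho> (sgn y) = cone_extension \<rho> y" if "1/4 \<le> norm y" for y
    using that by (auto simp: cone_extension_def norm_sgn sgn_div_norm[of "sgn y"])
qed

lemma C1_on_compact_lipschitz:
  fixes f :: "real^'n \<Rightarrow> real"
  assumes S: "compact S" and f: "C1_on S f"
  obtains L where "L-lipschitz_on S f"
proof -
  have "local_lipschitz {0::real} S (\<lambda>_. f)"
    unfolding local_lipschitz_def
  proof (intro ballI)
    fix x and t :: real assume x: "x \<in> S"
    obtain U g and g' :: "real^'n \<Rightarrow> (real^'n) \<Rightarrow>\<^sub>L real" where U: "open U" "x \<in> U"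
      and g: "\<And>y. y \<in> U \<Longrightarrow> (g has_derivative blinfun_apply (g' y)) (at y)"
      and g': "continuous_on U g'" and gf: "\<And>y. y \<in> U \<inter> S \<Longrightarrow> g y = f y"
      using f x unfolding C1_on_def by metis
    obtain u1 where u1: "u1 > 0" "cball x u1 \<subseteq> U" using U open_contains_cball by blast
    have "isCont g' x" using g' U continuous_on_eq_continuous_at by blast
    then obtain u2 where u2: "u2 > 0" "\<And>y. dist y x < u2 \<Longrightarrow> dist (g' y) (g' x) < 1"
      unfolding continuous_at_eps_delta by (metis zero_less_one)
    define u where "u = min u1 (u2 / 2)"
    define B where "B = norm (g' x) + 1"
    have u: "0 < u" using u1 u2 by (simp add: u_def)
    have "B-lipschitz_on (cball x u \<inter> S) f"
    proof (rule lipschitz_onI)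
      show "0 \<le> B" by (simp add: B_def)
      fix y z assume yz: "y \<in> cball x u \<inter> S" "z \<in> cball x u \<inter> S"
      have sub: "w \<in> U" "dist w x < u2" if "w \<in> cball x u" for w
        using that u1 u2 by (auto simp: u_def dist_commute)
      have "norm (g y - g z) \<le> B * norm (y - z)"
      proof (rule differentiable_bound[of "cball x u" g "\<lambda>w. blinfun_apply (g' w)"])
        show "(g has_derivative blinfun_apply (g' w)) (at w within cball x u)" if "w \<in> cball x u" for w
          using g sub[OF that] has_derivative_at_withinI by blast
        show "onorm (blinfun_apply (g' w)) \<le> B" if "w \<in> cball x u" for w
        proof -
          have "norm (g' w - g' x) < 1" using u2(2)[OF sub(2)[OF that]] by (simp add: dist_norm)
          then have "norm (g' w) \<le> B" using norm_triangle_sub[of "g' w" "g' x"] by (simp add: B_def)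
          then show ?thesis by (simp add: norm_blinfun.rep_eq)
        qed
      qed (use yz in auto)
      moreover have "g y = f y" "g z = f z" using yz sub by (auto intro!: gf)
      ultimately show "dist (f y) (f z) \<le> B * dist y z" by (simp add: dist_norm)
    qed
    then show "\<exists>u>0. \<exists>L. \<forall>t\<in>cball t u \<inter> {0}. L-lipschitz_on (cball x u \<inter> S) f"
      using u by blast
  qed
  from local_lipschitz_compact_implies_lipschitz[OF this S compact_sing]
  show ?thesis using that by auto
qed

lemma convolution_body_scaled:
  fixes L :: "(real^'n) set"
  assumes c: "0 < c" and L: "L \<in> sets borel"
  shows "convolution_body \<delta> ((\<lambda>x. x /\<^sub>R c) ` L) = {x. c *\<^sub>R x \<in> convolution_body \<delta> L}"
proof -
  have 1: "(\<lambda>x. x /\<^sub>R c) ` L = {y. c *\<^sub>R y \<in> L}"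
  proof (intro set_eqI iffI)
    fix y assume "y \<in> {y. c *\<^sub>R y \<in> L}"
    then show "y \<in> (\<lambda>x. x /\<^sub>R c) ` L" using c by (intro image_eqI[of _ _ "c *\<^sub>R y"]) auto
  qed (use c in auto)
  have tr: "(\<lambda>y. y + x) ` S = {y. y - x \<in> S}" for x and S :: "(real^'n) set"
    by (auto intro: image_eqI[of _ _ "_ - x"])
  define S where "S x = L \<inter> {y. y - c *\<^sub>R x \<in> L}" for x
  have scale: "measure lebesgue {y. c *\<^sub>R y \<in> A} = measure lebesgue A / c ^ CARD('n)"
    if A: "A \<in> sets borel" for A :: "(real^'n) set"
    using measure_lborel_scaled[OF c A] sets_scaled_vimage[OF A, of c] A c
    by (simp add: measure_completion field_simps)
  have S: "S x \<in> sets borel" for x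
    using measurable_sets[of "\<lambda>y. y - c *\<^sub>R x" borel borel L] L by (simp add: S_def vimage_def)
  have "x \<in> convolution_body \<delta> ((\<lambda>x. x /\<^sub>R c) ` L) \<longleftrightarrow> c *\<^sub>R x \<in> convolution_body \<delta> L" for x
  proof -
    have "{y. c *\<^sub>R y \<in> L} \<inter> (\<lambda>y. y + x) ` {y. c *\<^sub>R y \<in> L} = {y. c *\<^sub>R y \<in> S x}"
      unfolding tr by (auto simp: S_def scaleR_diff_right)
    then have "x \<in> convolution_body \<delta> ((\<lambda>x. x /\<^sub>R c) ` L) \<longleftrightarrow>
        \<delta> * (measure lebesgue L / c ^ CARD('n)) \<le> measure lebesgue (S x) / c ^ CARD('n)"
      unfolding convolution_body_def 1 by (simp add: scale[OF L] scale[OF S])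
    also have "\<dots> \<longleftrightarrow> \<delta> * measure lebesgue L \<le> measure lebesgue (S x)"
      using c by (simp add: divide_le_cancel)
    also have "\<dots> \<longleftrightarrow> c *\<^sub>R x \<in> convolution_body \<delta> L"
      by (simp add: convolution_body_def tr S_def)
    finally show ?thesis .
  qed
  then show ?thesis by blast
qed

theorem theorem1p6:
  fixes K :: "(real^'n) set" and \<delta> :: real
  assumes "C1_smooth_radial_set K" and "0 < \<delta>" and "\<delta> < 1"
  defines "f \<equiv> \<lambda>t. measure lebesgue (convolution_body \<delta> (volume_normalized (radial_perturbation K t)))"
  shows "(\<exists>\<epsilon>>0. (\<forall>t\<in>{-\<epsilon><..<\<epsilon>}. \<forall>v\<in>sphere 0 1. 0 < 1 + t * radial_fun K v) \<and>
                f C1_differentiable_on {-\<epsilon><..<\<epsilon>}) \<and>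
         (f has_real_derivative 0) (at 0)"
proof -
  define \<rho> where "\<rho> = radial_fun K"
  have "radial_set K" and C1: "C1_on (sphere 0 1) \<rho>"
    using assms(1) by (auto simp: C1_smooth_radial_set_def \<rho>_def)
  then have cont: "continuous_on (sphere 0 1) \<rho>"
    using is_radial_fun_radial_fun[of K] by (auto simp: is_radial_fun_def \<rho>_def)
  obtain M where "\<forall>v\<in>sphere 0 1. \<bar>\<rho> v\<bar> \<le> M"
    using compact_imp_bounded[OF compact_continuous_image[OF cont compact_sphere]]
    unfolding bounded_iff by auto
  then have M: "\<bar>\<rho> v\<bar> \<le> M" if "norm v = 1" for v using that by simp
  obtain L where L: "L-lipschitz_on (sphere 0 1) \<rho>"
    using C1_on_compact_lipschitz[OF compact_sphere C1] by blast
  define p where "p = cone_extension \<rho>"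
  interpret radial_profile p M "4 * M + 8 * L"
    unfolding p_def by (rule radial_profile_cone_extension[OF M L])
  have p: "p v = \<rho> v" if "norm v = 1" for v using that by (simp add: p_def cone_extension_sphere)
  obtain \<tau> Q where \<tau>: "0 < \<tau>" "\<tau> * M \<le> 1/4"
    and Q: "\<And>t. \<bar>t\<bar> < \<tau> \<Longrightarrow> ((\<lambda>t. vol (level_set \<delta> t) / vol (body 1 t)) has_real_derivative Q t) (at t)"
    "continuous_on {-\<tau><..<\<tau>} Q" "Q 0 = 0"
    using level_set_ratio_has_derivative[OF assms(2,3)] by blast
  have tM: "\<bar>t\<bar> * M \<le> 1/4" if "\<bar>t\<bar> < \<tau>" for t
    using param_bound[OF that \<tau>(2)] .
  have f: "f t = vol (level_set \<delta> t) / vol (body 1 t)" if t: "\<bar>t\<bar> < \<tau>" for t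
  proof -
    have K_t: "radial_perturbation K t = body 1 t"
    proof (rule set_eqI)
      fix y :: "real^'n"
      show "y \<in> radial_perturbation K t \<longleftrightarrow> y \<in> body 1 t"
      proof (cases "y = 0")
        case True
        moreover have "0 \<in> body 1 t" using radius_bounds(1)[of 1 t 0] tM[OF t] by (simp add: body_def)
        ultimately show ?thesis by (simp add: radial_perturbation_def radial_region_def)
      next
        case False
        have "norm (sgn y) = 1" "y = norm y *\<^sub>R sgn y" using False by (auto simp: norm_sgn sgn_div_norm)
        then have "y \<in> body 1 t \<longleftrightarrow> norm y \<le> 1 + t * \<rho> (sgn y)"
          using mem_body_ray[of 1 t "sgn y" "norm y"] tM[OF t] False p by simp
        then show ?thesis
          using False by (simp add: radial_perturbation_def radial_region_def \<rho>_def sgn_div_norm)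
      qed
    qed
    define W where "W = vol (body 1 t)"
    have "0 < (1 - 1/4) ^ DIM(real^'n) * vol (cball (0::real^'n) 1)"
      using content_cball_pos[of 1 "0::real^'n"] by simp
    also have "\<dots> \<le> W" unfolding W_def using tM[OF t] by (intro volume_bounds) auto
    finally have W: "0 < W" .
    define c where "c = root CARD('n) W"
    have c: "0 < c" "c ^ CARD('n) = W" using W by (auto simp: c_def)
    have "convolution_body \<delta> (body 1 t) = level_set \<delta> t"
    proof -
      have "(\<lambda>y. y + x) ` body 1 t = {y. y - x \<in> body 1 t}" for x
        by (auto intro: image_eqI[of _ _ "_ - x"])
      then show ?thesis
        by (simp add: convolution_body_def level_set_def overlap_def measure_completion)
    qed
    then have "convolution_body \<delta> (volume_normalized (body 1 t)) = {x. c *\<^sub>R x \<in> level_set \<delta> t}"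
      using convolution_body_scaled[OF c(1) sets_body, of \<delta> 1 t]
      by (simp add: volume_normalized_def c_def W_def measure_completion)
    then have "f t = vol {x. c *\<^sub>R x \<in> level_set \<delta> t}"
      by (simp add: f_def K_t measure_completion sets_scaled_vimage)
    then show ?thesis
      using measure_lborel_scaled[OF c(1) sets_level_set, of \<delta> t] W c(2) by (simp add: W_def field_simps)
  qed
  have df: "(f has_real_derivative Q t) (at t)" if t: "\<bar>t\<bar> < \<tau>" for t
    by (rule has_field_derivative_transform_within_open[OF Q(1)[OF t], where S="{-\<tau><..<\<tau>}"]) (use t f in auto)
  have "f C1_differentiable_on {-\<tau><..<\<tau>}"
    unfolding C1_differentiable_on_def
    using df Q(2) by (intro exI[of _ Q]) (auto simp: has_real_derivative_iff_has_vector_derivative[symmetric])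
  moreover have "0 < 1 + t * radial_fun K v" if "t \<in> {-\<tau><..<\<tau>}" "v \<in> sphere 0 1" for t v
  proof -
    have "\<bar>t\<bar> < \<tau>" using that by auto
    then show ?thesis using radius_bounds(1)[of 1 t v] tM[of t] p[of v] that by (simp add: \<rho>_def)
  qed
  moreover have "(f has_real_derivative 0) (at 0)" using df[of 0] Q(3) \<tau> by simp
  ultimately show ?thesis using \<tau>(1) by blast
qed

end
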